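(* For every real number $a>0$, $$\pi^4\, m\big((1+v)(1+w)(1+x)+a(1-v)(1-w)(y+z)\big)=4\pi^2\,\mathcal{L}^a_3(1)-2\pi^2\,\mathcal{L}^a_{2:1}(1)+4\big(\mathcal{L}^a_{3,2}(1,1)+\mathcal{L}^a_{3,1:1}(1,1)\big),$$ where the polynomial is in the five variables $v,w,x,y,z$.
   Context: The (logarithmic) Mahler measure of a nonzero polynomial $P\in\mathbb{C}[x_1,\dots,x_n]$ is $m(P)=\frac{1}{(2\pi i)^n}\int_{\mathbb{T}^n}\log|P(x_1,\dots,x_n)|\,\frac{dx_1}{x_1}\cdots\frac{dx_n}{x_n}$, with $\mathbb{T}^n=\{|x_1|=\dots=|x_n|=1\}$. Multiple polylogarithms: $\mathrm{Li}_{n_1,\dots,n_m}(x_1,\dots,x_m)=\sum_{0<k_1<\dots<k_m}\frac{x_1^{k_1}\cdots x_m^{k_m}}{k_1^{n_1}\cdots k_m^{n_m}}$ for $|x_i|<1$, extended by analytic continuation through $$\mathrm{Li}_{n_1,\dots,n_m}(x_1,\dots,x_m)=(-1)^m\,\mathrm{I}_{n_1,\dots,n_m}\big((x_1\cdots x_m)^{-1}:(x_2\cdots x_m)^{-1}:\dots:x_m^{-1}:1\big),$$ where $\mathrm{I}_{n_1,\dots,n_m}(a_1:\dots:a_m:1)$ is the iterated integral from $0$ to $1$ of the sequence of forms $\frac{dt}{t-a_1},\underbrace{\tfrac{dt}{t},\dots,\tfrac{dt}{t}}_{n_1-1},\frac{dt}{t-a_2},\underbrace{\tfrac{dt}{t},\dots,\tfrac{dt}{t}}_{n_2-1},\dots,\frac{dt}{t-a_m},\underbrace{\tfrac{dt}{t},\dots,\tfrac{dt}{t}}_{n_m-1}$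 over $t_1\le t_2\le\dots$ (first form in the innermost variable $t_1$). The integrals are along the real segment $[0,1]$ when no $a_i$ lies in $(0,1)$; when a singularity lies in $(0,1)$, all the integrals are taken along the path $\gamma(\theta)=\frac{e^{i\theta}+1}{2}$, $-\pi\le\theta\le0$, from $0$ to $1$. For real $a>0$ and complex $x,y$: $\mathcal{L}^a_r(x):=\mathrm{Li}_r(xa)-\mathrm{Li}_r(-xa)$; $\ \mathcal{L}^a_{r:1}(x):=\log a\,\big(\mathrm{Li}_r(xa)-\mathrm{Li}_r(-xa)\big)$. Writing $S_{r,s}(b;x,y):=\mathrm{Li}_{r,s}(bx,y/b)-\mathrm{Li}_{r,s}(-bx,y/b)+\mathrm{Li}_{r,s}(bx,-y/b)-\mathrm{Li}_{r,s}(-bx,-y/b)$, $$\mathcal{L}^a_{r,s}(x,y):=S_{r,s}(a;x,y)+S_{r,s}(1/a;x,y),\qquad \mathcal{L}^a_{r,s:1}(x,y):=\log(a)\,S_{r,s}(a;x,y)+\log(1/a)\,S_{r,s}(1/a;x,y).$$ For $a=1$ the terms with factor $\log 1=0$ are read as $0$. *)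

theory Defs
  imports "HOL-Complex_Analysis.Complex_Analysis"
begin

(* Polynomials in n variables enter through the polynomial function they induce; the
   variables are indexed by 0, ..., n - 1. The torus is parametrised by x_j = exp (i t_j)
   with 0 <= t_j <= 2 pi, so that dx_j / x_j = i dt_j and the factors i cancel those in
   1 / (2 pi i)^n. *)
definition mahler_measure :: "nat \<Rightarrow> ((nat \<Rightarrow> complex) \<Rightarrow> complex) \<Rightarrow> real" where
  "mahler_measure n P =
     1 / (2 * pi) ^ n *
     (LINT t:(\<Pi>\<^sub>E j\<in>{..<n}. {0..2 * pi}) | (\<Pi>\<^sub>M j\<in>{..<n}. lborel).
        ln (cmod (P (\<lambda>j. cis (t j)))))"

(* Iterated integral, up to time s, of the forms dt / (t - a) along the path g. The list
   has the OUTERMOST form first: in a # w, the form of a is integrated last. *)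
primrec iterated_integral :: "(real \<Rightarrow> complex) \<Rightarrow> complex list \<Rightarrow> real \<Rightarrow> complex" where
  "iterated_integral g [] s = 1"
| "iterated_integral g (a # w) s =
     integral {0..s}
       (\<lambda>u. iterated_integral g w u / (g u - a) * vector_derivative g (at u within {0..1}))"

(* The indented path is t |-> (exp (i t) + 1) / 2 for -pi <= t <= 0: from 0 to 1 through
   the lower half plane. *)
definition integration_path :: "complex list \<Rightarrow> real \<Rightarrow> complex" where
  "integration_path as =
     (if \<exists>a\<in>set as. a \<in> complex_of_real ` {0<..<1}
      then part_circlepath (1/2) (1/2) (- pi) 0
      else linepath 0 1)"

(* The value I_{n_1, ..., n_m} (a_1 : ... : a_m : 1). The word built by concat lists the
   singularities with the innermost form first, hence the reversal. *)
definition hyperlog :: "nat list \<Rightarrow> complex list \<Rightarrow> complex" where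
  "hyperlog ns as =
     iterated_integral (integration_path as)
       (rev (concat (map2 (\<lambda>n a. a # replicate (n - 1) 0) ns as))) 1"

definition multi_polylog_series :: "nat list \<Rightarrow> complex list \<Rightarrow> complex" where
  "multi_polylog_series ns xs =
     (\<Sum>\<^sub>\<infinity>ks\<in>{ks. length ks = length xs \<and> sorted_wrt (<) ks \<and> (\<forall>k\<in>set ks. 0 < k)}.
        \<Prod>i<length xs. (xs ! i) ^ (ks ! i) / of_nat (ks ! i) ^ (ns ! i))"

definition multi_polylog :: "nat list \<Rightarrow> complex list \<Rightarrow> complex" where
  "multi_polylog ns xs =
     (if \<forall>x\<in>set xs. cmod x < 1 then multi_polylog_series ns xs
      else (- 1) ^ length xs *
           hyperlog ns (map (\<lambda>i. inverse (prod_list (drop i xs))) [0..<length xs]))"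

abbreviation Li1 :: "nat \<Rightarrow> complex \<Rightarrow> complex" where
  "Li1 r x \<equiv> multi_polylog [r] [x]"

abbreviation Li2 :: "nat \<Rightarrow> nat \<Rightarrow> complex \<Rightarrow> complex \<Rightarrow> complex" where
  "Li2 r s x y \<equiv> multi_polylog [r, s] [x, y]"

definition L1 :: "real \<Rightarrow> nat \<Rightarrow> complex \<Rightarrow> complex" where
  "L1 a r x = Li1 r (x * of_real a) - Li1 r (- x * of_real a)"

definition L1_log :: "real \<Rightarrow> nat \<Rightarrow> complex \<Rightarrow> complex" where
  "L1_log a r x = of_real (ln a) * (Li1 r (x * of_real a) - Li1 r (- x * of_real a))"

definition S2 :: "nat \<Rightarrow> nat \<Rightarrow> real \<Rightarrow> complex \<Rightarrow> complex \<Rightarrow> complex" where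
  "S2 r s b x y =
     Li2 r s (of_real b * x) (y / of_real b) - Li2 r s (- of_real b * x) (y / of_real b)
     + Li2 r s (of_real b * x) (- y / of_real b) - Li2 r s (- of_real b * x) (- y / of_real b)"

definition L2 :: "real \<Rightarrow> nat \<Rightarrow> nat \<Rightarrow> complex \<Rightarrow> complex \<Rightarrow> complex" where
  "L2 a r s x y = S2 r s a x y + S2 r s (1 / a) x y"

(* For a = 1 the integrals in S2 3 1 can diverge; the factor ln 1 = 0 makes the terms 0,
   as intended. *)
definition L2_log :: "real \<Rightarrow> nat \<Rightarrow> nat \<Rightarrow> complex \<Rightarrow> complex \<Rightarrow> complex" where
  "L2_log a r s x y =
     of_real (ln a) * S2 r s a x y + of_real (ln (1 / a)) * S2 r s (1 / a) x y"

end

theory Submission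
  imports Defs
begin

text \<open>Both sides of the identity are the same combination of three real integrals. With
$\chi(t) = \mathrm{Li}_3(t) - \mathrm{Li}_3(-t)$ put
$I_b = \int_0^1 \chi(t) (\ln t - \ln b) \frac{2b}{t^2 - b^2} dt$ and
$H = \int_0^1 - \ln t (\ln t + \ln a) \frac{a}{(at)^2 - 1} dt$; the common value is
$4 (I_a + I_{1/a}) + 4 \pi^2 H$.

The Mahler measure is a mean over five independent angles. A rotation of $z$ and Jensen's formula
in $y$ (\<open>nn_integral_Jensen_pair\<close>) turn it into the mean of $\ln^+ (a T_1 T_2 R)$, where $T_1$
and $T_2$ are tangents of angles uniform in $[0, \pi/2]$ and $R$ is a quotient of two cosines of
such angles. The mean of $\ln^+ (\alpha R)$ is $\frac{2}{\pi^2} \chi(\alpha)$ for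
$\alpha \le 1$ (\<open>cos_ratio_mean_le_1\<close>), and the case $\alpha \ge 1$ is reduced to it by the
symmetry between $R$ and $1/R$ (\<open>cos_ratio_mean_ge_1\<close>). The product $T_1 T_2$ has the density
$\frac{4}{\pi^2} \frac{\ln x}{x^2 - 1}$ (\<open>nn_integral_tan_tan\<close>), which has the same symmetry.
Integrating, the part $a T_1 T_2 \le 1$ gives $I_a$, and the part $a T_1 T_2 > 1$ gives
$I_{1/a}$ and $H$ (\<open>nn_integral_cos_ratio_mean_tan_tan\<close>). Since $\ln |P|$ is unbounded
below, these means are computed for the nonnegative function $K - \ln |P|$, where Tonelli's
theorem applies and integrability comes out as a result (\<open>nn_integral_mahler_deficit\<close>).

On the polylogarithmic side, integration by parts absorbs each outer form $dt/t$ of an iterated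
integral into a logarithm (\<open>integral_by_parts_Ln\<close>). The terms of type $3,2$ and $3,1$ then
combine, for one singularity $\beta$ with $|\beta| = b$, to the integral of
$(\mathrm{Ln}\, z - \ln b) \mathrm{Li}_3(\pm z) / (z - \beta)$. This is the reason for the
terms with a factor $\ln a$: they make the numerator vanish at $z = b$, so the only pole that can
lie on $(0,1)$ is removable, and Cauchy's theorem moves the indented path to the segment
(\<open>integral_indented_eq_segment\<close>). The result is the real number $I_b$
(\<open>S2_eq_integral\<close>). The same cancellation in $\mathcal{L}^a_3 - \frac12 \mathcal{L}^a_{2:1}$
produces $H$ (\<open>L1_eq_integral\<close>).\<close>

section \<open>Polylogarithms in the closed unit disc\<close>

text \<open>For $r > 0$ the term of index 0 vanishes, because \<open>inverse 0 = 0\<close>; starting the sum there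
makes it a power series with the indices and coefficients aligned.\<close>

definition plog :: "nat \<Rightarrow> complex \<Rightarrow> complex" where
  "plog r z = (\<Sum>n. inverse (of_nat n ^ r) * z ^ n)"

lemma plog_coeff_le:
  assumes "norm z \<le> 1" "r \<ge> 2"
  shows "norm (inverse (of_nat n ^ r) * z ^ n :: complex) \<le> norm z * inverse (real n ^ 2)"
proof (cases "n = 0")
  case False
  have "inverse (real n ^ r) \<le> inverse (real n ^ 2)"
    using False assms by (intro le_imp_inverse_le power_increasing) auto
  moreover have "norm z ^ n \<le> norm z ^ 1"
    using False assms by (intro power_decreasing) auto
  ultimately show ?thesis
    using False by (simp add: norm_mult norm_inverse norm_power mult.commute mult_mono)
qed (use assms in \<open>simp add: power_0_left\<close>)

lemma summable_plog:
  assumes "norm z < 1 \<or> norm z \<le> 1 \<and> r \<ge> 2"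
  shows "summable (\<lambda>n. inverse (of_nat n ^ r) * z ^ n :: complex)"
proof (cases "norm z < 1")
  case True
  show ?thesis
  proof (rule summable_comparison_test'[where N=1])
    show "summable (\<lambda>n. norm z ^ n)" using True by simp
    fix n :: nat assume "n \<ge> 1"
    then have "inverse (real n ^ r) \<le> 1" by (simp add: inverse_le_1_iff)
    then show "norm (inverse (of_nat n ^ r) * z ^ n) \<le> norm z ^ n"
      by (simp add: norm_mult norm_inverse norm_power mult_left_le_one_le)
  qed
next
  case False
  show ?thesis
  proof (rule summable_comparison_test')
    show "summable (\<lambda>n. norm z * inverse (real n ^ 2))"
      by (intro summable_mult inverse_power_summable) auto
  qed (rule plog_coeff_le; use False assms in auto)
qed

lemma plog_0 [simp]: "r > 0 \<Longrightarrow> plog r 0 = 0"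
proof -
  assume r: "r > 0"
  have "(\<lambda>n. inverse (of_nat n ^ r) * 0 ^ n :: complex) = (\<lambda>n. 0)"
    using r by (auto simp: fun_eq_iff power_0_left)
  then show ?thesis by (simp add: plog_def)
qed

lemma plog_deriv_powser:
  assumes "norm z < 1"
  shows "(plog (Suc r) has_field_derivative (\<Sum>n. inverse (of_nat (Suc n) ^ r) * z ^ n)) (at z)"
proof -
  define w :: complex where "w = of_real ((norm z + 1) / 2)"
  have w: "norm w < 1" "norm z < norm w" using assms by (auto simp: w_def simp del: of_real_add)
  have "summable (\<lambda>n. inverse (of_nat n ^ Suc r) * w ^ n :: complex)"
    by (rule summable_plog) (use w in auto)
  from termdiffs_strong[OF this w(2)]
  have "((\<lambda>z. \<Sum>n. inverse (of_nat n ^ Suc r) * z ^ n) has_field_derivative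
     (\<Sum>n. diffs (\<lambda>n. inverse (of_nat n ^ Suc r)) n * z ^ n)) (at z)" .
  moreover have "diffs (\<lambda>n. inverse (of_nat n ^ Suc r)) = (\<lambda>n. inverse (of_nat (Suc n) ^ r :: complex))"
    by (auto simp: diffs_def fun_eq_iff field_simps simp del: of_nat_Suc)
  ultimately show ?thesis by (simp add: plog_def[abs_def])
qed

lemma plog_1_deriv:
  assumes "norm z < 1"
  shows "(plog 1 has_field_derivative 1 / (1 - z)) (at z)"
  using plog_deriv_powser[OF assms, of 0] suminf_geometric[OF assms] by simp

text \<open>This is the step $\mathrm{Li}_{r+1}' = \mathrm{Li}_r(z)/z$ that matches one form $dt/t$ of an
iterated integral.\<close>

lemma plog_deriv:
  assumes "norm z < 1" "z \<noteq> 0" "r > 0"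
  shows "(plog (Suc r) has_field_derivative plog r z / z) (at z)"
proof -
  have s: "summable (\<lambda>n. inverse (of_nat n ^ r) * z ^ n :: complex)"
    by (rule summable_plog) (use assms in auto)
  have s': "summable (\<lambda>n. inverse (of_nat (Suc n) ^ r) * z ^ n :: complex)"
  proof -
    have "summable (\<lambda>n. (inverse (of_nat (Suc n) ^ r) * z ^ (Suc n)) / z)"
      using s by (intro summable_divide) (subst summable_Suc_iff)
    then show ?thesis using assms by (simp add: field_simps del: of_nat_Suc)
  qed
  have "plog r z = (\<Sum>n. inverse (of_nat (Suc n) ^ r) * z ^ Suc n)"
    unfolding plog_def using suminf_split_head[OF s] assms by simp
  also have "\<dots> = (\<Sum>n. z * (inverse (of_nat (Suc n) ^ r) * z ^ n))"
    by (simp add: mult_ac)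
  also have "\<dots> = z * (\<Sum>n. inverse (of_nat (Suc n) ^ r) * z ^ n)"
    using s' by (rule suminf_mult)
  finally show ?thesis using plog_deriv_powser[OF assms(1), of r] assms by simp
qed

text \<open>The decay at 0 absorbs the logarithmic singularity that $\mathrm{Ln}\, z$ has there.\<close>

lemma plog_bound:
  assumes "r \<ge> 2"
  shows "\<exists>C\<ge>0. \<forall>z. norm z \<le> 1 \<longrightarrow> norm (plog r z) \<le> C * norm z"
proof (intro exI conjI allI impI)
  have s: "summable (\<lambda>n. inverse (real n ^ 2))" by (rule inverse_power_summable) auto
  show "(\<Sum>n. inverse (real n ^ 2)) \<ge> 0" by (intro suminf_nonneg s) auto
  fix z :: complex assume z: "norm z \<le> 1"
  have "norm (plog r z) \<le> (\<Sum>n. norm z * inverse (real n ^ 2))"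
    unfolding plog_def by (intro norm_suminf_le plog_coeff_le z assms summable_mult s)
  then show "norm (plog r z) \<le> (\<Sum>n. inverse (real n ^ 2)) * norm z"
    using suminf_mult[OF s, of "norm z"] by (simp add: mult.commute)
qed

lemma continuous_on_plog:
  assumes "r \<ge> 2"
  shows "continuous_on (cball 0 1) (plog r)"
proof -
  have "uniform_limit (cball 0 1) (\<lambda>N z. \<Sum>n<N. inverse (of_nat n ^ r) * z ^ n) (plog r) sequentially"
    unfolding plog_def
  proof (rule Weierstrass_m_test)
    show "summable (\<lambda>n. inverse (real n ^ 2))" by (rule inverse_power_summable) auto
    fix n :: nat and z :: complex assume z: "z \<in> cball 0 1"
    then have "norm z * inverse (real n ^ 2) \<le> 1 * inverse (real n ^ 2)"
      by (intro mult_right_mono) auto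
    with plog_coeff_le[of z r n] z assms
    show "norm (inverse (of_nat n ^ r) * z ^ n) \<le> inverse (real n ^ 2)" by auto
  qed
  then show ?thesis
    by (rule uniform_limit_theorem[rotated]) (auto intro!: always_eventually continuous_intros)
qed

lemma continuous_on_plog' [continuous_intros]:
  assumes "r \<ge> 2" "continuous_on S f" "\<And>x. x \<in> S \<Longrightarrow> norm (f x) \<le> 1"
  shows "continuous_on S (\<lambda>x. plog r (f x))"
  by (rule continuous_on_compose2[OF continuous_on_plog[OF assms(1)] assms(2)]) (use assms(3) in auto)

lemma multi_polylog_series_eq_plog:
  assumes "norm z < 1" "r > 0"
  shows "multi_polylog_series [r] [z] = plog r z"
proof -
  define f where "f = (\<lambda>n. inverse (of_nat n ^ r) * z ^ n :: complex)"
  have ns: "summable (\<lambda>n. norm (f n))"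
  proof -
    have "norm (of_real (norm z) :: complex) < 1" using assms by simp
    then have "summable (\<lambda>n. inverse (of_nat n ^ r) * (of_real (norm z)) ^ n :: complex)"
      by (intro summable_plog) auto
    then have "summable (\<lambda>n. Re (inverse (of_nat n ^ r) * (of_real (norm z)) ^ n))"
      by (rule summable_Re)
    also have "(\<lambda>n. Re (inverse (of_nat n ^ r) * (of_real (norm z)) ^ n)) = (\<lambda>n. norm (f n))"
    proof
      fix n
      have "inverse (of_nat n ^ r) * (of_real (norm z)) ^ n = complex_of_real (norm (f n))"
        by (simp add: f_def norm_mult norm_inverse norm_power)
      then show "Re (inverse (of_nat n ^ r) * (of_real (norm z)) ^ n) = norm (f n)" by simp
    qed
    finally show ?thesis .
  qed
  have so: "f summable_on UNIV" by (rule norm_summable_imp_summable_on[OF ns])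
  have bij: "bij_betw (\<lambda>n. [n]) {0<..} {ks :: nat list. length ks = length [z] \<and> sorted_wrt (<) ks \<and> (\<forall>k\<in>set ks. 0 < k)}"
    by (rule bij_betwI[where g = hd]) (auto simp: length_Suc_conv)
  have "multi_polylog_series [r] [z] = (\<Sum>\<^sub>\<infinity>n\<in>{0<..}. f n)"
    unfolding multi_polylog_series_def
    by (subst infsum_reindex_bij_betw[OF bij, symmetric]) (simp add: f_def field_simps)
  also have "\<dots> = (\<Sum>\<^sub>\<infinity>n\<in>UNIV. f n)"
    using assms by (intro infsum_cong_neutral) (auto simp: f_def)
  also have "\<dots> = suminf f" 
    using has_sum_imp_sums[OF has_sum_infsum[OF so]] by (simp add: sums_iff)
  finally show ?thesis by (simp add: plog_def f_def)
qed

section \<open>Iterated integrals along admissible paths\<close>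

lemma integrable_on_continuous_dominated:
  fixes f :: "real \<Rightarrow> complex"
  assumes "continuous_on {a<..<b} f" "k integrable_on {a..b}"
    "\<And>u. a < u \<Longrightarrow> u < b \<Longrightarrow> norm (f u) \<le> k u"
  shows "f integrable_on {a..b}"
proof -
  have "f absolutely_integrable_on {a<..<b}"
  proof (rule measurable_bounded_by_integrable_imp_absolutely_integrable)
    show "f \<in> borel_measurable (lebesgue_on {a<..<b})"
      by (rule continuous_imp_measurable_on_sets_lebesgue[OF assms(1)]) auto
    show "k integrable_on {a<..<b}" using assms(2) by (simp add: integrable_on_Icc_iff_Ioo)
  qed (use assms(3) in auto)
  then show ?thesis
    by (simp add: integrable_on_Icc_iff_Ioo absolutely_integrable_on_def)
qed

text \<open>Every small power of $y$ beats the logarithm; the factor $1 - y$ keeps the zero of $\ln y$ at 1.\<close>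

lemma minus_ln_le:
  fixes y :: real
  assumes "0 < y" "y \<le> 1" "0 < s" "s \<le> 1"
  shows "- ln y \<le> (1 - y) * y powr (- s) / s"
proof -
  have "ln (y powr (- s)) \<le> y powr (- s) - 1" using assms by (intro ln_le_minus_one) auto
  then have "- ln y \<le> (y powr (- s) - 1) / s" using assms by (simp add: ln_powr field_simps)
  also have "y powr (- s) - 1 = (1 - y powr s) * y powr (- s)"
    using assms by (simp add: algebra_simps flip: powr_add)
  also have "y powr 1 \<le> y powr s" using assms by (intro powr_mono') auto
  then have "(1 - y powr s) * y powr (- s) / s \<le> (1 - y) * y powr (- s) / s"
    using assms by (intro divide_right_mono mult_right_mono) auto
  finally show ?thesis .
qed

text \<open>These conditions are common to the two paths of integration. A positive real part keeps the path
away from the cut of \<open>Ln\<close>, and inside the unit disc the polylogarithms are given by their series.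
In the last condition the exponent $-1/4$ is chosen so that even $\mathrm{Ln}^2$ is integrable at 0,
and the factor $1 - u$ compensates a kernel with a pole at the endpoint 1.\<close>

locale hyperlog_path =
  fixes g g' :: "real \<Rightarrow> complex"
  assumes deriv: "\<And>u. (g has_vector_derivative g' u) (at u)"
    and start [simp]: "g 0 = 0" and finish [simp]: "g 1 = 1"
    and cont_deriv: "continuous_on UNIV g'"
    and deriv_bound: "\<And>u. norm (g' u) \<le> 2"
    and Re_pos: "\<And>u. 0 < u \<Longrightarrow> u \<le> 1 \<Longrightarrow> 0 < Re (g u)"
    and norm_ge: "\<And>u. 0 \<le> u \<Longrightarrow> u \<le> 1 \<Longrightarrow> u \<le> norm (g u)"
    and norm_lt: "\<And>u. 0 \<le> u \<Longrightarrow> u < 1 \<Longrightarrow> norm (g u) < 1"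
    and in_disc: "\<And>u. 0 \<le> u \<Longrightarrow> u \<le> 1 \<Longrightarrow> g u \<in> cball (1/2) (1/2)"
    and Ln_bound: "\<And>u. 0 < u \<Longrightarrow> u \<le> 1 \<Longrightarrow> norm (Ln (g u)) \<le> 8 * (1 - u) * u powr (- 1/4)"
begin

lemma cont: "continuous_on S g"
  using deriv has_vector_derivative_continuous continuous_at_imp_continuous_on by blast

lemma cont_deriv': "continuous_on S g'"
  using cont_deriv continuous_on_subset by blast

lemma norm_le: "0 \<le> u \<Longrightarrow> u \<le> 1 \<Longrightarrow> norm (g u) \<le> 1"
  using norm_lt[of u] by (cases "u = 1") auto

lemma nz: "0 < u \<Longrightarrow> u \<le> 1 \<Longrightarrow> g u \<noteq> 0"
  using Re_pos by fastforce

lemma not_nonpos: "0 < u \<Longrightarrow> u \<le> 1 \<Longrightarrow> g u \<notin> \<real>\<^sub>\<le>\<^sub>0"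
  using Re_pos by (fastforce simp: complex_nonpos_Reals_iff)

lemma field_vector_deriv:
  assumes "(F has_field_derivative D) (at (g u))"
  shows "((\<lambda>u. F (g u)) has_vector_derivative g' u * D) (at u)"
  using field_vector_diff_chain_at[OF deriv assms] by (simp add: o_def)

lemma iterated_integral_Cons:
  assumes "0 \<le> s" "s \<le> 1"
  shows "iterated_integral g (a # w) s =
    integral {0..s} (\<lambda>u. iterated_integral g w u / (g u - a) * g' u)"
proof -
  have "vector_derivative g (at u within {0..1}) = g' u" if "u \<in> {0..s}" for u
    using that assms deriv by (intro vector_derivative_at_within_ivl) auto
  then show ?thesis unfolding iterated_integral.simps by (intro integral_cong) simp
qed

declare iterated_integral.simps(2) [simp del]

lemma iterated_integral_plog1:
  assumes c: "c \<noteq> 0" "norm c \<le> 1" and s: "0 \<le> s" "s < 1"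
  shows "iterated_integral g [inverse c] s = - plog 1 (c * g s)"
proof -
  have "((\<lambda>u. 1 / (g u - inverse c) * g' u) has_integral (- plog 1 (c * g s) - (- plog 1 (c * g 0)))) {0..s}"
  proof (rule fundamental_theorem_of_calculus)
    fix u assume u: "u \<in> {0..s}"
    have lt: "norm (c * g u) < 1"
      using norm_lt[of u] u s c mult_left_le_one_le[of "norm (g u)" "norm c"] by (simp add: norm_mult)
    have "((\<lambda>z. - plog 1 (c * z)) has_field_derivative (- (1 / (1 - c * g u) * c))) (at (g u))"
      by (intro derivative_intros DERIV_chain2[where f = "plog 1" and g = "\<lambda>z. c * z", OF plog_1_deriv[OF lt]])
         (auto intro!: derivative_eq_intros)
    from field_vector_deriv[OF this]
    have "((\<lambda>u. - plog 1 (c * g u)) has_vector_derivative g' u * - (1 / (1 - c * g u) * c)) (at u)" .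
    moreover have "c * g u \<noteq> 1" using lt by force
    then have "g' u * - (1 / (1 - c * g u) * c) = 1 / (g u - inverse c) * g' u"
      using c by (simp add: field_simps)
    ultimately show "((\<lambda>u. - plog 1 (c * g u)) has_vector_derivative 1 / (g u - inverse c) * g' u) (at u within {0..s})"
      by (metis has_vector_derivative_at_within)
  qed (use s in auto)
  then show ?thesis using s by (simp add: iterated_integral_Cons integral_unique)
qed

text \<open>The path stays in the unit disc, so the primitives are the polylogarithm series and each further
form $dt/t$ raises the index by one.\<close>

lemma iterated_integral_plog:
  assumes c: "c \<noteq> 0" "norm c \<le> 1" and s: "0 \<le> s" "s \<le> 1"
  shows "iterated_integral g (replicate (Suc r) 0 @ [inverse c]) s = - plog (r + 2) (c * g s)"
  using s
proof (induction r arbitrary: s)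
  have main: "iterated_integral g (0 # w) s = - plog (Suc (Suc r)) (c * g s)"
    if w: "\<And>u. 0 \<le> u \<Longrightarrow> u < 1 \<Longrightarrow> iterated_integral g w u = - plog (Suc r) (c * g u)"
      and s: "0 \<le> s" "s \<le> 1" for s r w
  proof -
    have le: "norm (c * g u) \<le> 1" if "0 \<le> u" "u \<le> 1" for u
      using norm_le[OF that] c by (simp add: norm_mult mult_le_one)
    have lt: "norm (c * g u) < 1" if "0 \<le> u" "u < 1" for u
      using norm_lt[of u] that c mult_left_le_one_le[of "norm (g u)" "norm c"] by (simp add: norm_mult)
    have "((\<lambda>u. - plog (Suc r) (c * g u) / g u * g' u) has_integral
       (- plog (Suc (Suc r)) (c * g s) - (- plog (Suc (Suc r)) (c * g 0)))) {0..s}"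
    proof (rule fundamental_theorem_of_calculus_interior)
      show "continuous_on {0..s} (\<lambda>u. - plog (Suc (Suc r)) (c * g u))"
        using s le by (intro continuous_intros cont) auto
      fix u assume "u \<in> {0<..<s}"
      then have u: "0 < u" "u < 1" using s by auto
      have "((\<lambda>z. - plog (Suc (Suc r)) (c * z)) has_field_derivative
              (- (plog (Suc r) (c * g u) / (c * g u) * c))) (at (g u))"
        by (intro derivative_intros DERIV_chain2[where f = "plog (Suc (Suc r))" and g = "\<lambda>z. c * z", OF plog_deriv])
           (use u lt nz c in \<open>auto intro!: derivative_eq_intros\<close>)
      from field_vector_deriv[OF this]
      show "((\<lambda>u. - plog (Suc (Suc r)) (c * g u)) has_vector_derivative
              - plog (Suc r) (c * g u) / g u * g' u) (at u)"
        using c by (simp add: field_simps)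
    qed (use s in auto)
    then have "((\<lambda>u. - plog (Suc r) (c * g u) / g u * g' u) has_integral - plog (Suc (Suc r)) (c * g s)) {0..s}"
      by simp
    then have "((\<lambda>u. iterated_integral g w u / (g u - 0) * g' u) has_integral - plog (Suc (Suc r)) (c * g s)) {0..s}"
      by (rule has_integral_spike_finite[of "{1}", rotated 2]) (use s w in auto)
    then show ?thesis using s by (simp add: iterated_integral_Cons integral_unique)
  qed
  {
    case 0
    then show ?case using main[of "[inverse c]" 0 s] iterated_integral_plog1[OF c] by simp
  next
    case (Suc r)
    then show ?case using main[of "replicate (Suc r) 0 @ [inverse c]" "Suc r" s] by simp
  }
qed

text \<open>Along the path $dt/t$ is the differential of \<open>Ln\<close>, so $\mathrm{Ln}^{p-1} dt/t$ can be moved onto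
the remaining form. The hypothesis on $f$ admits a kernel with a pole at the endpoint 1: then $M$
grows only logarithmically, and the simple zero of \<open>Ln\<close> at 1 still kills the boundary term.\<close>

lemma integral_by_parts_Ln:
  fixes f :: "real \<Rightarrow> complex"
  assumes f: "continuous_on {0<..<1} f" "\<And>u. 0 < u \<Longrightarrow> u < 1 \<Longrightarrow> norm (f u) \<le> C / (1 - u)"
    and p: "p = 1 \<or> p = 2"
  defines "M \<equiv> \<lambda>u. integral {0..u} f"
  shows "continuous_on {0<..<1} M"
    and "\<And>u. 0 < u \<Longrightarrow> u < 1 \<Longrightarrow> norm (M u) \<le> C * (u / (1 - u) powr (1/2)) / (1/2)"
    and "(\<lambda>u. Ln (g u) ^ p / of_nat p * f u) integrable_on {0..1}"
    and "((\<lambda>u. Ln (g u) ^ (p - 1) * (g' u / g u) * M u) has_integral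
            - integral {0..1} (\<lambda>u. Ln (g u) ^ p / of_nat p * f u)) {0..1}"
proof -
  have C: "C \<ge> 0"
  proof -
    have "0 \<le> norm (f (1/2))" by simp
    also have "\<dots> \<le> C / (1 - 1/2)" by (rule f) auto
    finally show ?thesis by simp
  qed
  have hi: "((\<lambda>v. C / (1 - v)) has_integral (- (C * ln (1 - u)))) {0..u}" if "0 \<le> u" "u < 1" for u
  proof -
    have "((\<lambda>v. C / (1 - v)) has_integral (- (C * ln (1 - u)) - (- (C * ln (1 - 0))))) {0..u}"
      by (rule fundamental_theorem_of_calculus)
         (use that in \<open>auto intro!: derivative_eq_intros simp: has_real_derivative_iff_has_vector_derivative[symmetric]\<close>)
    then show ?thesis by simp
  qed
  have fint: "f integrable_on {0..u}" if "0 \<le> u" "u < 1" for u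
  proof (rule integrable_on_continuous_dominated)
    show "continuous_on {0<..<u} f" using f(1) that by (elim continuous_on_subset) auto
    show "(\<lambda>v. C / (1 - v)) integrable_on {0..u}" using hi[OF that] by blast
  qed (use f(2) that in auto)
  show Mb: "norm (M u) \<le> C * (u / (1 - u) powr (1/2)) / (1/2)" if u: "0 < u" "u < 1" for u
  proof -
    have "norm (M u) = norm (integral {0<..<u} f)"
      by (simp add: M_def integral_open_interval_real)
    also have "\<dots> \<le> integral {0<..<u} (\<lambda>v. C / (1 - v))"
      using fint[of u] hi[of u] u f(2)
      by (intro integral_norm_bound_integral) (auto simp: integrable_on_Icc_iff_Ioo[symmetric])
    also have "\<dots> = C * - ln (1 - u)"
      using hi[of u] u by (simp add: integral_open_interval_real[symmetric] integral_unique)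
    also have "\<dots> \<le> C * ((1 - (1 - u)) * (1 - u) powr (- (1/2)) / (1/2))"
      using u C by (intro mult_left_mono minus_ln_le) auto
    finally show ?thesis by (simp add: powr_minus field_simps)
  qed
  have Md: "(M has_vector_derivative f u) (at u)" if u: "0 < u" "u < 1" for u
  proof -
    define b where "b = (u + 1) / 2"
    have b: "u < b" "b < 1" using u by (auto simp: b_def)
    have "isCont f u" using f(1) u by (simp add: continuous_on_eq_continuous_at)
    then have "(M has_vector_derivative f u) (at u within {0..b})"
      unfolding M_def using fint[of b] b u
      by (intro integral_has_vector_derivative_continuous_at[where S="{}", simplified])
         (auto intro: continuous_at_imp_continuous_at_within)
    then have "(M has_vector_derivative f u) (at u within {0<..<b})"
      by (rule has_vector_derivative_within_subset) auto
    then show ?thesis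
      using has_vector_derivative_within_open[of u "{0<..<b}" M "f u"] u b by simp
  qed
  show "continuous_on {0<..<1} M"
    by (rule continuous_at_imp_continuous_on) (use has_vector_derivative_continuous[OF Md] in simp)
  have contLn: "continuous_on {0<..<1} (\<lambda>u. Ln (g u) ^ p / of_nat p)"
  proof -
    have "continuous_on {0<..<1} (\<lambda>u. Ln (g u))"
      by (rule continuous_on_Ln'[OF cont]) (use not_nonpos in simp)
    then have "continuous_on {0<..<1} (\<lambda>u. Ln (g u) ^ p * (1 / of_nat p))"
      by (intro continuous_on_mult continuous_on_power continuous_on_const)
    then show ?thesis by simp
  qed
  have Hb: "norm (Ln (g u) ^ p / of_nat p) \<le> 64 * (1 - u) * u powr (- 1/2)" if u: "0 < u" "u < 1" for u
  proof -
    have L: "norm (Ln (g u)) \<le> 8 * (1 - u) * u powr (- 1/4)" by (rule Ln_bound) (use u in auto)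
    have l1: "1 \<le> u powr (- 1/4)"
    proof -
      have "u powr 0 \<le> u powr (- 1/4)" by (rule powr_mono') (use u in auto)
      then show ?thesis using u by simp
    qed
    have sq: "u powr (- 1/4) * u powr (- 1/4) = u powr (- 1/2)"
      using powr_add[of u "-1/4" "-1/4"] by simp
    show ?thesis
    proof (cases "p = 1")
      case True
      have "8 * (1 - u) * u powr (- 1/4) \<le> 64 * (1 - u) * (u powr (- 1/4) * u powr (- 1/4))"
        using u l1 by (intro mult_mono mult_right_mono) (auto simp: mult_le_cancel_left1)
      then have "norm (Ln (g u)) \<le> 64 * (1 - u) * u powr (- 1/2)"
        using L unfolding sq by linarith
      then show ?thesis using True by simp
    next
      case False
      then have "norm (Ln (g u) ^ p / of_nat p) \<le> norm (Ln (g u)) ^ 2"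
        using p by (simp add: norm_divide norm_power)
      also have "\<dots> \<le> (8 * (1 - u) * u powr (- 1/4)) ^ 2" using L by (intro power_mono) auto
      also have "\<dots> = 64 * ((1 - u) * (1 - u)) * u powr (- 1/2)"
        unfolding sq[symmetric] power2_eq_square by algebra
      also have "\<dots> \<le> 64 * (1 - u) * u powr (- 1/2)"
      proof (rule mult_right_mono)
        have "(1 - u) * (1 - u) \<le> 1 - u" by (rule mult_left_le) (use u in auto)
        then show "64 * ((1 - u) * (1 - u)) \<le> 64 * (1 - u)" by (rule mult_left_mono) simp
      qed simp
      finally show ?thesis .
    qed
  qed
  show hint: "(\<lambda>u. Ln (g u) ^ p / of_nat p * f u) integrable_on {0..1}"
  proof (rule integrable_on_continuous_dominated)
    show "continuous_on {0<..<1} (\<lambda>u. Ln (g u) ^ p / of_nat p * f u)"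
      by (intro continuous_on_mult contLn f)
    have "(\<lambda>u::real. u powr (- 1/2)) integrable_on {0..1}"
      using has_integral_powr_from_0[of "-1/2" 1] by (auto simp: integrable_on_def)
    then show "(\<lambda>u::real. 64 * C * u powr (- 1/2)) integrable_on {0..1}"
      using integrable_cmul[of "\<lambda>u::real. u powr (- 1/2)" "{0..1}" "64 * C"] by simp
    fix u :: real assume u: "0 < u" "u < 1"
    have "norm (Ln (g u) ^ p / of_nat p * f u) \<le> (64 * (1 - u) * u powr (- 1/2)) * (C / (1 - u))"
      unfolding norm_mult by (intro mult_mono Hb f u) (use u in auto)
    also have "\<dots> = 64 * C * u powr (- 1/2)"
    proof -
      have e: "64 * d * x * (C / d) = 64 * C * x" if "d \<noteq> 0" for d x :: real using that by simp
      show ?thesis by (rule e) (use u in simp)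
    qed
    finally show "norm (Ln (g u) ^ p / of_nat p * f u) \<le> 64 * C * u powr (- 1/2)" .
  qed
  \<comment> \<open>The product whose derivative is integrated, with its limits 0 at both ends filled in.\<close>
  define Psi where "Psi = (\<lambda>u. if u = 0 \<or> u = 1 then 0 else Ln (g u) ^ p / of_nat p * M u)"
  have Psi_b: "norm (Psi u) \<le> 128 * C * (sqrt u * sqrt (1 - u))" if "0 \<le> u" "u \<le> 1" for u
  proof (cases "u = 0 \<or> u = 1")
    case False
    then have u: "0 < u" "u < 1" using that by auto
    have "norm (Psi u) \<le> (64 * (1 - u) * u powr (- 1/2)) * (C * (u / (1 - u) powr (1/2)) / (1/2))"
    proof -
      have "norm (Psi u) = norm (Ln (g u) ^ p / of_nat p) * norm (M u)"
        using False by (simp add: Psi_def norm_mult norm_divide)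
      also have "\<dots> \<le> (64 * (1 - u) * u powr (- 1/2)) * (C * (u / (1 - u) powr (1/2)) / (1/2))"
        using u by (intro mult_mono Hb Mb) auto
      finally show ?thesis .
    qed
    also have "\<dots> = 128 * C * ((u * u powr (-1/2)) * ((1 - u) / (1 - u) powr (1/2)))"
      by (simp only: divide_inverse mult_ac) simp
    also have "u * u powr (-1/2) = sqrt u"
      using u by (simp add: powr_mult_base powr_half_sqrt)
    also have "(1 - u) / (1 - u) powr (1/2) = sqrt (1 - u)"
      using u by (simp add: powr_half_sqrt real_div_sqrt)
    finally show ?thesis .
  qed (auto simp: Psi_def)
  have Psi_cont: "continuous_on {0..1} Psi"
  proof (subst continuous_on_eq_continuous_within, intro ballI)
    fix u :: real assume u: "u \<in> {0..1}"
    show "continuous (at u within {0..1}) Psi"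
    proof (cases "u = 0 \<or> u = 1")
      case True
      have "((\<lambda>u. 128 * C * (sqrt u * sqrt (1 - u))) \<longlongrightarrow> 128 * C * (sqrt u * sqrt (1 - u))) (at u within {0..1})"
        by (intro tendsto_intros)
      then have "((\<lambda>u. 128 * C * (sqrt u * sqrt (1 - u))) \<longlongrightarrow> 0) (at u within {0..1})"
        using True by auto
      then have "(Psi \<longlongrightarrow> 0) (at u within {0..1})"
        by (rule Lim_null_comparison[rotated]) (use Psi_b in \<open>auto simp: eventually_at intro!: exI[of _ 1]\<close>)
      then show ?thesis using True by (auto simp: continuous_within Psi_def)
    next
      case False
      then have u: "u \<in> {0<..<1}" using u by auto
      have "continuous_on {0<..<1} (\<lambda>u. Ln (g u) ^ p / of_nat p * M u)"
        by (intro continuous_on_mult contLn \<open>continuous_on {0<..<1} M\<close>)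
      then have "continuous_on {0<..<1} Psi"
        by (rule continuous_on_eq) (auto simp: Psi_def)
      then show ?thesis using u
        by (simp add: continuous_on_eq_continuous_at continuous_at_imp_continuous_at_within)
    qed
  qed
  have "((\<lambda>u. Ln (g u) ^ (p - 1) * (g' u / g u) * M u + Ln (g u) ^ p / of_nat p * f u)
           has_integral (Psi 1 - Psi 0)) {0..1}"
  proof (rule fundamental_theorem_of_calculus_interior)
    fix u :: real assume u: "u \<in> {0<..<1}"
    have "((\<lambda>z. Ln z ^ p / of_nat p) has_field_derivative Ln (g u) ^ (p - 1) / g u) (at (g u))"
      using u not_nonpos[of u] nz[of u] p by (auto intro!: derivative_eq_intros simp: field_simps)
    from has_vector_derivative_mult[OF field_vector_deriv[OF this] Md]
    have "((\<lambda>u. Ln (g u) ^ p / of_nat p * M u) has_vector_derivative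
       Ln (g u) ^ (p - 1) * (g' u / g u) * M u + Ln (g u) ^ p / of_nat p * f u) (at u)"
      using u by (simp add: algebra_simps)
    then show "(Psi has_vector_derivative
       Ln (g u) ^ (p - 1) * (g' u / g u) * M u + Ln (g u) ^ p / of_nat p * f u) (at u)"
      by (rule has_vector_derivative_transform_within_open[of _ _ _ "{0<..<1}"])
         (use u in \<open>auto simp: Psi_def\<close>)
  qed (use Psi_cont in auto)
  then have "((\<lambda>u. Ln (g u) ^ (p - 1) * (g' u / g u) * M u + Ln (g u) ^ p / of_nat p * f u)
           has_integral 0) {0..1}" by (simp add: Psi_def)
  from has_integral_diff[OF this integrable_integral[OF hint]]
  show "((\<lambda>u. Ln (g u) ^ (p - 1) * (g' u / g u) * M u) has_integral
            - integral {0..1} (\<lambda>u. Ln (g u) ^ p / of_nat p * f u)) {0..1}" by simp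
qed

end

context hyperlog_path
begin

text \<open>The singularity may be the endpoint 1 itself, as long as the distance to it shrinks no faster than
$1 - u$; a simple pole then grows no faster than the integration by parts tolerates.\<close>

definition gap :: "complex \<Rightarrow> bool" where
  "gap \<beta> \<longleftrightarrow> (\<exists>k>0. \<forall>u. 0 \<le> u \<longrightarrow> u < 1 \<longrightarrow> norm (g u - \<beta>) \<ge> k * (1 - u))"

lemma gap_ne: "gap \<beta> \<Longrightarrow> 0 \<le> u \<Longrightarrow> u < 1 \<Longrightarrow> g u \<noteq> \<beta>"
proof
  assume "gap \<beta>" and u: "0 \<le> u" "u < 1" and eq: "g u = \<beta>"
  then obtain k where "k > 0" "norm (g u - \<beta>) \<ge> k * (1 - u)" by (auto simp: gap_def)
  moreover have "k * (1 - u) > 0" using u \<open>k > 0\<close> by simp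
  ultimately show False using eq by simp
qed

lemma kernel_bound:
  assumes \<beta>: "gap \<beta>" and h: "\<And>u. 0 < u \<Longrightarrow> u < 1 \<Longrightarrow> norm (h u) \<le> B" "B \<ge> 0"
  shows "\<exists>C. \<forall>u. 0 < u \<longrightarrow> u < 1 \<longrightarrow> norm (h u / (g u - \<beta>) * g' u) \<le> C / (1 - u)"
proof -
  obtain k where k: "k > 0" "\<And>u. 0 \<le> u \<Longrightarrow> u < 1 \<Longrightarrow> norm (g u - \<beta>) \<ge> k * (1 - u)"
    using \<beta> by (auto simp: gap_def)
  have "norm (h u / (g u - \<beta>) * g' u) \<le> (2 * B / k) / (1 - u)" if u: "0 < u" "u < 1" for u
  proof -
    have pos: "0 < k * (1 - u)" using u k by simp
    have "norm (h u / (g u - \<beta>) * g' u) = norm (h u) / norm (g u - \<beta>) * norm (g' u)"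
      by (simp add: norm_mult norm_divide)
    also have "\<dots> \<le> B / (k * (1 - u)) * 2"
      using u k h pos by (intro mult_mono frac_le deriv_bound) auto
    finally show ?thesis by (simp add: mult_ac)
  qed
  then show ?thesis by blast
qed

text \<open>The three inner forms give $-\mathrm{Li}_3$. In the first integral the outer $dt/t$ becomes a factor
\<open>Ln\<close>. In the second the outermost kernel must be integrable by itself, which fails at $\beta = 1$.\<close>

lemma iterated_integral_Li3_kernel:
  assumes \<beta>: "gap \<beta>" and c: "c \<noteq> 0" "norm c \<le> 1"
  shows "((\<lambda>u. Ln (g u) * (plog 3 (c * g u) / (g u - \<beta>) * g' u)) has_integral
           iterated_integral g [0, \<beta>, 0, 0, inverse c] 1) {0..1}"
    and "\<beta> \<noteq> 1 \<Longrightarrow> ((\<lambda>u. plog 3 (c * g u) / (g u - \<beta>) * g' u) has_integral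
           - iterated_integral g [\<beta>, 0, 0, inverse c] 1) {0..1}"
proof -
  let ?f = "\<lambda>u. - plog 3 (c * g u) / (g u - \<beta>) * g' u"
  have le: "norm (c * g u) \<le> 1" if "0 \<le> u" "u \<le> 1" for u
    using norm_le[OF that] c by (simp add: norm_mult mult_le_one)
  have it: "iterated_integral g [0, 0, inverse c] u = - plog 3 (c * g u)" if "0 \<le> u" "u \<le> 1" for u
    using iterated_integral_plog[OF c that, of 1] by (simp add: numeral_3_eq_3)
  have itb: "iterated_integral g [\<beta>, 0, 0, inverse c] u = integral {0..u} ?f" if u: "0 \<le> u" "u \<le> 1" for u
    unfolding iterated_integral_Cons[OF u] by (rule integral_cong) (use u it in auto)
  have contplog: "continuous_on {0..1} (\<lambda>u. plog 3 (c * g u))"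
    by (intro continuous_intros cont le) auto
  obtain B where B: "B \<ge> 0" "\<And>z. norm z \<le> 1 \<Longrightarrow> norm (plog 3 z) \<le> B * norm z"
    using plog_bound[of 3] by auto
  have "norm (- plog 3 (c * g u)) \<le> B" if "0 < u" "u < 1" for u
  proof -
    have "norm (plog 3 (c * g u)) \<le> B * norm (c * g u)" using B le that by simp
    also have "\<dots> \<le> B * 1" using B le that by (intro mult_left_mono) auto
    finally show ?thesis by simp
  qed
  from kernel_bound[where h = "\<lambda>u. - plog 3 (c * g u)", OF \<beta> this B(1)] obtain C
    where C: "\<And>u. 0 < u \<Longrightarrow> u < 1 \<Longrightarrow> norm (?f u) \<le> C / (1 - u)" by blast
  have contf: "continuous_on {0<..<1} ?f"
    by (intro continuous_intros cont cont_deriv' continuous_on_subset[OF contplog])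
       (use gap_ne[OF \<beta>] in auto)
  from integral_by_parts_Ln(4)[OF contf C, of 1]
  have "((\<lambda>u. g' u / g u * integral {0..u} ?f) has_integral - integral {0..1} (\<lambda>u. Ln (g u) * ?f u)) {0..1}"
    by simp
  then have "((\<lambda>u. iterated_integral g [\<beta>, 0, 0, inverse c] u / (g u - 0) * g' u) has_integral
      - integral {0..1} (\<lambda>u. Ln (g u) * ?f u)) {0..1}"
    by (rule has_integral_eq[rotated]) (simp add: itb)
  then have eq: "iterated_integral g [0, \<beta>, 0, 0, inverse c] 1 = - integral {0..1} (\<lambda>u. Ln (g u) * ?f u)"
    by (simp only: iterated_integral_Cons integral_unique order.refl zero_le_one)
  from integral_by_parts_Ln(3)[OF contf C, of 1]
  have "(\<lambda>u. Ln (g u) * ?f u) integrable_on {0..1}" by simp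
  from has_integral_neg[OF integrable_integral[OF this]] eq
  show "((\<lambda>u. Ln (g u) * (plog 3 (c * g u) / (g u - \<beta>) * g' u)) has_integral
           iterated_integral g [0, \<beta>, 0, 0, inverse c] 1) {0..1}"
    by simp
  assume "\<beta> \<noteq> 1"
  then have "continuous_on {0..1} ?f"
    by (intro continuous_intros cont cont_deriv' contplog)
       (use gap_ne[OF \<beta>] finish in \<open>force simp: less_le\<close>)
  from integrable_integral[OF integrable_continuous_real[OF this]]
  have "(?f has_integral iterated_integral g [\<beta>, 0, 0, inverse c] 1) {0..1}"
    by (simp add: itb)
  from has_integral_neg[OF this]
  show "((\<lambda>u. plog 3 (c * g u) / (g u - \<beta>) * g' u) has_integral
           - iterated_integral g [\<beta>, 0, 0, inverse c] 1) {0..1}" by simp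
qed

text \<open>Two integrations by parts are needed for the second claim: the first one turns the outer $dt/t$
into \<open>Ln\<close>, the second one turns $\mathrm{Ln}\, dt/t$ into $\mathrm{Ln}^2/2$.\<close>

lemma iterated_integral_depth1:
  assumes \<beta>: "gap \<beta>"
  shows "((\<lambda>u. Ln (g u) * (1 / (g u - \<beta>) * g' u)) has_integral
           - iterated_integral g [0, \<beta>] 1) {0..1}"
    and "((\<lambda>u. Ln (g u) ^ 2 / 2 * (1 / (g u - \<beta>) * g' u)) has_integral
           iterated_integral g [0, 0, \<beta>] 1) {0..1}"
proof -
  let ?f = "\<lambda>u. 1 / (g u - \<beta>) * g' u"
  let ?M = "\<lambda>u. integral {0..u} ?f"
  let ?f2 = "\<lambda>u. g' u / g u * ?M u"
  have it: "iterated_integral g [\<beta>] u = integral {0..u} ?f" if "0 \<le> u" "u \<le> 1" for u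
    using iterated_integral_Cons[OF that, of \<beta> "[]"] by simp
  obtain C where C: "\<And>u. 0 < u \<Longrightarrow> u < 1 \<Longrightarrow> norm (?f u) \<le> C / (1 - u)"
    using kernel_bound[OF \<beta>, of "\<lambda>_. 1" 1] by auto
  have C0: "C \<ge> 0" 
  proof -
    have "0 \<le> norm (?f (1/2))" by (rule norm_ge_zero)
    also have "\<dots> \<le> C / (1 - 1/2)" by (rule C) auto
    finally show ?thesis by simp
  qed
  have contf: "continuous_on {0<..<1} ?f"
    by (intro continuous_intros cont cont_deriv') (use gap_ne[OF \<beta>] in auto)
  note bp = integral_by_parts_Ln[OF contf C, of 1]
  have it2: "iterated_integral g [0, \<beta>] u = integral {0..u} ?f2" if u: "0 \<le> u" "u \<le> 1" for u
    unfolding iterated_integral_Cons[OF u, of 0 "[\<beta>]"] by (rule integral_cong) (use u it in auto)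
  have b1: "(?f2 has_integral - integral {0..1} (\<lambda>u. Ln (g u) * ?f u)) {0..1}"
    using bp(4) by simp
  then have eq: "iterated_integral g [0, \<beta>] 1 = - integral {0..1} (\<lambda>u. Ln (g u) * ?f u)"
    by (simp only: it2 integral_unique order.refl zero_le_one)
  have "(\<lambda>u. Ln (g u) * ?f u) integrable_on {0..1}" using bp(3) by simp
  from integrable_integral[OF this] eq
  show "((\<lambda>u. Ln (g u) * (1 / (g u - \<beta>) * g' u)) has_integral
           - iterated_integral g [0, \<beta>] 1) {0..1}" by simp
  have contf2: "continuous_on {0<..<1} ?f2"
    by (intro continuous_on_mult continuous_on_divide cont cont_deriv' bp(1)) (use nz in auto)
  \<comment> \<open>The bound \<open>bp(2)\<close> on the inner integral vanishes linearly at 0, which pays for $1/u$.\<close>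
  have C2: "norm (?f2 u) \<le> (4 * C) / (1 - u)" if u: "0 < u" "u < 1" for u
  proof -
    have "norm (?f2 u) = norm (g' u) / norm (g u) * norm (?M u)"
      by (simp add: norm_mult norm_divide)
    also have "\<dots> \<le> 2 / u * (C * (u / (1 - u) powr (1/2)) / (1/2))"
      using u norm_ge[of u] by (intro mult_mono frac_le deriv_bound bp(2)) auto
    also have "\<dots> = 4 * C / (1 - u) powr (1/2)" using u by (simp add: field_simps)
    also have "\<dots> \<le> 4 * C / (1 - u)"
    proof (rule divide_left_mono)
      have "(1 - u) powr 1 \<le> (1 - u) powr (1/2)" using u by (intro powr_mono') auto
      then show "1 - u \<le> (1 - u) powr (1/2)" using u by simp
    qed (use u C0 in auto)
    finally show ?thesis .
  qed
  have "((\<lambda>u. g' u / g u * integral {0..u} ?f2) has_integral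
           - integral {0..1} (\<lambda>u. Ln (g u) * ?f2 u)) {0..1}"
    using integral_by_parts_Ln(4)[OF contf2 C2, of 1] by simp
  then have "((\<lambda>u. iterated_integral g [0, \<beta>] u / (g u - 0) * g' u) has_integral
      - integral {0..1} (\<lambda>u. Ln (g u) * ?f2 u)) {0..1}"
    by (rule has_integral_eq[rotated]) (simp add: it2)
  then have "iterated_integral g [0, 0, \<beta>] 1 = - integral {0..1} (\<lambda>u. Ln (g u) * ?f2 u)"
    by (simp only: iterated_integral_Cons[of 1 0 "[0, \<beta>]"] integral_unique order.refl zero_le_one)
  also have "(\<lambda>u. Ln (g u) * ?f2 u) = (\<lambda>u. Ln (g u) ^ (2 - 1) * (g' u / g u) * ?M u)"
    by (simp add: mult_ac)
  also have "- integral {0..1} \<dots> = integral {0..1} (\<lambda>u. Ln (g u) ^ 2 / 2 * ?f u)"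
    using integral_unique[OF integral_by_parts_Ln(4)[OF contf C, of 2]] by simp
  finally have eq2: "iterated_integral g [0, 0, \<beta>] 1 = integral {0..1} (\<lambda>u. Ln (g u) ^ 2 / 2 * ?f u)" .
  have "(\<lambda>u. Ln (g u) ^ 2 / 2 * ?f u) integrable_on {0..1}"
    using integral_by_parts_Ln(3)[OF contf C, of 2] by simp
  from integrable_integral[OF this] eq2
  show "((\<lambda>u. Ln (g u) ^ 2 / 2 * (1 / (g u - \<beta>) * g' u)) has_integral
           iterated_integral g [0, 0, \<beta>] 1) {0..1}" by simp
qed

end

section \<open>The segment and the indented path\<close>

text \<open>The sine is concave on $[0, \pi/2]$, hence above its chord.\<close>

lemma sin_ge_chord:
  fixes u :: real
  assumes "0 \<le> u" "u \<le> 1"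
  shows "u \<le> sin (pi / 2 * u)"
proof -
  have "convex_on {0..pi/2} (\<lambda>x. - sin x)"
  proof (rule f''_ge0_imp_convex)
    fix x :: real assume "x \<in> {0..pi/2}"
    then show "0 \<le> sin x" by (intro sin_ge_zero) auto
  qed (auto intro!: derivative_eq_intros)
  from convex_onD[OF this, of u 0 "pi/2"] show ?thesis using assms by (simp add: mult.commute)
qed

interpretation segment: hyperlog_path "linepath 0 1" "\<lambda>_. 1"
proof
  fix u :: real
  show "(linepath 0 1 has_vector_derivative 1) (at u)"
    by (auto simp: linepath_def[abs_def] scaleR_conv_of_real intro!: derivative_eq_intros has_vector_derivative_of_real)
  show "linepath 0 1 u \<in> cball (1/2 :: complex) (1/2)" if "0 \<le> u" "u \<le> 1"
  proof -
    have "dist (1/2) (linepath 0 1 u :: complex) = dist (of_real (1/2)) (of_real u :: complex)"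
      by (simp add: linepath_0 scaleR_conv_of_real)
    also have "\<dots> = \<bar>1/2 - u\<bar>" by (simp only: dist_of_real dist_real_def)
    also have "\<dots> \<le> 1/2" using that by (intro abs_leI) linarith+
    finally show ?thesis by (simp only: mem_cball)
  qed
  assume u: "0 < u" "u \<le> 1"
  have "norm (Ln (of_real u :: complex)) = - ln u"
    using u by (simp add: Ln_of_real)
  also have "\<dots> \<le> (1 - u) * u powr (- (1/4)) / (1/4)" using u by (intro minus_ln_le) auto
  also have "\<dots> \<le> 8 * (1 - u) * u powr (- 1/4)" using u by simp
  finally show "norm (Ln (linepath 0 1 u)) \<le> 8 * (1 - u) * u powr (- 1/4)"
    by (simp add: linepath_0 scaleR_conv_of_real)
qed (auto simp: linepath_def scaleR_conv_of_real dist_norm)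

abbreviation indented_path :: "real \<Rightarrow> complex" where
  "indented_path \<equiv> part_circlepath (1/2) (1/2) (- pi) 0"

abbreviation indented_path_deriv :: "real \<Rightarrow> complex" where
  "indented_path_deriv u \<equiv> \<i> * of_real (pi / 2) * exp (\<i> * of_real (linepath (- pi) 0 u))"

text \<open>The polar form: modulus and logarithm along the path can be read off from it.\<close>

lemma indented_path_eq:
  "indented_path u =
     of_real (sin (pi / 2 * u)) * exp (\<i> * of_real (pi / 2 * (u - 1)))"
proof -
  define x where "x = pi / 2 * u"
  have 1: "linepath (- pi) 0 u = 2 * x - pi" "pi / 2 * (u - 1) = x - pi / 2"
    by (simp_all add: linepath_def x_def field_simps)
  have "indented_path u = 1/2 + 1/2 * cis (2 * x - pi)"
    unfolding part_circlepath_def 1 by (simp add: cis_conv_exp)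
  also have "\<dots> = of_real (sin x) * cis (x - pi / 2)"
  proof -
    have "sin (x - pi / 2) = - cos x" "cos (x - pi / 2) = sin x"
      by (simp_all add: sin_diff cos_diff)
    moreover have "cos (2 * x - pi) = 2 * sin x ^ 2 - 1" "sin (2 * x - pi) = - (2 * sin x * cos x)"
      by (simp_all add: sin_diff cos_diff cos_double_sin sin_double)
    ultimately show ?thesis by (simp add: complex_eq_iff power2_eq_square diff_divide_distrib)
  qed
  finally show ?thesis unfolding 1 x_def by (simp add: cis_conv_exp)
qed

lemma Ln_indented_path:
  assumes "0 < u" "u \<le> 1"
  shows "Ln (indented_path u) =
           of_real (ln (sin (pi / 2 * u))) + \<i> * of_real (pi / 2 * (u - 1))"
proof (rule Ln_unique)
  have "0 < sin (pi / 2 * u)" using sin_ge_chord[of u] assms by simp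
  then show "exp (of_real (ln (sin (pi / 2 * u))) + \<i> * of_real (pi / 2 * (u - 1))) =
     indented_path u"
    unfolding indented_path_eq exp_add exp_of_real by simp
  have "- pi < pi / 2 * (- 1)" using pi_gt_zero by linarith
  also have "\<dots> \<le> pi / 2 * (u - 1)" using assms by (intro mult_left_mono) auto
  finally show "- pi < Im (of_real (ln (sin (pi / 2 * u))) + \<i> * of_real (pi / 2 * (u - 1)))" by simp
  have "pi / 2 * (u - 1) \<le> 0" using assms by (simp add: mult_nonneg_nonpos)
  also have "0 \<le> pi" by simp
  finally show "Im (of_real (ln (sin (pi / 2 * u))) + \<i> * of_real (pi / 2 * (u - 1))) \<le> pi" by simp
qed

interpretation indented: hyperlog_path "indented_path"
  indented_path_deriv
proof
  let ?g = indented_path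
  fix u :: real
  show "(?g has_vector_derivative indented_path_deriv u) (at u)"
    using has_vector_derivative_part_circlepath[of "1/2" "1/2" "-pi" 0 u UNIV] by simp
  show "?g 0 = 0" "?g 1 = 1" unfolding indented_path_eq by auto
  show "continuous_on UNIV indented_path_deriv"
    unfolding linepath_def by (intro continuous_intros)
  show "norm (indented_path_deriv u) \<le> 2"
    using pi_less_4 by (simp add: norm_mult)
  have n: "norm (?g u) = \<bar>sin (pi / 2 * u)\<bar>" unfolding indented_path_eq by (simp add: norm_mult)
  show "u \<le> norm (?g u)" if "0 \<le> u" "u \<le> 1" unfolding n using sin_ge_chord[OF that] by simp
  show "norm (?g u) < 1" if "0 \<le> u" "u < 1"
  proof -
    have "sin (pi / 2 * u) < sin (pi / 2)"
      using that pi_gt_zero by (intro sin_monotone_2pi) (auto intro: order.trans[of _ 0])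
    then show ?thesis unfolding n using sin_ge_chord[of u] that by simp
  qed
  show "?g u \<in> cball (1/2) (1/2)" if "0 \<le> u" "u \<le> 1"
    by (simp add: part_circlepath_def dist_norm norm_mult)
  assume u: "0 < u" "u \<le> 1"
  have s: "u \<le> sin (pi / 2 * u)" by (rule sin_ge_chord) (use u in auto)
  have "Re (?g u) = sin (pi / 2 * u) * cos (pi / 2 * u - pi / 2)"
    unfolding indented_path_eq by (simp add: Re_exp right_diff_distrib)
  also have "cos (pi / 2 * u - pi / 2) = sin (pi / 2 * u)" by (simp add: cos_diff)
  finally show "0 < Re (?g u)" using s u by simp
  have u1: "1 \<le> u powr (- 1/4)"
  proof -
    have "u powr 0 \<le> u powr (- 1/4)" by (rule powr_mono') (use u in auto)
    then show ?thesis using u by simp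
  qed
  have "norm (Ln (?g u)) \<le> \<bar>ln (sin (pi / 2 * u))\<bar> + \<bar>pi / 2 * (u - 1)\<bar>"
    unfolding Ln_indented_path[OF u] by (rule order.trans[OF norm_triangle_ineq]) (simp add: norm_mult del: of_real_mult)
  also have "\<bar>ln (sin (pi / 2 * u))\<bar> = - ln (sin (pi / 2 * u))" using s u by simp
  also have "\<dots> \<le> - ln u" using s u by simp
  also have "\<dots> \<le> (1 - u) * u powr (- (1/4)) / (1/4)" using u by (intro minus_ln_le) auto
  also have "\<bar>pi / 2 * (u - 1)\<bar> \<le> 2 * (1 - u)"
  proof -
    have "\<bar>pi / 2 * (u - 1)\<bar> = pi / 2 * (1 - u)" using u by (simp add: abs_mult)
    also have "\<dots> \<le> 2 * (1 - u)" using u pi_less_4 by (intro mult_right_mono) auto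
    finally show ?thesis .
  qed
  also have "2 * (1 - u) \<le> 2 * (1 - u) * u powr (- 1/4)"
    using u u1 by (simp add: mult_le_cancel_left1)
  finally have "norm (Ln (?g u)) \<le> 6 * ((1 - u) * u powr (- 1/4))" by (simp add: algebra_simps)
  also have "\<dots> \<le> 8 * (1 - u) * u powr (- 1/4)" using u by simp
  finally show "norm (Ln (?g u)) \<le> 8 * (1 - u) * u powr (- 1/4)" .
qed

section \<open>Moving the path to the segment\<close>

context hyperlog_path
begin

text \<open>The value does not depend on the path; it is the correction needed when $\mathrm{Ln}^2 / (z - \beta)$
is too singular at 0 for Cauchy's theorem. It is itself an integration by parts, with inner form
$dt$ and primitive $g$.\<close>

lemma integral_Ln_polynomial:
  "((\<lambda>u. Ln (g u) * (Ln (g u) - x) * g' u) has_integral 2 + x) {0..1}"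
proof -
  have M: "integral {0..u} g' = g u" if "0 \<le> u" for u
  proof -
    have "(g' has_integral g u - g 0) {0..u}"
      by (rule fundamental_theorem_of_calculus[OF that has_vector_derivative_at_within[OF deriv]])
    then show ?thesis by (simp add: integral_unique)
  qed
  have b: "norm (g' u) \<le> 2 / (1 - u)" if "0 < u" "u < 1" for u
  proof -
    have "2 / 1 \<le> 2 / (1 - u)" using that by (intro divide_left_mono) auto
    then show ?thesis using deriv_bound[of u] by linarith
  qed
  note bp = integral_by_parts_Ln[OF cont_deriv' b]
  have "((\<lambda>u. g' u / g u * integral {0..u} g') has_integral - integral {0..1} (\<lambda>u. Ln (g u) * g' u)) {0..1}"
    using bp(4)[of 1] by simp
  then have "(g' has_integral - integral {0..1} (\<lambda>u. Ln (g u) * g' u)) {0..1}"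
    by (rule has_integral_spike_finite[of "{0}", rotated 2]) (simp_all add: nz M)
  moreover have "(g' has_integral 1) {0..1}"
  proof -
    have "(g' has_integral g 1 - g 0) {0..1}"
      by (rule fundamental_theorem_of_calculus[OF zero_le_one has_vector_derivative_at_within[OF deriv]])
    then show ?thesis by simp
  qed
  ultimately have "- integral {0..1} (\<lambda>u. Ln (g u) * g' u) = 1"
    by (rule has_integral_unique)
  then have 1: "integral {0..1} (\<lambda>u. Ln (g u) * g' u) = -1"
    by (simp only: minus_equation_iff[of _ 1])
  have "((\<lambda>u. Ln (g u) * (g' u / g u) * integral {0..u} g') has_integral
      - integral {0..1} (\<lambda>u. Ln (g u) ^ 2 / 2 * g' u)) {0..1}"
    using bp(4)[of 2] by simp
  then have "((\<lambda>u. Ln (g u) * g' u) has_integral - integral {0..1} (\<lambda>u. Ln (g u) ^ 2 / 2 * g' u)) {0..1}"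
    by (rule has_integral_spike_finite[of "{0}", rotated 2]) (simp_all add: nz M)
  from integral_unique[OF this] have 2: "integral {0..1} (\<lambda>u. Ln (g u) ^ 2 / 2 * g' u) = 1"
    unfolding 1 by (metis minus_minus)
  have i1: "((\<lambda>u. Ln (g u) * g' u) has_integral -1) {0..1}"
    using integrable_integral[OF bp(3)[of 1]] 1 by simp
  have i2: "((\<lambda>u. Ln (g u) ^ 2 / 2 * g' u) has_integral 1) {0..1}"
    using integrable_integral[OF bp(3)[of 2]] 2 by simp
  from has_integral_diff[OF has_integral_mult_right[OF i2, of 2] has_integral_mult_right[OF i1, of x]]
  show ?thesis by (simp add: algebra_simps power2_eq_square)
qed

lemma has_integral_primitive:
  assumes "\<And>z. z \<in> cball (1/2) (1/2) \<Longrightarrow> (E has_field_derivative \<phi> z) (at z within cball (1/2) (1/2))"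
  shows "((\<lambda>u. \<phi> (g u) * g' u) has_integral E 1 - E 0) {0..1}"
proof -
  have "((\<lambda>u. \<phi> (g u) * g' u) has_integral (E \<circ> g) 1 - (E \<circ> g) 0) {0..1}"
  proof (rule fundamental_theorem_of_calculus)
    fix u :: real assume u: "u \<in> {0..1}"
    have "(E has_field_derivative \<phi> (g u)) (at (g u) within g ` {0..1})"
      using in_disc u by (intro DERIV_subset[OF assms]) auto
    from field_vector_diff_chain_within[OF has_vector_derivative_at_within[OF deriv] this]
    show "((E \<circ> g) has_vector_derivative \<phi> (g u) * g' u) (at u within {0..1})"
      by (simp add: mult.commute)
  qed simp
  then show ?thesis by simp
qed

end

lemma cball_half_Re_pos:
  assumes "z \<in> cball (1/2) (1/2 :: real)" "z \<noteq> (0::complex)"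
  shows "Re z > 0"
proof -
  have "norm (1/2 - z) \<le> 1/2" using assms(1) unfolding mem_cball dist_norm .
  then have "norm (1/2 - z) ^ 2 \<le> (1/2) ^ 2" by (rule power_mono) (rule norm_ge_zero)
  then have "(1/2 - Re z) ^ 2 + (Im z) ^ 2 \<le> (1/2) ^ 2" unfolding cmod_power2 by simp
  then have "(Re z) ^ 2 + (Im z) ^ 2 \<le> Re z" unfolding power2_diff by (simp add: power_divide)
  moreover have "norm z ^ 2 > 0" using assms(2) by simp
  then have "(Re z) ^ 2 + (Im z) ^ 2 > 0" unfolding cmod_power2 .
  ultimately show ?thesis by linarith
qed

lemma cball_half_norm_le:
  assumes "z \<in> cball (1/2) (1/2 :: real)"
  shows "norm (z::complex) \<le> 1"
proof -
  have "norm (1/2 - z) \<le> 1/2" using assms unfolding mem_cball dist_norm .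
  moreover have "norm z \<le> norm (1/2 :: complex) + norm (z - 1/2)"
    using norm_triangle_ineq[of "1/2" "z - 1/2"] by simp
  moreover have "norm (1/2 :: complex) = 1/2" by simp
  ultimately show ?thesis unfolding norm_minus_commute[of "1/2" z] by linarith
qed

lemma norm_Ln_le:
  assumes "z \<noteq> 0" "norm z \<le> 1"
  shows "norm (Ln z) \<le> 8 * norm z powr (- 1/4)"
proof -
  have p: "norm z > 0" using assms by simp
  have 1: "1 \<le> norm z powr (- 1/4)"
  proof -
    have "norm z powr 0 \<le> norm z powr (- 1/4)" by (rule powr_mono') (use assms in auto)
    then show ?thesis using p by simp
  qed
  have "norm (Ln z) \<le> \<bar>Re (Ln z)\<bar> + \<bar>Im (Ln z)\<bar>" by (rule cmod_le)
  also have "\<bar>Re (Ln z)\<bar> = - ln (norm z)" using assms by simp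
  also have "\<dots> \<le> (1 - norm z) * norm z powr (- (1/4)) / (1/4)"
    using p assms by (intro minus_ln_le) auto
  also have "\<dots> \<le> 1 * norm z powr (- (1/4)) / (1/4)"
    using assms by (intro divide_right_mono mult_right_mono) auto
  also have "\<bar>Im (Ln z)\<bar> \<le> pi"
    using Im_Ln_le_pi[OF assms(1)] mpi_less_Im_Ln[OF assms(1)] by (intro abs_leI) linarith+
  also have "pi \<le> 4 * 1" using pi_less_4 by simp
  also have "4 * 1 \<le> 4 * norm z powr (- 1/4)" using 1 by (intro mult_left_mono) auto
  finally show ?thesis by simp
qed

text \<open>The difference quotient of \<open>Ln\<close> at $b$ extends holomorphically over $b$, and the decay of $l$ at 0
outweighs the logarithm. So the integrand has a primitive on the disc with diameter $[0,1]$, closed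
disc included, and both paths run in it from 0 to 1.\<close>

lemma integral_indented_eq_segment:
  assumes b: "0 < b" "b < 1"
    and cl: "\<And>z. z \<in> cball (1/2) (1/2) \<Longrightarrow> z \<noteq> 0 \<Longrightarrow> continuous (at z within cball (1/2) (1/2)) l"
    and hl: "l holomorphic_on ball (1/2) (1/2)"
    and bl: "\<And>z. norm z \<le> 1 \<Longrightarrow> norm (l z) \<le> C * norm z powr (1/2)"
    and I: "((\<lambda>u. l (indented_path u)
                 * ((Ln (indented_path u) - of_real (ln b))
                      / (indented_path u - of_real b))
                 * indented_path_deriv u) has_integral I) {0..1}"
  shows "((\<lambda>t. l (of_real t) * ((Ln (of_real t) - of_real (ln b)) / (of_real t - of_real b))) has_integral I) {0..1}"
proof -
  let ?S = "cball (1/2) (1/2) :: complex set"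
  \<comment> \<open>The integrand with its removable singularities at $b$ and 0 filled in.\<close>
  define h where "h = (\<lambda>z. if z = of_real b then deriv Ln (of_real b) else (Ln z - Ln (of_real b)) / (z - of_real b))"
  define \<phi> where "\<phi> = (\<lambda>z. if z = 0 then 0 else l z * h z)"
  have lnb: "Ln (of_real b) = of_real (ln b)" using b by (simp add: Ln_of_real)
  have oH: "open {z. 0 < Re z}" by (simp add: open_halfspace_Re_gt)
  have holh: "h holomorphic_on {z. 0 < Re z}"
  proof -
    have "Ln holomorphic_on {z. 0 < Re z}"
      by (rule holomorphic_on_Ln) (auto simp: complex_nonpos_Reals_iff)
    from pole_lemma_open[OF this oH, of "of_real b"] show ?thesis unfolding h_def .
  qed
  have cont: "continuous_on ?S \<phi>"
  proof (subst continuous_on_eq_continuous_within, intro ballI)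
    fix z assume z: "z \<in> ?S"
    show "continuous (at z within ?S) \<phi>"
    proof (cases "z = 0")
      case False
      have c1: "continuous (at z within ?S) h"
        by (rule continuous_at_imp_continuous_at_within,
            rule continuous_on_interior[OF holomorphic_on_imp_continuous_on[OF holh]])
           (use cball_half_Re_pos[OF z False] in \<open>simp only: interior_open[OF oH] mem_Collect_eq\<close>)
      from continuous_mult[OF cl[OF z False] c1] have "continuous (at z within ?S) (\<lambda>z. l z * h z)" .
      then show ?thesis
      proof (rule continuous_transform_within[where \<delta> = "norm z"])
        show "l x * h x = \<phi> x" if "x \<in> ?S" "dist x z < norm z" for x
          using that by (auto simp: \<phi>_def dist_norm)
      qed (use False z in auto)
    next
      case True
      have l0: "(l \<longlongrightarrow> 0) (at 0 within ?S)"
      proof (rule Lim_null_comparison)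
        show "((\<lambda>z. C * norm z powr (1/2)) \<longlongrightarrow> 0) (at 0 within ?S)"
          by (auto intro!: tendsto_eq_intros simp: eventually_at_filter)
        show "\<forall>\<^sub>F z in at 0 within ?S. norm (l z) \<le> C * norm z powr (1/2)"
          unfolding eventually_at_filter by (rule always_eventually) (use bl cball_half_norm_le in blast)
      qed
      have l1: "((\<lambda>z. l z * Ln z) \<longlongrightarrow> 0) (at 0 within ?S)"
      proof (rule Lim_null_comparison)
        show "((\<lambda>z. 8 * C * norm z powr (1/4)) \<longlongrightarrow> 0) (at 0 within ?S)"
          by (auto intro!: tendsto_eq_intros simp: eventually_at_filter)
        have "norm (l z * Ln z) \<le> 8 * C * norm z powr (1/4)" if "z \<in> ?S" "z \<noteq> 0" for z
        proof -
          have n: "norm z \<le> 1" by (rule cball_half_norm_le) fact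
          have "norm (l z * Ln z) \<le> (C * norm z powr (1/2)) * (8 * norm z powr (- 1/4))"
            unfolding norm_mult using that n bl[OF n] order.trans[OF norm_ge_zero bl[OF n]]
            by (intro mult_mono norm_Ln_le) auto
          also have "\<dots> = 8 * C * (norm z powr (1/2) * norm z powr (- 1/4))" by simp
          also have "norm z powr (1/2) * norm z powr (- 1/4) = norm z powr (1/4)"
            using powr_add[of "norm z" "1/2" "-1/4"] by simp
          finally show ?thesis .
        qed
        then show "\<forall>\<^sub>F z in at 0 within ?S. norm (l z * Ln z) \<le> 8 * C * norm z powr (1/4)"
          unfolding eventually_at_filter by (intro always_eventually) blast
      qed
      have "((\<lambda>z. (l z * Ln z - l z * of_real (ln b)) / (z - of_real b)) \<longlongrightarrow> (0 - 0 * of_real (ln b)) / (0 - of_real b)) (at 0 within ?S)"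
        using b by (intro tendsto_intros l0 l1) auto
      then have "((\<lambda>z. (l z * Ln z - l z * of_real (ln b)) / (z - of_real b)) \<longlongrightarrow> 0) (at 0 within ?S)"
        by simp
      then have "(\<phi> \<longlongrightarrow> 0) (at 0 within ?S)"
      proof (rule Lim_transform_within[where d = b])
        show "(l z * Ln z - l z * of_real (ln b)) / (z - of_real b) = \<phi> z"
          if "z \<in> ?S" "0 < dist z 0" "dist z 0 < b" for z
        proof -
          have "z \<noteq> of_real b" using that b by auto
          then show ?thesis using that by (simp add: \<phi>_def h_def lnb right_diff_distrib)
        qed
      qed (use b in auto)
      then show ?thesis using True by (simp add: continuous_within \<phi>_def)
    qed
  qed
  obtain E where E: "\<And>z. z \<in> ?S \<Longrightarrow> (E has_field_derivative \<phi> z) (at z within ?S)"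
  proof (rule holomorphic_convex_primitive[of ?S "{0}" \<phi>])
    fix z assume z: "z \<in> interior ?S - {0}"
    then have z': "z \<in> ball (1/2) (1/2)" "z \<in> ?S" by auto
    have "(\<lambda>z. l z * h z) holomorphic_on ball (1/2) (1/2) \<inter> {z. 0 < Re z}"
      by (intro holomorphic_intros holomorphic_on_subset[OF hl] holomorphic_on_subset[OF holh]) auto
    then have "\<phi> holomorphic_on ball (1/2) (1/2) \<inter> {z. 0 < Re z}"
      by (rule holomorphic_transform) (auto simp: \<phi>_def)
    moreover have "z \<in> ball (1/2) (1/2) \<inter> {z. 0 < Re z}"
      using z z'(1) cball_half_Re_pos[OF z'(2)] by blast
    ultimately show "\<phi> field_differentiable at z"
      using oH by (meson holomorphic_on_imp_differentiable_at open_Int open_ball)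
  qed (use cont in auto)
  have h_ne: "h z = (Ln z - of_real (ln b)) / (z - of_real b)" if "z \<noteq> of_real b" for z
    using that by (simp add: h_def lnb)
  have ne: "indented_path u \<noteq> of_real b" for u
  proof
    assume "indented_path u = of_real b"
    then have "norm (of_real b - 1/2 :: complex) = norm (indented_path u - 1/2 :: complex)" by simp
    also have "\<dots> = 1/2" by (simp add: part_circlepath_def norm_mult)
    also have "of_real b - 1/2 = (of_real (b - 1/2) :: complex)" by simp
    finally show False using b by (simp only: norm_of_real)
  qed
  from indented.has_integral_primitive[OF E]
  have "((\<lambda>u. l (indented_path u)
                 * ((Ln (indented_path u) - of_real (ln b))
                      / (indented_path u - of_real b))
                 * indented_path_deriv u) has_integral E 1 - E 0) {0..1}"
  proof (rule has_integral_spike_finite[of "{0}", rotated 2])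
    fix u :: real assume "u \<in> {0..1} - {0}"
    then have "indented_path u \<noteq> 0" by (intro indented.nz) auto
    then show "l (indented_path u)
                 * ((Ln (indented_path u) - of_real (ln b))
                      / (indented_path u - of_real b))
                 * indented_path_deriv u =
          \<phi> (indented_path u) * indented_path_deriv u"
      by (simp only: \<phi>_def if_False h_ne[OF ne])
  qed auto
  then have "E 1 - E 0 = I" using I has_integral_unique by blast
  moreover from segment.has_integral_primitive[OF E]
  have "((\<lambda>t. l (of_real t) * ((Ln (of_real t) - of_real (ln b)) / (of_real t - of_real b))) has_integral E 1 - E 0) {0..1}"
  proof (rule has_integral_spike_finite[of "{0, b}", rotated 2])
    fix t :: real assume "t \<in> {0..1} - {0, b}"
    then show "l (of_real t) * ((Ln (of_real t) - of_real (ln b)) / (of_real t - of_real b)) = \<phi> (linepath 0 1 t) * 1"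
      by (simp add: \<phi>_def h_ne linepath_0 scaleR_conv_of_real)
  qed auto
  ultimately show ?thesis by simp
qed

context hyperlog_path
begin

text \<open>At $\beta = 1$ the second iterated integral is meaningless; there the combination is only used
with the coefficient $x = \ln 1 = 0$.\<close>

lemma Li3_kernel_combination:
  assumes "gap \<beta>" "c \<noteq> 0" "norm c \<le> 1" "\<beta> \<noteq> 1 \<or> x = 0"
  shows "((\<lambda>u. plog 3 (c * g u) * ((Ln (g u) - x) / (g u - \<beta>)) * g' u) has_integral
           iterated_integral g [0, \<beta>, 0, 0, inverse c] 1
             + x * iterated_integral g [\<beta>, 0, 0, inverse c] 1) {0..1}"
proof (cases "x = 0")
  case True
  then show ?thesis using iterated_integral_Li3_kernel(1)[OF assms(1-3)] by (simp add: mult_ac)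
next
  case False
  then have "\<beta> \<noteq> 1" using assms(4) by auto
  from has_integral_diff[OF iterated_integral_Li3_kernel(1)[OF assms(1-3)]
      has_integral_mult_right[OF iterated_integral_Li3_kernel(2)[OF assms(1-3) this], of x]]
  have "((\<lambda>u. Ln (g u) * (plog 3 (c * g u) / (g u - \<beta>) * g' u) -
            x * (plog 3 (c * g u) / (g u - \<beta>) * g' u)) has_integral
           iterated_integral g [0, \<beta>, 0, 0, inverse c] 1 -
            x * - iterated_integral g [\<beta>, 0, 0, inverse c] 1) {0..1}" .
  moreover have "L * (p / d * q) - x * (p / d * q) = p * ((L - x) / d) * q" for L p d q :: complex
    by (simp add: diff_divide_distrib algebra_simps)
  ultimately show ?thesis by simp
qed

lemma Ln_kernel_combination:
  assumes "gap \<beta>"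
  shows "((\<lambda>u. Ln (g u) * ((Ln (g u) - x) / (g u - \<beta>)) * g' u) has_integral
           2 * iterated_integral g [0, 0, \<beta>] 1 + x * iterated_integral g [0, \<beta>] 1) {0..1}"
proof -
  have eq: "2 * (L ^ 2 / 2 * (1 / d * q)) - x * (L * (1 / d * q)) = L * ((L - x) / d) * q"
    for L d q :: complex
    by (simp add: diff_divide_distrib algebra_simps power2_eq_square)
  from has_integral_diff[OF has_integral_mult_right[OF iterated_integral_depth1(2)[OF assms], of 2]
      has_integral_mult_right[OF iterated_integral_depth1(1)[OF assms], of x]]
  show ?thesis unfolding eq by simp
qed

end

text \<open>The other singularities that occur are 1 and $-1$, so $\beta$ alone decides which path is taken.\<close>

definition path_avoiding :: "real \<Rightarrow> real \<Rightarrow> complex" where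
  "path_avoiding \<beta> = (if 0 < \<beta> \<and> \<beta> < 1 then indented_path else linepath 0 1)"

lemma integration_path_real:
  assumes "\<beta> \<noteq> 0"
  shows "integration_path [of_real \<beta>] = path_avoiding \<beta>"
    and "\<sigma> = 1 \<or> \<sigma> = -1 \<Longrightarrow> integration_path [\<sigma>, of_real \<beta>] = path_avoiding \<beta>"
proof -
  have 1: "(complex_of_real \<beta> \<in> complex_of_real ` {0<..<1}) = (0 < \<beta> \<and> \<beta> < 1)"
    by (auto simp: image_iff)
  then show "integration_path [of_real \<beta>] = path_avoiding \<beta>"
    by (simp add: integration_path_def path_avoiding_def)
  assume "\<sigma> = 1 \<or> \<sigma> = -1"
  moreover have "1 \<notin> complex_of_real ` {0<..<1}" by (auto simp: image_iff)
  moreover have "-1 \<notin> complex_of_real ` {0<..<1}"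
  proof
    assume "-1 \<in> complex_of_real ` {0<..<1}"
    then obtain x where "0 < x" "complex_of_real x = complex_of_real (-1)" by auto
    then show False by (simp only: of_real_eq_iff)
  qed
  ultimately have "\<sigma> \<notin> complex_of_real ` {0<..<1}" by metis
  then show "integration_path [\<sigma>, of_real \<beta>] = path_avoiding \<beta>"
    using 1 by (simp add: integration_path_def path_avoiding_def)
qed

lemma segment_gap:
  assumes "\<beta> < 0 \<or> 1 \<le> \<beta>"
  shows "segment.gap (of_real \<beta>)"
  unfolding segment.gap_def
proof (intro exI[of _ "min 1 \<bar>\<beta>\<bar>"] conjI allI impI)
  show "0 < min 1 \<bar>\<beta>\<bar>" using assms by auto
  fix u :: real assume u: "0 \<le> u" "u < 1"
  have "min 1 \<bar>\<beta>\<bar> * (1 - u) \<le> \<bar>u - \<beta>\<bar>"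
  proof (cases "\<beta> < 0")
    case True
    have "min 1 \<bar>\<beta>\<bar> * (1 - u) \<le> \<bar>\<beta>\<bar> * 1" using u by (intro mult_mono) auto
    then show ?thesis using True u by simp
  next
    case False
    have "min 1 \<bar>\<beta>\<bar> * (1 - u) \<le> 1 * (1 - u)" using u by (intro mult_right_mono) auto
    then show ?thesis using False u assms by simp
  qed
  also have "\<bar>u - \<beta>\<bar> = norm (of_real (u - \<beta>) :: complex)" by (simp only: norm_of_real)
  also have "of_real (u - \<beta>) = linepath 0 1 u - (of_real \<beta> :: complex)"
    by (simp add: linepath_0 scaleR_conv_of_real)
  finally show "min 1 \<bar>\<beta>\<bar> * (1 - u) \<le> norm (linepath 0 1 u - (of_real \<beta> :: complex))" .
qed

lemma indented_gap:
  assumes "0 < \<beta>" "\<beta> < 1"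
  shows "indented.gap (of_real \<beta>)"
  unfolding indented.gap_def
proof (intro exI[of _ "1/2 - \<bar>\<beta> - 1/2\<bar>"] conjI allI impI)
  show k: "0 < 1/2 - \<bar>\<beta> - 1/2\<bar>" using assms by (simp add: abs_if)
  fix u :: real assume u: "0 \<le> u" "u < 1"
  let ?z = "indented_path u"
  have b: "norm (of_real \<beta> - 1/2 :: complex) = \<bar>\<beta> - 1/2\<bar>"
  proof -
    have "(of_real \<beta> - 1/2 :: complex) = of_real (\<beta> - 1/2)" by simp
    then show ?thesis by (simp only: norm_of_real)
  qed
  have z: "norm (?z - 1/2) = 1/2" by (simp add: part_circlepath_def norm_mult)
  have "(1/2 - \<bar>\<beta> - 1/2\<bar>) * (1 - u) \<le> 1/2 - \<bar>\<beta> - 1/2\<bar>"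
    using u k by (intro mult_left_le) auto
  also have "\<dots> = norm (?z - 1/2) - norm (of_real \<beta> - 1/2 :: complex)"
    unfolding b z ..
  also have "\<dots> \<le> norm (?z - of_real \<beta>)"
    using norm_triangle_ineq2[of "?z - 1/2" "of_real \<beta> - 1/2"] by simp
  finally show "(1/2 - \<bar>\<beta> - 1/2\<bar>) * (1 - u) \<le> norm (?z - of_real \<beta>)" .
qed

text \<open>Subtracting $\ln |\beta|$ makes the numerator vanish at a singularity $\beta$ in $(0,1)$, the only
case in which the defining path is not the segment already.\<close>

lemma real_Li3_kernel:
  assumes \<sigma>: "\<sigma> = 1 \<or> \<sigma> = -1" and \<beta>: "\<beta> \<noteq> 0"
  shows "((\<lambda>t. plog 3 (\<sigma> * of_real t) * ((Ln (of_real t) - of_real (ln \<bar>\<beta>\<bar>)) / (of_real t - of_real \<beta>))) has_integral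
           iterated_integral (path_avoiding \<beta>) [0, of_real \<beta>, 0, 0, \<sigma>] 1
             + of_real (ln \<bar>\<beta>\<bar>) * iterated_integral (path_avoiding \<beta>) [of_real \<beta>, 0, 0, \<sigma>] 1) {0..1}"
proof -
  have \<sigma>': "\<sigma> \<noteq> 0" "norm \<sigma> \<le> 1" "inverse \<sigma> = \<sigma>" using \<sigma> by auto
  show ?thesis
  proof (cases "0 < \<beta> \<and> \<beta> < 1")
    case False
    have pa: "path_avoiding \<beta> = linepath 0 1" using False unfolding path_avoiding_def by (rule if_not_P)
    from False have "segment.gap (of_real \<beta>)" using \<beta> by (intro segment_gap) auto
    moreover have "complex_of_real \<beta> \<noteq> 1 \<or> complex_of_real (ln \<bar>\<beta>\<bar>) = 0" by auto
    ultimately show ?thesis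
      using segment.Li3_kernel_combination[of "of_real \<beta>" \<sigma> "of_real (ln \<bar>\<beta>\<bar>)"] \<sigma>'
      by (simp add: pa scaleR_conv_of_real)
  next
    case True
    obtain C where C: "C \<ge> 0" "\<And>z. norm z \<le> 1 \<Longrightarrow> norm (plog 3 z) \<le> C * norm z"
      using plog_bound[of 3] by auto
    have n: "norm (\<sigma> * z) = norm z" for z using \<sigma> by auto
    have "((\<lambda>t. plog 3 (\<sigma> * of_real t) * ((Ln (of_real t) - of_real (ln \<beta>)) / (of_real t - of_real \<beta>))) has_integral
           iterated_integral (path_avoiding \<beta>) [0, of_real \<beta>, 0, 0, \<sigma>] 1
             + of_real (ln \<beta>) * iterated_integral (path_avoiding \<beta>) [of_real \<beta>, 0, 0, \<sigma>] 1) {0..1}"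
    proof (rule integral_indented_eq_segment[where l = "\<lambda>z. plog 3 (\<sigma> * z)"])
      have "continuous_on (cball (1/2) (1/2)) (\<lambda>z. plog 3 (\<sigma> * z))"
        by (intro continuous_intros) (simp, simp only: n cball_half_norm_le)
      then show "continuous (at z within cball (1/2) (1/2)) (\<lambda>z. plog 3 (\<sigma> * z))" if "z \<in> cball (1/2) (1/2)" for z
        using that by (simp add: continuous_on_eq_continuous_within)
      have "norm (\<sigma> * z) < 1" if "z \<in> ball (1/2) (1/2)" for z
      proof -
        have "norm (1/2 - z) < 1/2" using that unfolding mem_ball dist_norm .
        moreover have "norm z \<le> norm (1/2 :: complex) + norm (z - 1/2)"
          using norm_triangle_ineq[of "1/2" "z - 1/2"] by simp
        moreover have "norm (1/2 :: complex) = 1/2" by simp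
        ultimately show ?thesis unfolding n norm_minus_commute[of "1/2" z] by linarith
      qed
      then have "((\<lambda>z. plog 3 (\<sigma> * z)) has_field_derivative
          (\<Sum>n. inverse (of_nat (Suc n) ^ 2) * (\<sigma> * z) ^ n) * \<sigma>) (at z)" if "z \<in> ball (1/2) (1/2)" for z
        using that unfolding numeral_3_eq_3 numeral_2_eq_2
        by (intro DERIV_chain2[where f = "plog (Suc (Suc (Suc 0)))" and g = "\<lambda>z. \<sigma> * z", OF plog_deriv_powser])
           (auto intro!: derivative_eq_intros)
      then show "(\<lambda>z. plog 3 (\<sigma> * z)) holomorphic_on ball (1/2) (1/2)"
        unfolding holomorphic_on_open[OF open_ball] by blast
      fix z :: complex assume z: "norm z \<le> 1"
      have "norm (plog 3 (\<sigma> * z)) \<le> C * norm z" using C(2)[of "\<sigma> * z"] z n by simp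
      also have "norm z powr 1 \<le> norm z powr (1/2)" using z by (intro powr_mono') auto
      then have "C * norm z \<le> C * norm z powr (1/2)" using C by (intro mult_left_mono) auto
      finally show "norm (plog 3 (\<sigma> * z)) \<le> C * norm z powr (1/2)" .
    qed (use True indented.Li3_kernel_combination[OF indented_gap, of \<beta> \<sigma> "of_real (ln \<beta>)"] \<sigma>' in
         \<open>auto simp: path_avoiding_def\<close>)
    then show ?thesis using True by simp
  qed
qed

text \<open>Here the integrand behaves like $\mathrm{Ln}^2 z$ at 0. Writing
$\frac{1}{z - \beta} = \frac{z}{\beta (z - \beta)} - \frac{1}{\beta}$ splits it into a summand with
the decaying factor $z\, \mathrm{Ln}\, z$, for which Cauchy's theorem works, and a polynomial in \<open>Ln\<close>
whose integral is the same along both paths.\<close>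

lemma real_Ln_kernel:
  assumes \<beta>: "\<beta> \<noteq> 0"
  shows "((\<lambda>t. Ln (of_real t) * ((Ln (of_real t) - of_real (ln \<bar>\<beta>\<bar>)) / (of_real t - of_real \<beta>))) has_integral
           2 * iterated_integral (path_avoiding \<beta>) [0, 0, of_real \<beta>] 1
             + of_real (ln \<bar>\<beta>\<bar>) * iterated_integral (path_avoiding \<beta>) [0, of_real \<beta>] 1) {0..1}"
proof (cases "0 < \<beta> \<and> \<beta> < 1")
  case False
  have pa: "path_avoiding \<beta> = linepath 0 1" using False unfolding path_avoiding_def by (rule if_not_P)
  from False have "segment.gap (of_real \<beta>)" using \<beta> by (intro segment_gap) auto
  then show ?thesis
    using segment.Ln_kernel_combination[of "of_real \<beta>" "of_real (ln \<bar>\<beta>\<bar>)"]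
    by (simp add: pa scaleR_conv_of_real)
next
  case True
  define x where "x = complex_of_real (ln \<beta>)"
  define l where "l = (\<lambda>z. z * Ln z / of_real \<beta>)"
  have key: "l z * ((Ln z - x) / (z - of_real \<beta>)) * q =
      Ln z * ((Ln z - x) / (z - of_real \<beta>)) * q + 1 / of_real \<beta> * (Ln z * (Ln z - x) * q)"
    if "z \<noteq> of_real \<beta>" for z q
    using that True by (simp add: l_def field_simps)
  let ?I = "2 * iterated_integral (path_avoiding \<beta>) [0, 0, of_real \<beta>] 1
             + x * iterated_integral (path_avoiding \<beta>) [0, of_real \<beta>] 1"
  have bl: "norm (l z) \<le> 8 / \<beta> * norm z powr (1/2)" if "norm z \<le> 1" for z
  proof (cases "z = 0")
    case False
    have "norm (l z) = norm z * norm (Ln z) / \<beta>" using True by (simp add: l_def norm_mult norm_divide)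
    also have "\<dots> \<le> norm z * (8 * norm z powr (- 1/4)) / \<beta>"
      using True False that by (intro divide_right_mono mult_left_mono norm_Ln_le) auto
    also have "norm z * (8 * norm z powr (- 1/4)) = 8 * norm z powr (3/4)"
      using powr_add[of "norm z" 1 "-1/4"] by simp
    also have "\<dots> \<le> 8 * norm z powr (1/2)"
      using that by (intro mult_left_mono powr_mono') auto
    finally show ?thesis using True by (simp add: divide_right_mono)
  qed (simp add: l_def)
  have "((\<lambda>t. l (of_real t) * ((Ln (of_real t) - of_real (ln \<beta>)) / (of_real t - of_real \<beta>))) has_integral
           ?I + 1 / of_real \<beta> * (2 + x)) {0..1}"
  proof (rule integral_indented_eq_segment[where l = l])
    show "l holomorphic_on ball (1/2) (1/2)"
    proof -
      have "z \<notin> \<real>\<^sub>\<le>\<^sub>0" if z: "z \<in> ball (1/2) (1/2)" for z :: complex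
      proof -
        have "z \<noteq> 0" "z \<in> cball (1/2) (1/2)" using z by auto
        from cball_half_Re_pos[OF this(2,1)] show ?thesis by (simp add: complex_nonpos_Reals_iff)
      qed
      then have "Ln holomorphic_on ball (1/2) (1/2)" by (intro holomorphic_on_Ln) blast
      then show ?thesis unfolding l_def
        by (intro holomorphic_on_divide holomorphic_on_mult holomorphic_on_ident holomorphic_on_const)
           (use True in auto)
    qed
    show "continuous (at z within cball (1/2) (1/2)) l" if z: "z \<in> cball (1/2) (1/2)" "z \<noteq> 0" for z
    proof -
      have "z \<notin> \<real>\<^sub>\<le>\<^sub>0" using cball_half_Re_pos[OF z] by (simp add: complex_nonpos_Reals_iff)
      then show ?thesis unfolding l_def
        by (intro continuous_intros continuous_at_imp_continuous_at_within[OF continuous_at_Ln])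
           (use \<beta> in auto)
    qed
    fix z :: complex assume "norm z \<le> 1" then show "norm (l z) \<le> 8 / \<beta> * norm z powr (1/2)" by (rule bl)
  next
    let ?g = indented_path
    let ?g' = indented_path_deriv
    have gap: "indented.gap (of_real \<beta>)" using True by (intro indented_gap) auto
    from has_integral_add[OF indented.Ln_kernel_combination[OF gap, of x]
        has_integral_mult_right[OF indented.integral_Ln_polynomial[of x], of "1 / of_real \<beta>"]]
    have "((\<lambda>u. l (?g u) * ((Ln (?g u) - x) / (?g u - of_real \<beta>)) * ?g' u) has_integral
           2 * iterated_integral ?g [0, 0, of_real \<beta>] 1 + x * iterated_integral ?g [0, of_real \<beta>] 1
             + 1 / of_real \<beta> * (2 + x)) {0..1}"
    proof (rule has_integral_spike_finite[of "{1}", rotated 2])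
      fix u :: real assume "u \<in> {0..1} - {1}"
      then have "?g u \<noteq> of_real \<beta>" by (intro indented.gap_ne[OF gap]) auto
      from key[OF this] show "l (?g u) * ((Ln (?g u) - x) / (?g u - of_real \<beta>)) * ?g' u =
        Ln (?g u) * ((Ln (?g u) - x) / (?g u - of_real \<beta>)) * ?g' u
          + 1 / of_real \<beta> * (Ln (?g u) * (Ln (?g u) - x) * ?g' u)" .
    qed auto
    then show "((\<lambda>u. l (?g u) * ((Ln (?g u) - of_real (ln \<beta>)) / (?g u - of_real \<beta>)) * ?g' u) has_integral
           ?I + 1 / of_real \<beta> * (2 + x)) {0..1}"
      using True by (simp add: path_avoiding_def x_def)
  qed (use True in auto)
  from has_integral_diff[OF this has_integral_mult_right[OF segment.integral_Ln_polynomial[of x], of "1 / of_real \<beta>"]]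
  have "((\<lambda>t. l (of_real t) * ((Ln (of_real t) - x) / (of_real t - of_real \<beta>))
           - 1 / of_real \<beta> * (Ln (of_real t) * (Ln (of_real t) - x))) has_integral ?I) {0..1}"
    by (simp add: scaleR_conv_of_real x_def)
  then have "((\<lambda>t. Ln (of_real t) * ((Ln (of_real t) - x) / (of_real t - of_real \<beta>))) has_integral ?I) {0..1}"
  proof (rule has_integral_spike_finite[of "{\<beta>}", rotated 2])
    fix t assume "t \<in> {0..1} - {\<beta>}"
    then have "complex_of_real t \<noteq> of_real \<beta>" by simp
    from key[OF this, of 1]
    show "Ln (of_real t) * ((Ln (of_real t) - x) / (of_real t - of_real \<beta>)) =
      l (of_real t) * ((Ln (of_real t) - x) / (of_real t - of_real \<beta>))
           - 1 / of_real \<beta> * (Ln (of_real t) * (Ln (of_real t) - x))" by simp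
  qed simp
  then show ?thesis using True by (simp add: x_def)
qed

section \<open>The polylogarithmic side as real integrals\<close>

text \<open>Inside the unit disc the value is defined by the series, but the series equals the iterated
integral along the segment; so one formula covers all nonzero real arguments.\<close>

lemma Li1_eq_iterated_integral:
  assumes x: "x \<noteq> (0::real)"
  shows "Li1 3 (of_real x) = - iterated_integral (path_avoiding (1 / x)) [0, 0, of_real (1 / x)] 1"
    and "Li1 2 (of_real x) = - iterated_integral (path_avoiding (1 / x)) [0, of_real (1 / x)] 1"
proof -
  have i: "inverse (complex_of_real x) = of_real (1 / x)" by (simp add: inverse_eq_divide)
  have "Li1 3 (of_real x) = - iterated_integral (path_avoiding (1 / x)) [0, 0, of_real (1 / x)] 1 \<and>
        Li1 2 (of_real x) = - iterated_integral (path_avoiding (1 / x)) [0, of_real (1 / x)] 1"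
  proof (cases "norm (of_real x :: complex) < 1")
    case True
    have "\<not> (0 < 1 / x \<and> 1 / x < 1)" using True x by (auto simp: field_simps)
    then have pa: "path_avoiding (1 / x) = linepath 0 1" unfolding path_avoiding_def by (rule if_not_P)
    have "Li1 3 (of_real x) = plog 3 (of_real x)" "Li1 2 (of_real x) = plog 2 (of_real x)"
      using True multi_polylog_series_eq_plog[OF True] by (simp_all add: multi_polylog_def)
    then show ?thesis unfolding pa i[symmetric]
      using segment.iterated_integral_plog[of "of_real x" 1 1] segment.iterated_integral_plog[of "of_real x" 1 0] True x
      by (simp add: numeral_3_eq_3 numeral_2_eq_2)
  next
    case False
    then have "Li1 r (of_real x) = - hyperlog [r] [of_real (1 / x)]" for r
      by (simp add: multi_polylog_def i)
    moreover have "integration_path [complex_of_real (1 / x)] = path_avoiding (1 / x)"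
      using x by (intro integration_path_real) auto
    ultimately show ?thesis by (simp add: hyperlog_def numeral_3_eq_3 numeral_2_eq_2)
  qed
  then show "Li1 3 (of_real x) = - iterated_integral (path_avoiding (1 / x)) [0, 0, of_real (1 / x)] 1"
    and "Li1 2 (of_real x) = - iterated_integral (path_avoiding (1 / x)) [0, of_real (1 / x)] 1" by auto
qed

text \<open>The product of the two arguments is $\pm 1$, so they never both lie in the open unit disc and the
iterated integral is always the defining case.\<close>

lemma Li2_eq_iterated_integral:
  assumes \<beta>: "\<beta> \<noteq> (0::real)" and \<sigma>: "\<sigma> = (1::real) \<or> \<sigma> = -1"
  shows "Li2 3 2 (of_real (\<sigma> * \<beta>)) (of_real (1 / \<beta>)) =
           iterated_integral (path_avoiding \<beta>) [0, of_real \<beta>, 0, 0, of_real \<sigma>] 1"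
    and "Li2 3 1 (of_real (\<sigma> * \<beta>)) (of_real (1 / \<beta>)) =
           iterated_integral (path_avoiding \<beta>) [of_real \<beta>, 0, 0, of_real \<sigma>] 1"
proof -
  have "\<not> (norm (of_real (\<sigma> * \<beta>) :: complex) < 1 \<and> norm (of_real (1 / \<beta>) :: complex) < 1)"
    unfolding norm_of_real using \<beta> \<sigma> by (auto simp: abs_mult field_simps)
  then have n: "\<not> (\<forall>x\<in>set [complex_of_real (\<sigma> * \<beta>), of_real (1 / \<beta>)]. cmod x < 1)"
    by (simp only: list.set) blast
  have m: "map (\<lambda>i. inverse (prod_list (drop i [complex_of_real (\<sigma> * \<beta>), of_real (1 / \<beta>)]))) [0..<2]
      = [of_real \<sigma>, of_real \<beta>]"
    using \<beta> \<sigma> by (auto simp: numeral_2_eq_2 field_simps)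
  have "Li2 3 r (of_real (\<sigma> * \<beta>)) (of_real (1 / \<beta>)) = hyperlog [3, r] [of_real \<sigma>, of_real \<beta>]" for r
    unfolding multi_polylog_def if_not_P[OF n] using m by (simp add: numeral_2_eq_2)
  moreover have "integration_path [of_real \<sigma>, complex_of_real \<beta>] = path_avoiding \<beta>"
    using \<beta> \<sigma> by (intro integration_path_real) auto
  ultimately show "Li2 3 2 (of_real (\<sigma> * \<beta>)) (of_real (1 / \<beta>)) =
           iterated_integral (path_avoiding \<beta>) [0, of_real \<beta>, 0, 0, of_real \<sigma>] 1"
    and "Li2 3 1 (of_real (\<sigma> * \<beta>)) (of_real (1 / \<beta>)) =
           iterated_integral (path_avoiding \<beta>) [of_real \<beta>, 0, 0, of_real \<sigma>] 1"
    by (simp_all add: hyperlog_def numeral_3_eq_3 numeral_2_eq_2)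
qed

text \<open>Twice the Legendre chi function: $2 \sum t^n / n^r$ over odd $n$.\<close>

definition legendre_chi :: "nat \<Rightarrow> real \<Rightarrow> real" where
  "legendre_chi r t = Re (plog r (of_real t) - plog r (- of_real t))"

lemma plog_of_real:
  assumes "\<bar>t\<bar> \<le> 1" "r \<ge> 2"
  shows "Im (plog r (of_real t)) = 0"
proof -
  have "(\<lambda>n. Im (inverse (of_nat n ^ r) * of_real t ^ n)) = (\<lambda>n. 0)"
  proof
    fix n
    have "inverse (of_nat n ^ r) * of_real t ^ n = complex_of_real (inverse (of_nat n ^ r) * t ^ n)" by simp
    then show "Im (inverse (of_nat n ^ r) * of_real t ^ n) = 0" by (simp only: Im_complex_of_real)
  qed
  moreover have "summable (\<lambda>n. inverse (of_nat n ^ r) * of_real t ^ n :: complex)"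
    by (rule summable_plog) (use assms in auto)
  ultimately show ?thesis unfolding plog_def by (subst Im_suminf) auto
qed

lemma legendre_chi_of_real:
  assumes "\<bar>t\<bar> \<le> 1" "r \<ge> 2"
  shows "plog r (of_real t) - plog r (- of_real t) = of_real (legendre_chi r t)"
  using plog_of_real[of t r] plog_of_real[of "-t" r] assms
  by (simp add: legendre_chi_def complex_eq_iff)

lemma has_integral_of_real_valued:
  assumes "((\<lambda>t. complex_of_real (q t)) has_integral c) S"
  obtains I where "(q has_integral I) S" "c = of_real I"
proof -
  have "(q has_integral Re c) S"
    using has_integral_linear[OF assms bounded_linear_Re] by (simp add: o_def)
  moreover have "((\<lambda>_. 0) has_integral Im c) S"
    using has_integral_linear[OF assms bounded_linear_Im] by (simp add: o_def)
  then have "Im c = 0" by (simp add: has_integral_0_eq)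
  then have "c = of_real (Re c)" by (simp add: complex_eq_iff)
  ultimately show thesis using that by blast
qed

text \<open>The four terms of \<open>S2\<close> are the choices of sign of the innermost singularity $\pm 1$ and of
$\beta = \pm b$; the first choice produces $\chi$, the second one the kernel
$\frac{1}{t-b} - \frac{1}{t+b}$.\<close>

lemma S2_eq_integral:
  assumes b: "b > 0"
  obtains I where "((\<lambda>t. legendre_chi 3 t * (ln t - ln b) * (2 * b / (t ^ 2 - b ^ 2))) has_integral I) {0..1}"
    "S2 3 2 b 1 1 + of_real (ln b) * S2 3 1 b 1 1 = of_real I"
proof -
  let ?it2 = "\<lambda>\<sigma> \<beta>. iterated_integral (path_avoiding \<beta>) [0, of_real \<beta>, 0, 0, of_real \<sigma>] 1"
  let ?it1 = "\<lambda>\<sigma> \<beta>. iterated_integral (path_avoiding \<beta>) [of_real \<beta>, 0, 0, of_real \<sigma>] 1"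
  let ?f = "\<lambda>\<sigma> \<beta> t. plog 3 (of_real \<sigma> * of_real t) * ((Ln (of_real t) - of_real (ln b)) / (of_real t - of_real \<beta>))"
  have k: "(?f \<sigma> \<beta> has_integral ?it2 \<sigma> \<beta> + of_real (ln b) * ?it1 \<sigma> \<beta>) {0..1}"
    if "\<sigma> = 1 \<or> \<sigma> = -1" "\<bar>\<beta>\<bar> = b" for \<sigma> \<beta> :: real
    using real_Li3_kernel[of "of_real \<sigma>" \<beta>] that b by auto
  have s: "S2 3 2 b 1 1 = ?it2 1 b - ?it2 (-1) b + ?it2 (-1) (-b) - ?it2 1 (-b)"
     "S2 3 1 b 1 1 = ?it1 1 b - ?it1 (-1) b + ?it1 (-1) (-b) - ?it1 1 (-b)"
    using Li2_eq_iterated_integral[of b 1] Li2_eq_iterated_integral[of b "-1"]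
      Li2_eq_iterated_integral[of "-b" 1] Li2_eq_iterated_integral[of "-b" "-1"] b
    unfolding S2_def by simp_all
  from has_integral_diff[OF has_integral_add[OF has_integral_diff[OF k[of 1 b] k[of "-1" b]] k[of "-1" "-b"]] k[of 1 "-b"]]
  have "((\<lambda>t. ?f 1 b t - ?f (-1) b t + ?f (-1) (-b) t - ?f 1 (-b) t) has_integral
       S2 3 2 b 1 1 + of_real (ln b) * S2 3 1 b 1 1) {0..1}"
    using b unfolding s by (simp add: algebra_simps)
  then have "((\<lambda>t. complex_of_real (legendre_chi 3 t * (ln t - ln b) * (2 * b / (t ^ 2 - b ^ 2)))) has_integral
       S2 3 2 b 1 1 + of_real (ln b) * S2 3 1 b 1 1) {0..1}"
  proof (rule has_integral_spike_finite[of "{0, b}", rotated 2])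
    fix t :: real assume t: "t \<in> {0..1} - {0, b}"
    then have L: "Ln (of_real t) = of_real (ln t)" by (intro Ln_of_real) auto
    have ne: "t - b \<noteq> 0" "t + b \<noteq> 0" using t b by auto
    have "?f 1 b t - ?f (-1) b t + ?f (-1) (-b) t - ?f 1 (-b) t
       = (plog 3 (of_real t) - plog 3 (- of_real t)) * (of_real (ln t) - of_real (ln b)) *
          (1 / of_real (t - b) - 1 / of_real (t + b))"
      unfolding L by (simp add: diff_divide_distrib algebra_simps)
    also have "plog 3 (of_real t) - plog 3 (- of_real t) = of_real (legendre_chi 3 t)"
      using t by (intro legendre_chi_of_real) auto
    also have "1 / of_real (t - b) - 1 / of_real (t + b) = complex_of_real (1 / (t - b) - 1 / (t + b))" by simp
    also have "1 / (t - b) - 1 / (t + b) = 2 * b / (t ^ 2 - b ^ 2)"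
    proof -
      have e: "t ^ 2 - b ^ 2 = (t - b) * (t + b)" by (simp add: power2_eq_square algebra_simps)
      show ?thesis unfolding e using ne by (simp add: field_simps)
    qed
    finally show "complex_of_real (legendre_chi 3 t * (ln t - ln b) * (2 * b / (t ^ 2 - b ^ 2))) =
       ?f 1 b t - ?f (-1) b t + ?f (-1) (-b) t - ?f 1 (-b) t"
      by (simp only: of_real_mult of_real_diff)
  qed auto
  then show thesis by (rule has_integral_of_real_valued) (use that in blast)
qed

text \<open>The factor $1/2$ is what makes the numerator $\ln t (\ln t + \ln a)$ vanish at $t = 1/a$.\<close>

lemma L1_eq_integral:
  assumes a: "a > 0"
  obtains H where "((\<lambda>t. - ln t * (ln t + ln a) * (a / ((a * t) ^ 2 - 1))) has_integral H) {0..1}"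
    "L1 a 3 1 - L1_log a 2 1 / 2 = of_real H"
proof -
  define b where "b = 1 / a"
  have b: "b > 0" "ln b = - ln a" using a by (simp_all add: b_def ln_div)
  let ?it2 = "\<lambda>\<beta>. iterated_integral (path_avoiding \<beta>) [0, 0, of_real \<beta>] 1"
  let ?it1 = "\<lambda>\<beta>. iterated_integral (path_avoiding \<beta>) [0, of_real \<beta>] 1"
  let ?f = "\<lambda>\<beta> t. Ln (of_real t) * ((Ln (of_real t) - of_real (ln b)) / (of_real t - of_real \<beta>))"
  have k: "(?f \<beta> has_integral 2 * ?it2 \<beta> + of_real (ln b) * ?it1 \<beta>) {0..1}" if "\<bar>\<beta>\<bar> = b" for \<beta>
    using real_Ln_kernel[of \<beta>] that b(1) by auto
  have l: "L1 a 3 1 = - ?it2 b + ?it2 (- b)" "L1_log a 2 1 = of_real (ln a) * (- ?it1 b + ?it1 (- b))"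
    using Li1_eq_iterated_integral[of a] Li1_eq_iterated_integral[of "-a"] a
    by (simp_all add: L1_def L1_log_def b_def)
  have val: "(-1/2) * ((2 * A + of_real (- ln a) * B) - (2 * C + of_real (- ln a) * D)) =
      (- A + C) - of_real (ln a) * (- B + D) / 2" for A B C D :: complex
    by (simp add: field_simps)
  have "((\<lambda>t. (-1/2) * (?f b t - ?f (-b) t)) has_integral
      (-1/2) * ((2 * ?it2 b + of_real (ln b) * ?it1 b) - (2 * ?it2 (-b) + of_real (ln b) * ?it1 (-b)))) {0..1}"
    by (intro has_integral_mult_right has_integral_diff k) (use b in auto)
  then have "((\<lambda>t. (-1/2) * (?f b t - ?f (-b) t)) has_integral L1 a 3 1 - L1_log a 2 1 / 2) {0..1}"
    unfolding l b(2) val .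
  then have "((\<lambda>t. complex_of_real (- ln t * (ln t + ln a) * (a / ((a * t) ^ 2 - 1)))) has_integral
       L1 a 3 1 - L1_log a 2 1 / 2) {0..1}"
  proof (rule has_integral_spike_finite[of "{0, b}", rotated 2])
    fix t :: real assume t: "t \<in> {0..1} - {0, b}"
    then have L: "Ln (of_real t) = of_real (ln t)" by (intro Ln_of_real) auto
    have ne: "a * t - 1 \<noteq> 0" "a * t + 1 > 0" using t a by (auto simp: b_def field_simps add_pos_pos)
    have tb: "t - b = (a * t - 1) / a" "t + b = (a * t + 1) / a" using a by (simp_all add: b_def field_simps)
    have "(-1/2) * (?f b t - ?f (-b) t)
       = (-1/2) * of_real (ln t) * (of_real (ln t) - of_real (ln b)) *
          (1 / of_real (t - b) - 1 / of_real (t + b))"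
      unfolding L by (simp add: diff_divide_distrib algebra_simps)
    also have "1 / of_real (t - b) - 1 / of_real (t + b) = complex_of_real (1 / (t - b) - 1 / (t + b))" by simp
    also have "1 / (t - b) - 1 / (t + b) = 2 * (a / ((a * t) ^ 2 - 1))"
    proof -
      have e: "(a * t) ^ 2 - 1 = (a * t - 1) * (a * t + 1)" by (simp add: power2_eq_square algebra_simps)
      show ?thesis unfolding e tb using ne a by (simp add: field_simps)
    qed
    finally show "complex_of_real (- ln t * (ln t + ln a) * (a / ((a * t) ^ 2 - 1))) =
       (-1/2) * (?f b t - ?f (-b) t)"
      by (simp add: b(2))
  qed auto
  then show thesis by (rule has_integral_of_real_valued) (use that in blast)
qed

section \<open>Uniform angles\<close>

definition unif :: "real \<Rightarrow> real measure" where
  "unif L = uniform_measure lborel {0..L}"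

lemma sets_unif [simp, measurable_cong]: "sets (unif L) = sets borel"
  by (simp add: unif_def)

lemma space_unif [simp]: "space (unif L) = UNIV"
  by (simp add: unif_def)

lemma emeasure_unif_UNIV [simp]: "L > 0 \<Longrightarrow> emeasure (unif L) UNIV = 1"
  unfolding unif_def by (subst emeasure_uniform_measure) (auto simp: ennreal_divide_self)

lemma sigma_finite_unif: "L > 0 \<Longrightarrow> sigma_finite_measure (unif L)"
  by (intro finite_measure.axioms finite_measureI) auto

lemma nn_integral_unif:
  assumes [measurable]: "f \<in> borel_measurable borel" and L: "L > 0"
  shows "(\<integral>\<^sup>+x. f x \<partial>unif L) = ennreal (1 / L) * (\<integral>\<^sup>+x\<in>{0..L}. f x \<partial>lborel)"
proof -
  have "(\<integral>\<^sup>+x. f x \<partial>unif L) = (\<integral>\<^sup>+x\<in>{0..L}. f x \<partial>lborel) / ennreal L"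
    unfolding unif_def using L by (subst nn_integral_uniform_measure) auto
  also have "\<dots> = ennreal (1 / L) * (\<integral>\<^sup>+x\<in>{0..L}. f x \<partial>lborel)"
    using L by (simp add: divide_ennreal_def inverse_ennreal inverse_eq_divide mult.commute)
  finally show ?thesis .
qed

lemma AE_unifI:
  assumes "\<And>x. 0 \<le> x \<Longrightarrow> x \<le> L \<Longrightarrow> x \<notin> S \<Longrightarrow> P x" "finite S"
  shows "AE x in unif L. P x"
  unfolding unif_def
proof (rule AE_uniform_measureI)
  have "AE x in lborel. x \<notin> S"
    by (rule AE_not_in) (use assms(2) in \<open>auto intro: finite_imp_null_set_lborel\<close>)
  then show "AE x in lborel. x \<in> {0..L} \<longrightarrow> P x"
    by eventually_elim (use assms(1) in auto)
qed auto

lemma nn_integral_swap_borel: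
  assumes M: "sigma_finite_measure M" "sets M = sets borel" and N: "sigma_finite_measure N" "sets N = sets borel"
    and f: "case_prod f \<in> borel_measurable (borel \<Otimes>\<^sub>M borel)"
  shows "(\<integral>\<^sup>+y. (\<integral>\<^sup>+x. f x y \<partial>M) \<partial>N) = (\<integral>\<^sup>+x. (\<integral>\<^sup>+y. f x y \<partial>N) \<partial>M)"
proof -
  interpret pair_sigma_finite M N
    using M N by (auto simp: pair_sigma_finite_def)
  have "sets (M \<Otimes>\<^sub>M N) = sets (borel \<Otimes>\<^sub>M borel)"
    by (intro sets_pair_measure_cong M N)
  then have "case_prod f \<in> borel_measurable (M \<Otimes>\<^sub>M N)"
    using f measurable_cong_sets by blast
  then show ?thesis by (rule Fubini')
qed

lemma nn_integral_has_integral_Icc: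
  fixes f :: "real \<Rightarrow> real"
  assumes I: "(f has_integral I) {a..b}" and nn: "\<And>x. a \<le> x \<Longrightarrow> x \<le> b \<Longrightarrow> 0 \<le> f x"
    and [measurable]: "f \<in> borel_measurable borel"
  shows "(\<integral>\<^sup>+x\<in>{a..b}. ennreal (f x) \<partial>lborel) = ennreal I"
proof -
  have "(\<lambda>x. f x * indicator {a..b} x) = (\<lambda>x. if x \<in> {a..b} then f x else 0)"
    by (auto simp: indicator_def)
  then have "((\<lambda>x. f x * indicator {a..b} x) has_integral I) UNIV"
    using I by (simp only: has_integral_restrict_UNIV)
  then have "(\<integral>\<^sup>+x. ennreal (f x * indicator {a..b} x) \<partial>lborel) = ennreal I"
  proof (rule nn_integral_has_integral_lborel[rotated 2])
    show "(\<lambda>x. f x * indicator {a..b} x) \<in> borel_measurable borel"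
      by (intro borel_measurable_times borel_measurable_indicator assms(3)) simp
  qed (use nn in \<open>auto simp: indicator_def\<close>)
  also have "(\<integral>\<^sup>+x. ennreal (f x * indicator {a..b} x) \<partial>lborel) = (\<integral>\<^sup>+x\<in>{a..b}. ennreal (f x) \<partial>lborel)"
    by (intro nn_integral_cong) (auto simp: indicator_def)
  finally show ?thesis .
qed

lemma nn_integral_unif_has_integral:
  assumes "(f has_integral I) {0..L}" "\<And>x. 0 \<le> x \<Longrightarrow> x \<le> L \<Longrightarrow> 0 \<le> f x"
    and "f \<in> borel_measurable borel" "L > 0"
  shows "(\<integral>\<^sup>+x. ennreal (f x) \<partial>unif L) = ennreal (I / L)"
proof -
  have "I \<ge> 0" by (rule has_integral_nonneg[OF assms(1)]) (use assms(2) in auto)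
  then show ?thesis
    using nn_integral_has_integral_Icc[OF assms(1-3)] assms(3,4)
    by (subst nn_integral_unif) (auto simp flip: ennreal_mult)
qed

lemma nn_integral_unif_reflect:
  assumes [measurable]: "f \<in> borel_measurable borel" and L: "L > 0"
  shows "(\<integral>\<^sup>+x. f (L - x) \<partial>unif L) = (\<integral>\<^sup>+x. f x \<partial>unif L)"
proof -
  have "(\<integral>\<^sup>+x\<in>{0..L}. f x \<partial>lborel) = (\<integral>\<^sup>+x. f (L + (-1) * x) * indicator {0..L} (L + (-1) * x) \<partial>lborel)"
    by (subst nn_integral_real_affine[where t = L and c = "-1"]) auto
  also have "\<dots> = (\<integral>\<^sup>+x\<in>{0..L}. f (L - x) \<partial>lborel)"
    by (intro nn_integral_cong) (auto simp: indicator_def)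
  finally show ?thesis using L by (simp add: nn_integral_unif)
qed

lemma nn_integral_unif_scale:
  assumes [measurable]: "f \<in> borel_measurable borel" and L: "L > 0" and c: "c > 0"
  shows "(\<integral>\<^sup>+x. f (c * x) \<partial>unif L) = (\<integral>\<^sup>+x. f x \<partial>unif (c * L))"
proof -
  have "(\<integral>\<^sup>+x\<in>{0..c * L}. f x \<partial>lborel) = ennreal c * (\<integral>\<^sup>+x. f (0 + c * x) * indicator {0..c * L} (0 + c * x) \<partial>lborel)"
    using c by (subst nn_integral_real_affine[where t = 0 and c = c]) auto
  also have "(\<integral>\<^sup>+x. f (0 + c * x) * indicator {0..c * L} (0 + c * x) \<partial>lborel) = (\<integral>\<^sup>+x\<in>{0..L}. f (c * x) \<partial>lborel)"
    using c by (intro nn_integral_cong) (auto simp: indicator_def zero_le_mult_iff)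
  finally have "(\<integral>\<^sup>+x. f x \<partial>unif (c * L)) = ennreal (1 / (c * L)) * (ennreal c * (\<integral>\<^sup>+x\<in>{0..L}. f (c * x) \<partial>lborel))"
    using c L by (simp add: nn_integral_unif)
  also have "\<dots> = ennreal (1 / (c * L) * c) * (\<integral>\<^sup>+x\<in>{0..L}. f (c * x) \<partial>lborel)"
    using c L by (subst ennreal_mult) (auto simp: mult.assoc)
  also have "1 / (c * L) * c = 1 / L" using c by simp
  finally show ?thesis using L by (simp add: nn_integral_unif)
qed

lemma nn_integral_Icc_scale:
  fixes f :: "real \<Rightarrow> ennreal"
  assumes [measurable]: "f \<in> borel_measurable borel" and L: "L > 0"
  shows "(\<integral>\<^sup>+x\<in>{0..L}. f x \<partial>lborel) = (\<integral>\<^sup>+t\<in>{0..1}. ennreal L * f (L * t) \<partial>lborel)"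
proof -
  have "(\<integral>\<^sup>+x\<in>{0..L}. f x \<partial>lborel) = ennreal L * (\<integral>\<^sup>+t. f (0 + L * t) * indicator {0..L} (0 + L * t) \<partial>lborel)"
    using L by (subst nn_integral_real_affine[where t = 0 and c = L]) auto
  also have "\<dots> = (\<integral>\<^sup>+t. ennreal L * (f (0 + L * t) * indicator {0..L} (0 + L * t)) \<partial>lborel)"
    by (rule nn_integral_cmult[symmetric]) auto
  also have "\<dots> = (\<integral>\<^sup>+t\<in>{0..1}. ennreal L * f (L * t) \<partial>lborel)"
  proof (rule nn_integral_cong)
    fix t :: real
    have "L * t \<in> {0..L} \<longleftrightarrow> t \<in> {0..1}" using L by (auto simp: zero_le_mult_iff)
    then show "ennreal L * (f (0 + L * t) * indicator {0..L} (0 + L * t)) = ennreal L * f (L * t) * indicator {0..1} t"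
      by (simp add: indicator_def)
  qed
  finally show ?thesis .
qed

lemma nn_integral_unif_fold:
  assumes [measurable]: "f \<in> borel_measurable borel" and L: "L > 0" and sym: "\<And>x. f (2 * L - x) = f x"
  shows "(\<integral>\<^sup>+x. f x \<partial>unif (2 * L)) = (\<integral>\<^sup>+x. f x \<partial>unif L)"
proof -
  have 1: "(\<integral>\<^sup>+x\<in>{L..2*L}. f x \<partial>lborel) = (\<integral>\<^sup>+x\<in>{0..L}. f x \<partial>lborel)"
  proof -
    have "(\<integral>\<^sup>+x\<in>{L..2*L}. f x \<partial>lborel) = (\<integral>\<^sup>+x. f (2 * L + (-1) * x) * indicator {L..2*L} (2 * L + (-1) * x) \<partial>lborel)"
      by (subst nn_integral_real_affine[where t = "2 * L" and c = "-1"]) auto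
    also have "\<dots> = (\<integral>\<^sup>+x\<in>{0..L}. f x \<partial>lborel)"
      by (intro nn_integral_cong) (auto simp: indicator_def sym)
    finally show ?thesis .
  qed
  have "AE x in lborel. x \<noteq> L" by (rule AE_lborel_singleton)
  then have "(\<integral>\<^sup>+x\<in>{0..2*L}. f x \<partial>lborel) = (\<integral>\<^sup>+x. f x * indicator {0..L} x + f x * indicator {L..2*L} x \<partial>lborel)"
    by (intro nn_integral_cong_AE, eventually_elim) (use L in \<open>auto simp: indicator_def\<close>)
  also have "\<dots> = (\<integral>\<^sup>+x\<in>{0..L}. f x \<partial>lborel) + (\<integral>\<^sup>+x\<in>{L..2*L}. f x \<partial>lborel)"
    by (rule nn_integral_add) auto
  also have "\<dots> = ennreal 2 * (\<integral>\<^sup>+x\<in>{0..L}. f x \<partial>lborel)"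
    unfolding 1 by (simp flip: mult_2)
  finally have "(\<integral>\<^sup>+x. f x \<partial>unif (2 * L)) = ennreal (1 / (2 * L)) * (ennreal 2 * (\<integral>\<^sup>+x\<in>{0..L}. f x \<partial>lborel))"
    using L by (simp add: nn_integral_unif)
  also have "\<dots> = ennreal (1 / (2 * L) * 2) * (\<integral>\<^sup>+x\<in>{0..L}. f x \<partial>lborel)"
    using L by (subst ennreal_mult) (auto simp: mult.assoc)
  also have "1 / (2 * L) * 2 = 1 / L" by simp
  finally show ?thesis using L by (simp add: nn_integral_unif)
qed

lemma nn_integral_unif_shift:
  assumes [measurable]: "f \<in> borel_measurable borel" and L: "L > 0" and per: "\<And>x. f (x + L) = f x"
    and c: "0 \<le> c" "c \<le> L"
  shows "(\<integral>\<^sup>+x. f (x + c) \<partial>unif L) = (\<integral>\<^sup>+x. f x \<partial>unif L)"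
proof -
  have 1: "(\<integral>\<^sup>+x\<in>{L..L+c}. f x \<partial>lborel) = (\<integral>\<^sup>+x\<in>{0..c}. f x \<partial>lborel)"
  proof -
    have "(\<integral>\<^sup>+x\<in>{L..L+c}. f x \<partial>lborel) = (\<integral>\<^sup>+x. f (L + 1 * x) * indicator {L..L+c} (L + 1 * x) \<partial>lborel)"
      by (subst nn_integral_real_affine[where t = L and c = 1]) auto
    also have "\<dots> = (\<integral>\<^sup>+x\<in>{0..c}. f x \<partial>lborel)"
      using per by (intro nn_integral_cong) (auto simp: indicator_def add.commute)
    finally show ?thesis .
  qed
  have "(\<integral>\<^sup>+x\<in>{0..L}. f (x + c) \<partial>lborel) = (\<integral>\<^sup>+x. f (c + 1 * x) * indicator {c..L+c} (c + 1 * x) \<partial>lborel)"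
    by (intro nn_integral_cong) (auto simp: indicator_def add.commute)
  also have "\<dots> = (\<integral>\<^sup>+x\<in>{c..L+c}. f x \<partial>lborel)"
    by (subst nn_integral_real_affine[where t = c and c = 1 and f = "\<lambda>x. f x * indicator {c..L+c} x"]) auto
  also have "\<dots> = (\<integral>\<^sup>+x. f x * indicator {c..L} x + f x * indicator {L..L+c} x \<partial>lborel)"
    using AE_lborel_singleton[of L]
    by (intro nn_integral_cong_AE) (use c in \<open>auto elim!: eventually_mono simp: indicator_def\<close>)
  also have "\<dots> = (\<integral>\<^sup>+x\<in>{c..L}. f x \<partial>lborel) + (\<integral>\<^sup>+x\<in>{0..c}. f x \<partial>lborel)"
    unfolding 1[symmetric] by (rule nn_integral_add) auto
  also have "\<dots> = (\<integral>\<^sup>+x. f x * indicator {c..L} x + f x * indicator {0..c} x \<partial>lborel)"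
    by (rule nn_integral_add[symmetric]) auto
  also have "\<dots> = (\<integral>\<^sup>+x\<in>{0..L}. f x \<partial>lborel)"
    using AE_lborel_singleton[of c]
    by (intro nn_integral_cong_AE) (use c in \<open>auto elim!: eventually_mono simp: indicator_def\<close>)
  finally show ?thesis using L by (simp add: nn_integral_unif)
qed

lemma finite_nn_integral_ln_sin: "(\<integral>\<^sup>+t. ennreal (- ln (sin t)) \<partial>unif (pi / 2)) < \<infinity>"
proof -
  have "(\<integral>\<^sup>+t. ennreal (- ln (sin t)) \<partial>unif (pi / 2)) = (\<integral>\<^sup>+u. ennreal (- ln (sin (pi / 2 * u))) \<partial>unif 1)"
    by (subst nn_integral_unif_scale) auto
  also have "\<dots> \<le> (\<integral>\<^sup>+u. ennreal (2 * u powr (-1/2)) \<partial>unif 1)"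
  proof (intro nn_integral_mono_AE AE_unifI[where S = "{0}"] ennreal_leI)
    fix u :: real assume "0 \<le> u" "u \<le> 1" "u \<notin> {0}"
    then have u: "0 < u" "u \<le> 1" by auto
    have s: "u \<le> sin (pi / 2 * u)" using u by (intro sin_ge_chord) auto
    have "- ln (sin (pi / 2 * u)) \<le> - ln u" using s u by simp
    also have "\<dots> \<le> (1 - u) * u powr (- (1/2)) / (1/2)" using u by (intro minus_ln_le) auto
    also have "\<dots> \<le> 1 * u powr (- (1/2)) / (1/2)"
      using u by (intro divide_right_mono mult_right_mono) auto
    finally show "- ln (sin (pi / 2 * u)) \<le> 2 * u powr (-1/2)" by simp
  qed auto
  also have "\<dots> = ennreal (4 / 1)"
  proof (rule nn_integral_unif_has_integral)
    have "((\<lambda>u::real. u powr (-1/2)) has_integral 2) {0..1}"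
      using has_integral_powr_from_0[of "-1/2" 1] by simp
    from has_integral_mult_right[OF this, of 2]
    show "((\<lambda>u::real. 2 * u powr (-1/2)) has_integral 4) {0..1}" by simp
  qed auto
  finally show ?thesis by (rule order.strict_trans1) simp
qed

text \<open>Euler's argument: $\sin 2t = 2 \sin t \cos t$ and the symmetries of sine and cosine give
$E + E = \ln 2 + E$ for the mean $E$, which is finite.\<close>

lemma nn_integral_ln_sin: "(\<integral>\<^sup>+t. ennreal (- ln (sin t)) \<partial>unif (pi / 2)) = ennreal (ln 2)"
proof -
  define E where "E = (\<integral>\<^sup>+t. ennreal (- ln (sin t)) \<partial>unif (pi / 2))"
  have fin: "E < \<infinity>" unfolding E_def by (rule finite_nn_integral_ln_sin)
  have c: "(\<integral>\<^sup>+t. ennreal (- ln (cos t)) \<partial>unif (pi / 2)) = E"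
    unfolding E_def by (subst nn_integral_unif_reflect[symmetric]) (auto simp: cos_sin_eq[symmetric] sin_cos_eq)
  have d: "(\<integral>\<^sup>+t. ennreal (- ln (sin (2 * t))) \<partial>unif (pi / 2)) = E"
  proof -
    have "(\<integral>\<^sup>+t. ennreal (- ln (sin (2 * t))) \<partial>unif (pi / 2)) = (\<integral>\<^sup>+t. ennreal (- ln (sin t)) \<partial>unif (2 * (pi / 2)))"
      by (rule nn_integral_unif_scale) auto
    also have "\<dots> = E" unfolding E_def by (rule nn_integral_unif_fold) auto
    finally show ?thesis .
  qed
  have pos: "0 < sin t \<and> 0 < cos t" if "0 \<le> t" "t \<le> pi / 2" "t \<notin> {0, pi / 2}" for t :: real
    using that by (auto intro!: sin_gt_zero cos_gt_zero)
  have "E + E = (\<integral>\<^sup>+t. ennreal (- ln (sin t)) + ennreal (- ln (cos t)) \<partial>unif (pi / 2))"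
    using c by (subst nn_integral_add) (auto simp: E_def)
  also have "\<dots> = (\<integral>\<^sup>+t. ennreal (ln 2) + ennreal (- ln (sin (2 * t))) \<partial>unif (pi / 2))"
  proof (intro nn_integral_cong_AE AE_unifI[where S = "{0, pi / 2}"])
    fix t :: real assume "0 \<le> t" "t \<le> pi / 2" "t \<notin> {0, pi / 2}"
    from pos[OF this] have p: "0 < sin t" "0 < cos t" by auto
    have "ln (sin (2 * t)) = ln 2 + ln (sin t) + ln (cos t)"
      using p by (simp add: sin_double ln_mult)
    moreover have "0 < sin (2 * t)" using p by (simp add: sin_double)
    then have "ln (sin t) \<le> 0" "ln (cos t) \<le> 0" "ln (sin (2 * t)) \<le> 0"
      using p by (simp_all add: ln_le_zero_iff)
    ultimately show "ennreal (- ln (sin t)) + ennreal (- ln (cos t)) = ennreal (ln 2) + ennreal (- ln (sin (2 * t)))"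
      by (simp flip: ennreal_plus)
  qed auto
  also have "\<dots> = ennreal (ln 2) + E"
    by (subst nn_integral_add) (auto simp: d)
  finally have "E + E = ennreal (ln 2) + E" .
  then have "E = ennreal (ln 2)" using fin
    by (metis add.commute ennreal_add_left_cancel infinity_ennreal_def less_irrefl)
  then show ?thesis by (simp add: E_def)
qed

lemma norm_one_plus_cis: "norm (1 + cis \<theta>) = 2 * \<bar>cos (\<theta> / 2)\<bar>"
proof -
  have "norm (1 + cis \<theta>) ^ 2 = (1 + cos \<theta>) ^ 2 + sin \<theta> ^ 2" by (simp add: cmod_power2)
  also have "\<dots> = 2 + 2 * cos \<theta>" using sin_cos_squared_add[of \<theta>] by (simp add: power2_eq_square algebra_simps)
  also have "\<dots> = (2 * \<bar>cos (\<theta> / 2)\<bar>) ^ 2"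
    using cos_double_cos[of "\<theta> / 2"] by (simp add: power_mult_distrib)
  finally show ?thesis by (rule power2_eq_imp_eq) auto
qed

lemma one_plus_cis_nonzero:
  assumes "0 \<le> \<theta>" "\<theta> \<le> 2 * pi" "\<theta> \<noteq> pi"
  shows "1 + cis \<theta> \<noteq> 0"
proof -
  have "cos (\<theta> / 2) \<noteq> 0"
  proof (cases "\<theta> < pi")
    case True then show ?thesis using assms cos_gt_zero_pi[of "\<theta> / 2"] by auto
  next
    case False
    then have "0 < cos (pi - \<theta> / 2)" using assms by (intro cos_gt_zero_pi) auto
    then show ?thesis by auto
  qed
  then have "norm (1 + cis \<theta>) > 0" unfolding norm_one_plus_cis by simp
  then show ?thesis by auto
qed

lemma norm_one_minus_cis: "norm (1 - cis \<theta>) = 2 * \<bar>sin (\<theta> / 2)\<bar>"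
proof -
  have "norm (1 - cis \<theta>) ^ 2 = (1 - cos \<theta>) ^ 2 + sin \<theta> ^ 2" by (simp add: cmod_power2)
  also have "\<dots> = 2 - 2 * cos \<theta>" using sin_cos_squared_add[of \<theta>] by (simp add: power2_eq_square algebra_simps)
  also have "\<dots> = (2 * \<bar>sin (\<theta> / 2)\<bar>) ^ 2"
    using cos_double_sin[of "\<theta> / 2"] by (simp add: power_mult_distrib)
  finally show ?thesis by (rule power2_eq_imp_eq) auto
qed

lemma nn_integral_circle_fold:
  assumes [measurable]: "f \<in> borel_measurable borel" and sym: "\<And>x. f (2 * pi - x) = f x"
  shows "(\<integral>\<^sup>+x. f x \<partial>unif (2 * pi)) = (\<integral>\<^sup>+t. f (2 * t) \<partial>unif (pi / 2))"
  by (subst nn_integral_unif_scale) (auto intro: nn_integral_unif_fold sym)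

lemma nn_integral_ln_one_plus_cis:
  "(\<integral>\<^sup>+\<theta>. ennreal (ln 2 - ln (norm (1 + cis \<theta>))) \<partial>unif (2 * pi)) = ennreal (ln 2)"
proof -
  have "(\<integral>\<^sup>+\<theta>. ennreal (ln 2 - ln (norm (1 + cis \<theta>))) \<partial>unif (2 * pi))
     = (\<integral>\<^sup>+t. ennreal (ln 2 - ln (2 * \<bar>cos (2 * t / 2)\<bar>)) \<partial>unif (pi / 2))"
    unfolding norm_one_plus_cis
    by (rule nn_integral_circle_fold) (auto simp: diff_divide_distrib)
  also have "\<dots> = (\<integral>\<^sup>+t. ennreal (- ln (cos t)) \<partial>unif (pi / 2))"
  proof (intro nn_integral_cong_AE AE_unifI[where S = "{pi / 2}"])
    fix t :: real assume "0 \<le> t" "t \<le> pi / 2" "t \<notin> {pi / 2}"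
    then have "0 < cos t" by (intro cos_gt_zero_pi) auto
    then show "ennreal (ln 2 - ln (2 * \<bar>cos (2 * t / 2)\<bar>)) = ennreal (- ln (cos t))"
      by (simp add: ln_mult)
  qed auto
  also have "\<dots> = (\<integral>\<^sup>+t. ennreal (- ln (sin t)) \<partial>unif (pi / 2))"
    by (subst nn_integral_unif_reflect[symmetric]) (auto simp: cos_sin_eq[symmetric] sin_cos_eq)
  finally show ?thesis by (simp add: nn_integral_ln_sin)
qed

section \<open>Jensen's formula for linear polynomials\<close>

text \<open>The mean value property of the holomorphic function $\mathrm{Ln} (1 + qz)$ on the unit disc.\<close>

lemma has_integral_ln_one_plus_cis:
  assumes q: "norm q < 1"
  shows "((\<lambda>\<theta>. ln (norm (1 + q * cis \<theta>))) has_integral 0) {0..2 * pi}"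
proof -
  have lt: "norm (q * z) < 1" if "norm z \<le> 1" for z
    using that q mult_left_le[of "norm z" "norm q"] by (simp add: norm_mult)
  have ne: "1 + q * z \<notin> \<real>\<^sub>\<le>\<^sub>0" if "norm z \<le> 1" for z
  proof -
    have "- Re (q * z) < 1" using lt[OF that] abs_Re_le_cmod[of "q * z"] by linarith
    then show ?thesis by (auto simp: complex_nonpos_Reals_iff)
  qed
  have "(\<lambda>z. Ln (1 + q * z)) holomorphic_on cball 0 1"
    by (intro holomorphic_intros) (use ne in auto)
  from Cauchy_integral_circlepath_simple[OF this, of 0]
  have "((\<lambda>u. Ln (1 + q * u) / u) has_contour_integral 0) (part_circlepath 0 1 0 (2 * pi))"
    by (simp add: circlepath_def)
  then have "((\<lambda>t. Ln (1 + q * cis t) * \<i>) has_integral 0) {0..2 * pi}"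
    by (subst (asm) has_contour_integral_part_circlepath_iff) (auto simp: field_simps)
  from has_integral_linear[OF has_integral_mult_right[OF this, of "-\<i>"] bounded_linear_Re]
  have "((\<lambda>t. Re (Ln (1 + q * cis t))) has_integral 0) {0..2 * pi}"
    by (simp add: o_def mult_ac)
  moreover have "Re (Ln (1 + q * cis t)) = ln (norm (1 + q * cis t))" for t
  proof -
    have "1 + q * cis t \<noteq> 0" using ne[of "cis t"] by force
    then show ?thesis by simp
  qed
  ultimately show ?thesis by simp
qed

lemma borel_cis [measurable]: "cis \<in> borel_measurable borel"
  by (intro borel_measurable_continuous_onI continuous_intros)

lemma cis_periodic: "cis (x + 2 * pi) = cis x"
  by (simp add: cis.ctr)

text \<open>The constant $K$ serves to make the integrand nonnegative, so that the mean can be taken in the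
extended nonnegative reals.\<close>

lemma Jensen_linear_less:
  assumes AB: "norm B < norm A" and K: "K \<ge> 0" "ln (norm A + norm B) \<le> K"
  shows "(\<integral>\<^sup>+\<theta>. ennreal (K - ln (norm (A + B * cis \<theta>))) \<partial>unif (2 * pi)) = ennreal (K - ln (norm A))"
proof -
  have A: "A \<noteq> 0" using AB by auto
  have q: "norm (B / A) < 1" using AB A by (simp add: norm_divide)
  have eq: "K - ln (norm (A + B * cis \<theta>)) = (K - ln (norm A)) - ln (norm (1 + B / A * cis \<theta>))" for \<theta>
  proof -
    have e: "A + B * cis \<theta> = A * (1 + B / A * cis \<theta>)" using A by (simp add: field_simps)
    have "norm (B / A * cis \<theta>) < 1" using q by (simp only: norm_mult norm_cis mult_1_right)
    then have "1 + B / A * cis \<theta> \<noteq> 0" by (metis add_eq_0_iff norm_minus_cancel norm_one less_irrefl)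
    then show ?thesis unfolding e norm_mult using A by (simp add: ln_mult)
  qed
  have "(\<integral>\<^sup>+\<theta>. ennreal (K - ln (norm (A + B * cis \<theta>))) \<partial>unif (2 * pi)) = ennreal ((2 * pi * (K - ln (norm A))) / (2 * pi))"
  proof (rule nn_integral_unif_has_integral)
    have "((\<lambda>\<theta>::real. K - ln (norm A)) has_integral (2 * pi) * (K - ln (norm A))) {0..2 * pi}"
      using has_integral_const_real[of "K - ln (norm A)" 0 "2 * pi"] by simp
    from has_integral_diff[OF this has_integral_ln_one_plus_cis[OF q]]
    show "((\<lambda>\<theta>. K - ln (norm (A + B * cis \<theta>))) has_integral 2 * pi * (K - ln (norm A))) {0..2 * pi}"
      unfolding eq by simp
    fix \<theta> :: real
    show "0 \<le> K - ln (norm (A + B * cis \<theta>))"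
    proof (cases "A + B * cis \<theta> = 0")
      case False
      have "norm (A + B * cis \<theta>) \<le> norm A + norm B"
        using norm_triangle_ineq[of A "B * cis \<theta>"] by (simp add: norm_mult)
      then have "ln (norm (A + B * cis \<theta>)) \<le> ln (norm A + norm B)" using False by (intro ln_mono) auto
      then show ?thesis using K by linarith
    qed (use K in simp)
  qed auto
  then show ?thesis by simp
qed

text \<open>On the circle of equality the zero lies on the path of integration; a rotation moves the
zero to $\theta = \pi$, and that mean is known from Euler's integral.\<close>

lemma Jensen_linear_eq:
  assumes AB: "norm B = norm A" and A: "A \<noteq> 0" and K: "ln (norm A + norm B) \<le> K"
  shows "(\<integral>\<^sup>+\<theta>. ennreal (K - ln (norm (A + B * cis \<theta>))) \<partial>unif (2 * pi)) = ennreal (K - ln (norm A))"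
proof -
  define \<delta> where "\<delta> = Arg2pi (B / A)"
  have \<delta>: "0 \<le> \<delta>" "\<delta> \<le> 2 * pi" using Arg2pi_ge_0 Arg2pi_lt_2pi[of "B / A"] by (auto simp: \<delta>_def)
  have "B / A = of_real (norm (B / A)) * exp (\<i> * of_real \<delta>)" unfolding \<delta>_def by (rule Arg2pi_eq)
  then have BA: "B / A = cis \<delta>" using AB A by (simp add: norm_divide cis_conv_exp)
  define K' where "K' = K - ln (norm A) - ln 2"
  have "ln (2 * norm A) \<le> K" using K AB by simp
  then have K': "K' \<ge> 0" using A by (simp add: K'_def ln_mult)
  have le: "ln (norm (1 + cis \<theta>)) \<le> ln 2" for \<theta>
  proof (cases "1 + cis \<theta> = 0")
    case False
    have "norm (1 + cis \<theta>) \<le> 2" using norm_triangle_ineq[of 1 "cis \<theta>"] by simp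
    then show ?thesis using False by (intro ln_mono) auto
  qed simp
  have "(\<integral>\<^sup>+\<theta>. ennreal (K - ln (norm (A + B * cis \<theta>))) \<partial>unif (2 * pi))
      = (\<integral>\<^sup>+\<theta>. ennreal (K - ln (norm A * norm (1 + cis (\<theta> + \<delta>)))) \<partial>unif (2 * pi))"
  proof -
    have "A + B * cis \<theta> = A * (1 + cis (\<theta> + \<delta>))" for \<theta>
    proof -
      have "B = A * cis \<delta>" using BA A by (simp add: field_simps)
      then show ?thesis by (simp add: cis_mult[symmetric] algebra_simps)
    qed
    then show ?thesis by (simp add: norm_mult)
  qed
  also have "\<dots> = (\<integral>\<^sup>+\<theta>. ennreal (K - ln (norm A * norm (1 + cis \<theta>))) \<partial>unif (2 * pi))"
    by (rule nn_integral_unif_shift[where f = "\<lambda>\<theta>. ennreal (K - ln (norm A * norm (1 + cis \<theta>)))"])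
       (use \<delta> in \<open>auto simp: cis_periodic\<close>)
  also have "\<dots> = (\<integral>\<^sup>+\<theta>. ennreal K' + ennreal (ln 2 - ln (norm (1 + cis \<theta>))) \<partial>unif (2 * pi))"
  proof (intro nn_integral_cong_AE AE_unifI[where S = "{pi}"])
    fix \<theta> :: real assume \<theta>: "0 \<le> \<theta>" "\<theta> \<le> 2 * pi" "\<theta> \<notin> {pi}"
    then have "norm (1 + cis \<theta>) > 0" using one_plus_cis_nonzero[of \<theta>] by simp
    then have "K - ln (norm A * norm (1 + cis \<theta>)) = K' + (ln 2 - ln (norm (1 + cis \<theta>)))"
      using A by (simp add: K'_def ln_mult)
    then show "ennreal (K - ln (norm A * norm (1 + cis \<theta>))) = ennreal K' + ennreal (ln 2 - ln (norm (1 + cis \<theta>)))"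
      using K' le[of \<theta>] by (simp flip: ennreal_plus)
  qed auto
  also have "\<dots> = ennreal K' + ennreal (ln 2)"
    by (subst nn_integral_add) (auto simp: nn_integral_ln_one_plus_cis)
  also have "\<dots> = ennreal (K - ln (norm A))" using K' by (simp add: K'_def flip: ennreal_plus)
  finally show ?thesis .
qed

text \<open>If $|A| < |B|$, conjugation and a multiplication by $e^{i\theta}$ exchange the roles of $A$ and $B$.\<close>

lemma Jensen_linear:
  assumes A: "A \<noteq> 0" and K: "K \<ge> 0" "ln (norm A + norm B) \<le> K"
  shows "(\<integral>\<^sup>+\<theta>. ennreal (K - ln (norm (A + B * cis \<theta>))) \<partial>unif (2 * pi))
           = ennreal (K - ln (max (norm A) (norm B)))"
proof (cases "norm A" "norm B" rule: linorder_cases)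
  case less
  have "norm (A + B * cis \<theta>) = norm (cnj B + cnj A * cis \<theta>)" for \<theta>
  proof -
    have "norm (A + B * cis \<theta>) = norm (cnj (A + B * cis \<theta>) * cis \<theta>)"
      by (simp add: norm_mult del: complex_cnj_add)
    also have "cnj (A + B * cis \<theta>) * cis \<theta> = cnj B + cnj A * cis \<theta>"
      by (simp add: algebra_simps cis_cnj cis_mult)
    finally show ?thesis .
  qed
  then show ?thesis using Jensen_linear_less[of "cnj A" "cnj B" K] less K by (simp add: add.commute max_def)
next
  case equal then show ?thesis using Jensen_linear_eq[of B A K] A K by simp
next
  case greater then show ?thesis using Jensen_linear_less[of B A K] K by (simp add: max_def)
qed

section \<open>The Legendre chi function on the unit interval\<close>

lemma borel_measurable_plog [measurable]: "plog r \<in> borel_measurable borel"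
  unfolding plog_def[abs_def] suminf_eq_lim by (intro borel_measurable_lim_metric) measurable

lemma borel_measurable_legendre_chi [measurable]: "legendre_chi r \<in> borel_measurable borel"
  unfolding legendre_chi_def[abs_def] by measurable

lemma legendre_chi_deriv:
  assumes "0 < t" "t < 1" "r > 0"
  shows "(legendre_chi (Suc r) has_real_derivative legendre_chi r t / t) (at t)"
proof -
  have 1: "((\<lambda>t. plog (Suc r) (of_real t)) has_vector_derivative plog r (of_real t) / of_real t) (at t)"
    by (intro has_vector_derivative_real_field plog_deriv) (use assms in auto)
  have "((\<lambda>z. plog (Suc r) (- z)) has_field_derivative plog r (- of_real t) / (- of_real t) * (-1)) (at (of_real t))"
    by (rule DERIV_chain2[where f = "plog (Suc r)" and g = uminus, OF plog_deriv])
       (use assms in \<open>auto intro!: derivative_eq_intros\<close>)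
  then have "((\<lambda>z. plog (Suc r) (- z)) has_field_derivative plog r (- of_real t) / of_real t) (at (of_real t))"
    by simp
  from has_vector_derivative_real_field[OF this]
  have 2: "((\<lambda>t. plog (Suc r) (- of_real t)) has_vector_derivative plog r (- of_real t) / of_real t) (at t)" .
  have "((\<lambda>t. Re (plog (Suc r) (of_real t) - plog (Suc r) (- of_real t))) has_vector_derivative
          Re (plog r (of_real t) / of_real t - plog r (- of_real t) / of_real t)) (at t)"
    by (intro bounded_linear.has_vector_derivative[OF bounded_linear_Re] has_vector_derivative_diff 1 2)
  then show ?thesis
    unfolding has_real_derivative_iff_has_vector_derivative legendre_chi_def[abs_def]
    by (simp add: Re_divide_of_real diff_divide_distrib)
qed

lemma legendre_chi_1:
  assumes "0 \<le> t" "t < 1"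
  shows "legendre_chi 1 t = ln ((1 + t) / (1 - t))"
proof -
  have p: "plog 1 z = - Ln (1 - z)" if "norm z < 1" for z
  proof -
    have "(\<lambda>n. (- 1) ^ Suc n / of_nat n * (- z) ^ n) sums Ln (1 + (- z))"
      by (rule Ln_series) (use that in simp)
    moreover have "(- 1) ^ Suc n / of_nat n * (- z) ^ n = - (inverse (of_nat n ^ 1) * z ^ n)" for n
    proof -
      have "(- 1) ^ n * (- z) ^ n = z ^ n" by (simp flip: power_mult_distrib)
      then show ?thesis by (simp add: field_simps)
    qed
    ultimately have "(\<lambda>n. - (inverse (of_nat n ^ 1) * z ^ n)) sums Ln (1 - z)" by simp
    from sums_minus[OF this] show ?thesis by (simp add: plog_def sums_iff)
  qed
  have "plog 1 (of_real t) = - of_real (ln (1 - t))"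
    using assms p[of "of_real t"] Ln_of_real[of "1 - t"] by simp
  moreover have "plog 1 (- of_real t) = - of_real (ln (1 + t))"
    using assms p[of "- of_real t"] Ln_of_real[of "1 + t"] by simp
  ultimately show ?thesis using assms by (simp add: legendre_chi_def ln_div)
qed

lemma continuous_on_legendre_chi:
  assumes "r \<ge> 2"
  shows "continuous_on {0..1} (legendre_chi r)"
  unfolding legendre_chi_def[abs_def]
  by (intro continuous_intros assms) auto

lemma legendre_chi_0 [simp]: "r > 0 \<Longrightarrow> legendre_chi r 0 = 0"
  by (simp add: legendre_chi_def)

lemma legendre_chi_bound:
  assumes "r \<ge> 2"
  shows "\<exists>C\<ge>0. \<forall>t. 0 \<le> t \<longrightarrow> t \<le> 1 \<longrightarrow> \<bar>legendre_chi r t\<bar> \<le> C * t"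
proof -
  obtain C where C: "C \<ge> 0" "\<And>z. norm z \<le> 1 \<Longrightarrow> norm (plog r z) \<le> C * norm z"
    using plog_bound[OF assms] by auto
  have "\<bar>legendre_chi r t\<bar> \<le> (2 * C) * t" if "0 \<le> t" "t \<le> 1" for t
  proof -
    have "\<bar>legendre_chi r t\<bar> \<le> norm (plog r (of_real t) - plog r (- of_real t))"
      unfolding legendre_chi_def by (rule abs_Re_le_cmod)
    also have "\<dots> \<le> norm (plog r (of_real t)) + norm (plog r (- of_real t))" by (rule norm_triangle_ineq4)
    also have "\<dots> \<le> C * t + C * t"
      using C(2)[of "of_real t"] C(2)[of "- of_real t"] that by (intro add_mono) auto
    finally show ?thesis by simp
  qed
  then show ?thesis using C(1) by (intro exI[of _ "2 * C"]) auto
qed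

section \<open>The product of two tangents\<close>

lemma nn_integral_UN_incseq:
  fixes f :: "real \<Rightarrow> ennreal"
  assumes [measurable]: "f \<in> borel_measurable borel" and A: "incseq A" "\<And>n. A n \<in> sets borel"
  shows "(\<integral>\<^sup>+x. f x * indicator (\<Union>n. A n) x \<partial>lborel) = (SUP n. \<integral>\<^sup>+x. f x * indicator (A n) x \<partial>lborel)"
proof -
  have "emeasure (density lborel f) B = (\<integral>\<^sup>+x. f x * indicator B x \<partial>lborel)" if "B \<in> sets borel" for B
    using that by (intro emeasure_density) auto
  moreover have "(SUP n. emeasure (density lborel f) (A n)) = emeasure (density lborel f) (\<Union>n. A n)"
    using A by (intro SUP_emeasure_incseq) auto
  ultimately show ?thesis using A by (simp add: sets.countable_UN)
qed

lemma borel_measurable_tan [measurable]: "tan \<in> borel_measurable (borel :: real measure)"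
  unfolding tan_def[abs_def] by measurable

text \<open>The substitution $x = k \tan w$ on $[0, n]$, exhausted over $n$ because the tangent is unbounded.\<close>

lemma nn_integral_tan:
  fixes f :: "real \<Rightarrow> ennreal"
  assumes [measurable]: "f \<in> borel_measurable borel" and k: "k > 0"
  shows "(\<integral>\<^sup>+w. f (k * tan w) \<partial>unif (pi / 2)) =
           ennreal (2 / pi) * (\<integral>\<^sup>+x\<in>{0..}. f x * ennreal (k / (k\<^sup>2 + x\<^sup>2)) \<partial>lborel)"
proof -
  have pos: "0 < k\<^sup>2 + x\<^sup>2" for x using k by (intro add_pos_nonneg) auto
  have step: "(\<integral>\<^sup>+w. f (k * tan w) * indicator {0..arctan (real (Suc n) / k)} w \<partial>lborel) =
      (\<integral>\<^sup>+x. f x * ennreal (k / (k\<^sup>2 + x\<^sup>2)) * indicator {0..real (Suc n)} x \<partial>lborel)" for n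
  proof -
    have "(\<integral>\<^sup>+w. f (k * tan w) * indicator {arctan (0 / k)..arctan (real (Suc n) / k)} w \<partial>lborel) =
      (\<integral>\<^sup>+x. f (k * tan (arctan (x / k))) * ennreal (k / (k\<^sup>2 + x\<^sup>2)) * indicator {0..real (Suc n)} x \<partial>lborel)"
    proof (rule nn_integral_substitution_aux[where f = "\<lambda>w. f (k * tan w)" and g = "\<lambda>x. arctan (x / k)"])
      fix x :: real
      have "inverse (1 + (x / k)\<^sup>2) * (1 / k) = k / (k\<^sup>2 + x\<^sup>2)"
        using k pos[of x] by (simp add: field_simps power2_eq_square)
      moreover have "((\<lambda>x. arctan (x / k)) has_real_derivative inverse (1 + (x / k)\<^sup>2) * (1 / k)) (at x)"
        using k by (auto intro!: derivative_eq_intros)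
      ultimately show "((\<lambda>x. arctan (x / k)) has_real_derivative k / (k\<^sup>2 + x\<^sup>2)) (at x)" by simp
    qed (use k pos in \<open>auto intro!: continuous_intros simp: less_imp_neq[symmetric] less_imp_le\<close>)
    then show ?thesis using k by (simp add: tan_arctan)
  qed
  have "incseq (\<lambda>n. {0..arctan (real (Suc n) / k)})"
    using k by (auto simp: incseq_def divide_right_mono arctan_monotone' order.trans[OF _ arctan_monotone'])
  moreover have "(\<Union>n. {0..arctan (real (Suc n) / k)}) = {0..<pi / 2}"
  proof safe
    fix w n assume "w \<in> {0..arctan (real (Suc n) / k)}"
    then show "w \<in> {0..<pi / 2}" using arctan_ubound[of "real (Suc n) / k"] by auto
  next
    fix w :: real assume w: "w \<in> {0..<pi / 2}"
    obtain n where "k * tan w \<le> real n" using real_arch_simple by blast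
    then have "tan w \<le> real (Suc n) / k" using k by (simp add: field_simps)
    then have "arctan (tan w) \<le> arctan (real (Suc n) / k)" by (rule arctan_monotone')
    then show "w \<in> (\<Union>n. {0..arctan (real (Suc n) / k)})" using w by (auto simp: arctan_tan)
  qed
  ultimately have "(\<integral>\<^sup>+w. f (k * tan w) * indicator {0..<pi / 2} w \<partial>lborel) =
      (SUP n. \<integral>\<^sup>+w. f (k * tan w) * indicator {0..arctan (real (Suc n) / k)} w \<partial>lborel)"
    using nn_integral_UN_incseq[of "\<lambda>w. f (k * tan w)" "\<lambda>n. {0..arctan (real (Suc n) / k)}"] by auto
  also have "\<dots> = (SUP n. \<integral>\<^sup>+x. f x * ennreal (k / (k\<^sup>2 + x\<^sup>2)) * indicator {0..real (Suc n)} x \<partial>lborel)"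
    by (simp only: step)
  also have "\<dots> = (\<integral>\<^sup>+x\<in>{0..}. f x * ennreal (k / (k\<^sup>2 + x\<^sup>2)) \<partial>lborel)"
  proof -
    have "{0..} \<subseteq> (\<Union>n. {0..real (Suc n)})"
    proof
      fix x :: real assume x: "x \<in> {0..}"
      obtain n where "x \<le> real n" using real_arch_simple by blast
      then have "x \<in> {0..real (Suc n)}" using x by simp
      then show "x \<in> (\<Union>n. {0..real (Suc n)})" by blast
    qed
    then have "(\<Union>n. {0..real (Suc n)}) = {0..}" by auto
    then show ?thesis
      using nn_integral_UN_incseq[of "\<lambda>x. f x * ennreal (k / (k\<^sup>2 + x\<^sup>2))" "\<lambda>n. {0..real (Suc n)}"]
      by (auto simp: incseq_def)
  qed
  finally have main: "(\<integral>\<^sup>+w. f (k * tan w) * indicator {0..<pi / 2} w \<partial>lborel) = \<dots>" .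
  have "(\<integral>\<^sup>+w\<in>{0..pi / 2}. f (k * tan w) \<partial>lborel) = (\<integral>\<^sup>+w. f (k * tan w) * indicator {0..<pi / 2} w \<partial>lborel)"
    using AE_lborel_singleton[of "pi / 2"]
    by (intro nn_integral_cong_AE) (auto elim!: eventually_mono simp: indicator_def)
  then show ?thesis by (subst nn_integral_unif) (auto simp: main)
qed

text \<open>Up to the factor $4/\pi^2$ the density of the product of two independent tangents.\<close>

definition tan_kernel :: "real \<Rightarrow> real" where
  "tan_kernel x = ln x / (x\<^sup>2 - 1)"

lemma borel_tan_kernel [measurable]: "tan_kernel \<in> borel_measurable borel"
  unfolding tan_kernel_def[abs_def] by measurable

lemma tan_kernel_nonneg: "0 \<le> x \<Longrightarrow> tan_kernel x \<ge> 0"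
proof (cases "x = 0 \<or> x = 1")
  case False
  assume "0 \<le> x"
  then have x: "x > 0" "x \<noteq> 1" using False by auto
  show ?thesis
  proof (cases "x < 1")
    case True
    then have "x\<^sup>2 - 1 < 0" using x by (simp add: power_less_one_iff abs_square_less_1)
    then show ?thesis using True x by (simp add: tan_kernel_def divide_nonpos_nonpos)
  qed (use x in \<open>auto simp: tan_kernel_def\<close>)
qed (auto simp: tan_kernel_def)

lemma nn_integral_tan_kernel:
  assumes x: "x > 0" "x \<noteq> 1"
  shows "(\<integral>\<^sup>+v. ennreal (tan v / ((tan v)\<^sup>2 + x\<^sup>2)) \<partial>unif (pi / 2)) = ennreal (2 / pi) * ennreal (tan_kernel x)"
proof -
  have x1: "x\<^sup>2 \<noteq> 1" using x by (simp add: power2_eq_1_iff)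
  have D: "(sin v)\<^sup>2 + x\<^sup>2 * (cos v)\<^sup>2 > 0" for v
  proof (cases "cos v = 0")
    case True
    then have "(sin v)\<^sup>2 = 1" using sin_cos_squared_add[of v] by simp
    then show ?thesis using True by simp
  qed (use x in \<open>auto intro!: add_nonneg_pos\<close>)
  have "(\<integral>\<^sup>+v. ennreal (tan v / ((tan v)\<^sup>2 + x\<^sup>2)) \<partial>unif (pi / 2)) =
        (\<integral>\<^sup>+v. ennreal (sin v * cos v / ((sin v)\<^sup>2 + x\<^sup>2 * (cos v)\<^sup>2)) \<partial>unif (pi / 2))"
  proof (intro nn_integral_cong_AE AE_unifI[where S = "{pi / 2}"])
    fix v :: real assume "0 \<le> v" "v \<le> pi / 2" "v \<notin> {pi / 2}"
    then have c: "0 < cos v" by (intro cos_gt_zero_pi) auto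
    have "(tan v)\<^sup>2 + x\<^sup>2 = ((sin v)\<^sup>2 + x\<^sup>2 * (cos v)\<^sup>2) / (cos v)\<^sup>2"
      using c by (simp add: tan_def power_divide add_divide_distrib)
    then have "tan v / ((tan v)\<^sup>2 + x\<^sup>2) = sin v * cos v / ((sin v)\<^sup>2 + x\<^sup>2 * (cos v)\<^sup>2)"
      using c by (simp add: tan_def power2_eq_square)
    then show "ennreal (tan v / ((tan v)\<^sup>2 + x\<^sup>2)) = ennreal (sin v * cos v / ((sin v)\<^sup>2 + x\<^sup>2 * (cos v)\<^sup>2))"
      by simp
  qed auto
  also have "\<dots> = ennreal (tan_kernel x / (pi / 2))"
  proof (rule nn_integral_unif_has_integral)
    \<comment> \<open>$\sin^2 v + x^2 \cos^2 v$ has derivative $-2 (x^2 - 1) \sin v \cos v$ and runs from $x^2$ to 1.\<close>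
    define F where "F = (\<lambda>v. - ln ((sin v)\<^sup>2 + x\<^sup>2 * (cos v)\<^sup>2) / (2 * (x\<^sup>2 - 1)))"
    have "((\<lambda>v. sin v * cos v / ((sin v)\<^sup>2 + x\<^sup>2 * (cos v)\<^sup>2)) has_integral F (pi / 2) - F 0) {0..pi / 2}"
    proof (rule fundamental_theorem_of_calculus)
      fix v :: real
      have "(F has_real_derivative - ((2 * sin v * cos v + x\<^sup>2 * (2 * cos v * - sin v)) / ((sin v)\<^sup>2 + x\<^sup>2 * (cos v)\<^sup>2)) / (2 * (x\<^sup>2 - 1))) (at v)"
        unfolding F_def using D[of v] x1 by (auto intro!: derivative_eq_intros simp: power2_eq_square)
      also have "- ((2 * sin v * cos v + x\<^sup>2 * (2 * cos v * - sin v)) / ((sin v)\<^sup>2 + x\<^sup>2 * (cos v)\<^sup>2)) / (2 * (x\<^sup>2 - 1))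
          = sin v * cos v / ((sin v)\<^sup>2 + x\<^sup>2 * (cos v)\<^sup>2)"
      proof -
        have "2 * sin v * cos v + x\<^sup>2 * (2 * cos v * - sin v) = - (sin v * cos v) * (2 * (x\<^sup>2 - 1))"
          by (simp add: algebra_simps)
        then show ?thesis using x1 by simp
      qed
      finally show "(F has_vector_derivative sin v * cos v / ((sin v)\<^sup>2 + x\<^sup>2 * (cos v)\<^sup>2)) (at v within {0..pi / 2})"
        by (simp add: has_real_derivative_iff_has_vector_derivative has_vector_derivative_at_within)
    qed simp
    also have "F (pi / 2) - F 0 = tan_kernel x"
    proof -
      have "x\<^sup>2 - 1 \<noteq> 0" "2 * x\<^sup>2 - 2 \<noteq> 0" using x1 by auto
      then show ?thesis using x by (simp add: F_def tan_kernel_def ln_realpow frac_eq_eq algebra_simps)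
    qed
    finally show "((\<lambda>v. sin v * cos v / ((sin v)\<^sup>2 + x\<^sup>2 * (cos v)\<^sup>2)) has_integral tan_kernel x) {0..pi / 2}" .
  next
    fix v :: real assume "0 \<le> v" "v \<le> pi / 2"
    then show "0 \<le> sin v * cos v / ((sin v)\<^sup>2 + x\<^sup>2 * (cos v)\<^sup>2)"
      using D[of v] by (intro divide_nonneg_pos mult_nonneg_nonneg sin_ge_zero cos_ge_zero) auto
  qed auto
  also have "tan_kernel x / (pi / 2) = 2 / pi * tan_kernel x" by simp
  finally show ?thesis
    using ennreal_mult[of "2 / pi" "tan_kernel x"] tan_kernel_nonneg[of x] x by simp
qed

text \<open>The inner mean turns $T_2$ into a Cauchy density of scale $T_1$; the mean over $T_1$ of that density
is elementary.\<close>

lemma nn_integral_tan_tan: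
  fixes f :: "real \<Rightarrow> ennreal"
  assumes [measurable]: "f \<in> borel_measurable borel"
  shows "(\<integral>\<^sup>+v. \<integral>\<^sup>+w. f (tan v * tan w) \<partial>unif (pi / 2) \<partial>unif (pi / 2)) =
           ennreal (4 / pi\<^sup>2) * (\<integral>\<^sup>+x\<in>{0..}. f x * ennreal (tan_kernel x) \<partial>lborel)"
proof -
  have "(\<integral>\<^sup>+v. \<integral>\<^sup>+w. f (tan v * tan w) \<partial>unif (pi / 2) \<partial>unif (pi / 2)) =
      (\<integral>\<^sup>+v. ennreal (2 / pi) * (\<integral>\<^sup>+x\<in>{0..}. f x * ennreal (tan v / ((tan v)\<^sup>2 + x\<^sup>2)) \<partial>lborel) \<partial>unif (pi / 2))"
    by (intro nn_integral_cong_AE AE_unifI[where S = "{0, pi / 2}"] nn_integral_tan)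
       (auto intro!: tan_gt_zero)
  also have "\<dots> = ennreal (2 / pi) * (\<integral>\<^sup>+v. (\<integral>\<^sup>+x\<in>{0..}. f x * ennreal (tan v / ((tan v)\<^sup>2 + x\<^sup>2)) \<partial>lborel) \<partial>unif (pi / 2))"
    by (rule nn_integral_cmult) (auto intro!: sigma_finite_measure.borel_measurable_nn_integral sigma_finite_lborel)
  also have "(\<integral>\<^sup>+v. (\<integral>\<^sup>+x\<in>{0..}. f x * ennreal (tan v / ((tan v)\<^sup>2 + x\<^sup>2)) \<partial>lborel) \<partial>unif (pi / 2)) =
     (\<integral>\<^sup>+x. (\<integral>\<^sup>+v. f x * ennreal (tan v / ((tan v)\<^sup>2 + x\<^sup>2)) * indicator {0..} x \<partial>unif (pi / 2)) \<partial>lborel)"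
    by (rule nn_integral_swap_borel) (auto intro!: sigma_finite_lborel sigma_finite_unif)
  also have "\<dots> = (\<integral>\<^sup>+x. ennreal (2 / pi) * (f x * ennreal (tan_kernel x) * indicator {0..} x) \<partial>lborel)"
    using AE_lborel_singleton[of 0] AE_lborel_singleton[of 1]
  proof (intro nn_integral_cong_AE, eventually_elim)
    fix x :: real assume x: "x \<noteq> 0" "x \<noteq> 1"
    show "(\<integral>\<^sup>+v. f x * ennreal (tan v / ((tan v)\<^sup>2 + x\<^sup>2)) * indicator {0..} x \<partial>unif (pi / 2)) =
      ennreal (2 / pi) * (f x * ennreal (tan_kernel x) * indicator {0..} x)"
    proof (cases "x > 0")
      case True
      have "(\<integral>\<^sup>+v. f x * ennreal (tan v / ((tan v)\<^sup>2 + x\<^sup>2)) \<partial>unif (pi / 2)) =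
         f x * (\<integral>\<^sup>+v. ennreal (tan v / ((tan v)\<^sup>2 + x\<^sup>2)) \<partial>unif (pi / 2))"
        by (rule nn_integral_cmult) auto
      then show ?thesis using True nn_integral_tan_kernel[OF True x(2)] by (simp add: mult_ac)
    qed (use x in auto)
  qed
  also have "\<dots> = ennreal (2 / pi) * (\<integral>\<^sup>+x\<in>{0..}. f x * ennreal (tan_kernel x) \<partial>lborel)"
    by (rule nn_integral_cmult) auto
  also have "ennreal (2 / pi) * (ennreal (2 / pi) * (\<integral>\<^sup>+x\<in>{0..}. f x * ennreal (tan_kernel x) \<partial>lborel)) =
     ennreal (2 / pi * (2 / pi)) * (\<integral>\<^sup>+x\<in>{0..}. f x * ennreal (tan_kernel x) \<partial>lborel)"
    by (subst ennreal_mult) (auto simp: mult.assoc)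
  also have "2 / pi * (2 / pi) = 4 / pi\<^sup>2" by (simp add: power2_eq_square)
  finally show ?thesis .
qed

section \<open>The quotient of two cosines\<close>

definition ln_plus :: "real \<Rightarrow> real" where
  "ln_plus y = max 0 (ln y)"

lemma borel_ln_plus [measurable]: "ln_plus \<in> borel_measurable borel"
  unfolding ln_plus_def[abs_def] by measurable

lemma ln_plus_nonneg [simp]: "ln_plus y \<ge> 0"
  by (simp add: ln_plus_def)

text \<open>With $1 - c^2 \cos^2 s = (1 - c^2) + c^2 \sin^2 s$ the integrand is the derivative of an inverse
hyperbolic sine in $\sin s$.\<close>

lemma nn_integral_cos_sqrt:
  assumes c: "0 < c" "c < 1"
  shows "(\<integral>\<^sup>+s. ennreal (cos s / sqrt (1 - c\<^sup>2 * (cos s)\<^sup>2)) \<partial>unif (pi / 2)) =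
           ennreal (2 / pi) * ennreal (legendre_chi 1 c / (2 * c))"
proof -
  have c2: "c\<^sup>2 < 1" using c by (simp add: power_less_one_iff abs_square_less_1)
  have D: "1 - c\<^sup>2 * (cos s)\<^sup>2 = (1 - c\<^sup>2) + c\<^sup>2 * (sin s)\<^sup>2" for s
    using sin_cos_squared_add[of s] by (simp add: cos_squared_eq algebra_simps)
  have pos: "0 < 1 - c\<^sup>2 * (cos s)\<^sup>2" for s
    unfolding D using c2 by (intro add_pos_nonneg) auto
  define r where "r = sqrt (1 - c\<^sup>2)"
  have r: "r > 0" "r\<^sup>2 = 1 - c\<^sup>2" using c2 by (auto simp: r_def)
  define F where "F = (\<lambda>s. arsinh (c * sin s / r) / c)"
  have "(\<integral>\<^sup>+s. ennreal (cos s / sqrt (1 - c\<^sup>2 * (cos s)\<^sup>2)) \<partial>unif (pi / 2)) =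
      ennreal ((legendre_chi 1 c / (2 * c)) / (pi / 2))"
  proof (rule nn_integral_unif_has_integral)
    have "((\<lambda>s. cos s / sqrt (1 - c\<^sup>2 * (cos s)\<^sup>2)) has_integral F (pi / 2) - F 0) {0..pi / 2}"
    proof (rule fundamental_theorem_of_calculus)
      fix s :: real
      have "(F has_real_derivative (1 / sqrt ((c * sin s / r)\<^sup>2 + 1) * (c * cos s / r)) / c) (at s)"
        unfolding F_def using r c
        by (intro DERIV_cdivide DERIV_chain2[where f = arsinh, OF arsinh_real_has_field_derivative])
           (auto intro!: derivative_eq_intros)
      also have "(c * sin s / r)\<^sup>2 + 1 = (1 - c\<^sup>2 * (cos s)\<^sup>2) / r\<^sup>2"
        unfolding D r(2)[symmetric] using r by (simp add: field_simps power2_eq_square)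
      also have "sqrt ((1 - c\<^sup>2 * (cos s)\<^sup>2) / r\<^sup>2) = sqrt (1 - c\<^sup>2 * (cos s)\<^sup>2) / r"
        using r(1) by (simp add: real_sqrt_divide)
      also have "(1 / (sqrt (1 - c\<^sup>2 * (cos s)\<^sup>2) / r) * (c * cos s / r)) / c = cos s / sqrt (1 - c\<^sup>2 * (cos s)\<^sup>2)"
        using r c by simp
      finally show "(F has_vector_derivative cos s / sqrt (1 - c\<^sup>2 * (cos s)\<^sup>2)) (at s within {0..pi / 2})"
        by (simp add: has_real_derivative_iff_has_vector_derivative has_vector_derivative_at_within)
    qed simp
    also have "F (pi / 2) - F 0 = legendre_chi 1 c / (2 * c)"
    proof -
      have "(c / r)\<^sup>2 + 1 = (1 / r)\<^sup>2"
      proof -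
        have "(c / r)\<^sup>2 + 1 = (c\<^sup>2 + r\<^sup>2) / r\<^sup>2" using r(1) by (simp add: power_divide add_divide_distrib)
        also have "c\<^sup>2 + r\<^sup>2 = 1" using r by simp
        finally show ?thesis by (simp add: power_divide)
      qed
      then have s1: "sqrt ((c / r)\<^sup>2 + 1) = 1 / r" using r by simp
      have "arsinh (c / r) = ln (c / r + sqrt ((c / r)\<^sup>2 + 1))" by (simp add: arsinh_real_def)
      also have "\<dots> = ln ((1 + c) / r)" unfolding s1 by (simp add: add_divide_distrib add.commute)
      also have "\<dots> = ln (1 + c) - ln r" using r c by (simp add: ln_div)
      also have "ln r = ln (1 - c\<^sup>2) / 2" unfolding r_def using c2 by (simp add: ln_sqrt)
      also have "1 - c\<^sup>2 = (1 - c) * (1 + c)" by (simp add: power2_eq_square algebra_simps)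
      also have "ln ((1 - c) * (1 + c)) = ln (1 - c) + ln (1 + c)" using c by (simp add: ln_mult)
      finally have ar: "arsinh (c / r) = (ln (1 + c) - ln (1 - c)) / 2" by (simp add: field_simps)
      have "F (pi / 2) - F 0 = arsinh (c / r) / c" by (simp add: F_def)
      also have "\<dots> = (ln (1 + c) - ln (1 - c)) / (2 * c)" unfolding ar by simp
      finally show ?thesis using c legendre_chi_1[of c] by (simp add: ln_div)
    qed
    finally show "((\<lambda>s. cos s / sqrt (1 - c\<^sup>2 * (cos s)\<^sup>2)) has_integral legendre_chi 1 c / (2 * c)) {0..pi / 2}" .
  next
    fix s :: real assume "0 \<le> s" "s \<le> pi / 2"
    then show "0 \<le> cos s / sqrt (1 - c\<^sup>2 * (cos s)\<^sup>2)"
      using pos[of s] by (intro divide_nonneg_pos cos_ge_zero) auto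
  qed auto
  also have "(legendre_chi 1 c / (2 * c)) / (pi / 2) = 2 / pi * (legendre_chi 1 c / (2 * c))" by simp
  finally show ?thesis
    using c ennreal_mult[of "2 / pi" "legendre_chi 1 c / (2 * c)"] legendre_chi_1[of c] by simp
qed

text \<open>After reflecting $t$, the integrand lives on $\sin t \le \alpha \cos s$; the substitution
$\sin t = c \cos s$ removes $s$ from the logarithm.\<close>

lemma nn_integral_ln_plus_inner:
  assumes a: "0 < \<alpha>" "\<alpha> \<le> 1" and s: "0 < s" "s < pi / 2"
  shows "(\<integral>\<^sup>+t. ennreal (ln_plus (\<alpha> * cos s / cos t)) \<partial>unif (pi / 2)) =
    ennreal (2 / pi) * (\<integral>\<^sup>+c\<in>{0..\<alpha>}. ennreal (ln (\<alpha> / c)) * ennreal (cos s / sqrt (1 - c\<^sup>2 * (cos s)\<^sup>2)) \<partial>lborel)"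
proof -
  have cs: "0 < cos s" "cos s < 1"
    using s cos_gt_zero_pi[of s] cos_monotone_0_pi[of 0 s] by auto
  define \<beta> where "\<beta> = \<alpha> * cos s"
  have \<beta>: "0 < \<beta>" "\<beta> < 1"
    using a cs mult_le_less_imp_less[of \<alpha> 1 "cos s" 1] by (auto simp: \<beta>_def)
  have "(\<integral>\<^sup>+t. ennreal (ln_plus (\<beta> / cos t)) \<partial>unif (pi / 2)) = (\<integral>\<^sup>+t. ennreal (ln_plus (\<beta> / sin t)) \<partial>unif (pi / 2))"
    by (subst nn_integral_unif_reflect[symmetric]) (auto simp: cos_sin_eq[symmetric] sin_cos_eq)
  also have "\<dots> = ennreal (2 / pi) * (\<integral>\<^sup>+t\<in>{0..pi / 2}. ennreal (ln_plus (\<beta> / sin t)) \<partial>lborel)"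
    by (subst nn_integral_unif) auto
  also have "(\<integral>\<^sup>+t\<in>{0..pi / 2}. ennreal (ln_plus (\<beta> / sin t)) \<partial>lborel)
      = (\<integral>\<^sup>+t. ennreal (ln_plus (\<beta> / sin t)) * indicator {arcsin (0 * cos s)..arcsin (\<alpha> * cos s)} t \<partial>lborel)"
  proof (rule nn_integral_cong)
    fix t :: real
    show "ennreal (ln_plus (\<beta> / sin t)) * indicator {0..pi / 2} t =
        ennreal (ln_plus (\<beta> / sin t)) * indicator {arcsin (0 * cos s)..arcsin (\<alpha> * cos s)} t"
    proof (cases "t \<in> {0..pi / 2} \<and> arcsin \<beta> < t")
      case True
      then have t: "0 \<le> t" "t \<le> pi / 2" "arcsin \<beta> < t" by auto
      have "sin (arcsin \<beta>) < sin t"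
        using t \<beta> arcsin_lbound[of \<beta>] by (intro sin_monotone_2pi) auto
      then have "\<beta> < sin t" using \<beta> by simp
      then have "ln (\<beta> / sin t) \<le> 0" using \<beta> by (subst ln_le_zero_iff) auto
      then show ?thesis using True by (simp add: ln_plus_def \<beta>_def)
    next
      case False
      have "arcsin \<beta> \<le> pi / 2" using \<beta> by (intro arcsin_ubound) auto
      then have "t \<in> {0..pi / 2} \<longleftrightarrow> t \<in> {0..arcsin \<beta>}" using False by auto
      then show ?thesis by (simp add: indicator_def \<beta>_def)
    qed
  qed
  also have "\<dots> = (\<integral>\<^sup>+c. ennreal (ln_plus (\<beta> / sin (arcsin (c * cos s)))) * ennreal (cos s / sqrt (1 - c\<^sup>2 * (cos s)\<^sup>2)) * indicator {0..\<alpha>} c \<partial>lborel)"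
  proof (rule nn_integral_substitution_aux[where g = "\<lambda>c. arcsin (c * cos s)" and f = "\<lambda>t. ennreal (ln_plus (\<beta> / sin t))"])
    have le: "c * cos s \<le> \<beta>" "0 \<le> c * cos s" if "c \<in> {0..\<alpha>}" for c
      using that cs by (auto simp: \<beta>_def)
    have pos: "0 < 1 - c\<^sup>2 * (cos s)\<^sup>2" if "c \<in> {0..\<alpha>}" for c
    proof -
      have "(c * cos s)\<^sup>2 < 1" using le[OF that] \<beta> by (simp add: power_less_one_iff abs_square_less_1)
      then show ?thesis by (simp add: power_mult_distrib)
    qed
    fix c assume c: "c \<in> {0..\<alpha>}"
    show "((\<lambda>c. arcsin (c * cos s)) has_real_derivative cos s / sqrt (1 - c\<^sup>2 * (cos s)\<^sup>2)) (at c)"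
      using le[OF c] \<beta>
      by (auto intro!: derivative_eq_intros simp: power_mult_distrib divide_inverse)
    show "0 \<le> cos s / sqrt (1 - c\<^sup>2 * (cos s)\<^sup>2)" using pos[OF c] cs by auto
  next
    have pos: "0 < 1 - c\<^sup>2 * (cos s)\<^sup>2" if "c \<in> {0..\<alpha>}" for c
    proof -
      have "c * cos s \<le> \<beta>" "0 \<le> c * cos s" using that cs by (auto simp: \<beta>_def)
      then have "(c * cos s)\<^sup>2 < 1" using \<beta> by (simp add: power_less_one_iff abs_square_less_1)
      then show ?thesis by (simp add: power_mult_distrib)
    qed
    show "continuous_on {0..\<alpha>} (\<lambda>c. cos s / sqrt (1 - c\<^sup>2 * (cos s)\<^sup>2))"
      by (intro continuous_intros) (use pos in force)
  qed (use a in auto)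
  also have "\<dots> = (\<integral>\<^sup>+c\<in>{0..\<alpha>}. ennreal (ln (\<alpha> / c)) * ennreal (cos s / sqrt (1 - c\<^sup>2 * (cos s)\<^sup>2)) \<partial>lborel)"
    using AE_lborel_singleton[of 0]
  proof (intro nn_integral_cong_AE, eventually_elim)
    fix c :: real assume c0: "c \<noteq> 0"
    show "ennreal (ln_plus (\<beta> / sin (arcsin (c * cos s)))) * ennreal (cos s / sqrt (1 - c\<^sup>2 * (cos s)\<^sup>2)) * indicator {0..\<alpha>} c
        = ennreal (ln (\<alpha> / c)) * ennreal (cos s / sqrt (1 - c\<^sup>2 * (cos s)\<^sup>2)) * indicator {0..\<alpha>} c"
    proof (cases "c \<in> {0..\<alpha>}")
      case True
      then have c: "0 < c" "c \<le> \<alpha>" using c0 by auto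
      have "c * cos s \<le> \<beta>" "0 \<le> c * cos s" using c cs by (auto simp: \<beta>_def)
      then have "sin (arcsin (c * cos s)) = c * cos s" using \<beta> by (intro sin_arcsin) auto
      then have "\<beta> / sin (arcsin (c * cos s)) = \<alpha> / c" using cs by (simp add: \<beta>_def)
      moreover have "0 \<le> ln (\<alpha> / c)" using c a by (intro ln_ge_zero) auto
      ultimately show ?thesis by (simp add: ln_plus_def)
    qed simp
  qed
  finally show ?thesis by (simp add: \<beta>_def)
qed

lemma continuous_on_ln_mult:
  fixes f :: "real \<Rightarrow> real"
  assumes f: "continuous_on {0..1} f" and C: "\<And>x. 0 \<le> x \<Longrightarrow> x \<le> 1 \<Longrightarrow> \<bar>f x\<bar> \<le> C * x"
  shows "continuous_on {0..1} (\<lambda>x. ln x * f x)"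
proof (subst continuous_on_eq_continuous_within, intro ballI)
  fix x :: real assume x: "x \<in> {0..1}"
  show "continuous (at x within {0..1}) (\<lambda>x. ln x * f x)"
  proof (cases "x = 0")
    case True
    have "((\<lambda>x. ln x * f x) \<longlongrightarrow> 0) (at 0 within {0..1})"
    proof (rule Lim_null_comparison)
      show "((\<lambda>x. 2 * C * sqrt x) \<longlongrightarrow> 0) (at 0 within {0..1})"
        by (auto intro!: tendsto_eq_intros)
      have "norm (ln x * f x) \<le> 2 * C * sqrt x" if x: "0 < x" "x \<le> 1" for x
      proof -
        have "\<bar>ln x\<bar> = - ln x" using x by simp
        also have "\<dots> \<le> (1 - x) * x powr (- (1/2)) / (1/2)" using x by (intro minus_ln_le) auto
        also have "\<dots> \<le> 1 * x powr (- (1/2)) / (1/2)"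
          using x by (intro divide_right_mono mult_right_mono) auto
        finally have "\<bar>ln x\<bar> \<le> 2 * x powr (- (1/2))" by simp
        then have "norm (ln x * f x) \<le> 2 * x powr (- (1/2)) * (C * x)"
          unfolding real_norm_def abs_mult using x C by (intro mult_mono) auto
        also have "\<dots> = 2 * C * (x * x powr (- (1/2)))" by simp
        also have "x * x powr (- (1/2)) = sqrt x" using x by (simp add: powr_mult_base powr_half_sqrt)
        finally show ?thesis .
      qed
      then show "\<forall>\<^sub>F x in at 0 within {0..1}. norm (ln x * f x) \<le> 2 * C * sqrt x"
        unfolding eventually_at_filter by (intro always_eventually) auto
    qed
    then show ?thesis using True by (simp add: continuous_within)
  next
    case False
    have "continuous (at x within {0..1}) f" using f x by (simp add: continuous_on_eq_continuous_within)
    then show ?thesis using False by (intro continuous_intros) auto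
  qed
qed

text \<open>Integrating $\frac12 \ln (\alpha/c)\, d\chi_2(c)$ by parts with $d\chi_3 = \chi_2\, dc/c$ gives the primitive
$\frac12 (\ln (\alpha/c) \chi_2(c) + \chi_3(c))$.\<close>

lemma has_integral_ln_legendre_chi:
  assumes a: "0 < \<alpha>" "\<alpha> \<le> 1"
  shows "((\<lambda>c. ln (\<alpha> / c) * (legendre_chi 1 c / (2 * c))) has_integral legendre_chi 3 \<alpha> / 2) {0..\<alpha>}"
proof -
  define F where "F = (\<lambda>c. (ln \<alpha> * legendre_chi 2 c - ln c * legendre_chi 2 c + legendre_chi 3 c) / 2)"
  have "((\<lambda>c. ln (\<alpha> / c) * (legendre_chi 1 c / (2 * c))) has_integral F \<alpha> - F 0) {0..\<alpha>}"
  proof (rule fundamental_theorem_of_calculus_interior)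
    fix c assume "c \<in> {0<..<\<alpha>}"
    then have c: "0 < c" "c < 1" "c < \<alpha>" using a by auto
    have 2: "(legendre_chi 2 has_real_derivative legendre_chi 1 c / c) (at c)"
      using legendre_chi_deriv[of c 1] c by (simp add: numeral_2_eq_2)
    have 3: "(legendre_chi 3 has_real_derivative legendre_chi 2 c / c) (at c)"
      using legendre_chi_deriv[of c 2] c by (simp add: numeral_3_eq_3 numeral_2_eq_2)
    have "(F has_real_derivative (ln \<alpha> * (legendre_chi 1 c / c)
        - (1 / c * legendre_chi 2 c + legendre_chi 1 c / c * ln c) + legendre_chi 2 c / c) / 2) (at c)"
      unfolding F_def using c
      by (intro DERIV_cdivide DERIV_add DERIV_diff DERIV_cmult DERIV_mult DERIV_ln_divide 2 3)
    also have "(ln \<alpha> * (legendre_chi 1 c / c)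
        - (1 / c * legendre_chi 2 c + legendre_chi 1 c / c * ln c) + legendre_chi 2 c / c) / 2
        = ln (\<alpha> / c) * (legendre_chi 1 c / (2 * c))"
      using c by (simp add: ln_div field_simps)
    finally show "(F has_vector_derivative ln (\<alpha> / c) * (legendre_chi 1 c / (2 * c))) (at c)"
      by (simp add: has_real_derivative_iff_has_vector_derivative)
  next
    obtain C where C: "\<And>t. 0 \<le> t \<Longrightarrow> t \<le> 1 \<Longrightarrow> \<bar>legendre_chi 2 t\<bar> \<le> C * t"
      using legendre_chi_bound[of 2] by auto
    have chi: "continuous_on {0..1} (legendre_chi 2)" "continuous_on {0..1} (legendre_chi 3)"
      by (intro continuous_on_legendre_chi; simp)+
    have "continuous_on {0..1} F"
      unfolding F_def
      by (intro continuous_on_divide continuous_on_add continuous_on_diff continuous_on_mult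
            continuous_on_const chi continuous_on_ln_mult[OF chi(1) C]) auto
    then show "continuous_on {0..\<alpha>} F" by (rule continuous_on_subset) (use a in auto)
  qed (use a in auto)
  then show ?thesis using a by (simp add: F_def)
qed

lemma ln_legendre_chi_nonneg:
  assumes "0 \<le> c" "c \<le> \<alpha>" "\<alpha> \<le> 1"
  shows "0 \<le> ln (\<alpha> / c) * (legendre_chi 1 c / (2 * c))"
proof (cases "c = 0 \<or> c = 1")
  case False
  then have c: "0 < c" "c < 1" using assms by auto
  then have "0 \<le> ln (\<alpha> / c)" "0 \<le> ln ((1 + c) / (1 - c))"
    using assms by (auto intro!: ln_ge_zero)
  then show ?thesis using c legendre_chi_1[of c] by simp
qed (use assms in auto)

lemma nn_integral_ln_plus_cos_ratio_le_1:
  assumes a: "0 < \<alpha>" "\<alpha> \<le> 1"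
  shows "(\<integral>\<^sup>+s. \<integral>\<^sup>+t. ennreal (ln_plus (\<alpha> * cos s / cos t)) \<partial>unif (pi / 2) \<partial>unif (pi / 2)) =
    ennreal (2 / pi\<^sup>2 * legendre_chi 3 \<alpha>)"
proof -
  let ?k = "\<lambda>c s. ennreal (ln (\<alpha> / c)) * ennreal (cos s / sqrt (1 - c\<^sup>2 * (cos s)\<^sup>2)) * indicator {0..\<alpha>} c"
  have "(\<integral>\<^sup>+s. \<integral>\<^sup>+t. ennreal (ln_plus (\<alpha> * cos s / cos t)) \<partial>unif (pi / 2) \<partial>unif (pi / 2)) =
      (\<integral>\<^sup>+s. ennreal (2 / pi) * (\<integral>\<^sup>+c. ?k c s \<partial>lborel) \<partial>unif (pi / 2))"
    by (intro nn_integral_cong_AE AE_unifI[where S = "{0, pi / 2}"] nn_integral_ln_plus_inner a) auto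
  also have "\<dots> = ennreal (2 / pi) * (\<integral>\<^sup>+s. (\<integral>\<^sup>+c. ?k c s \<partial>lborel) \<partial>unif (pi / 2))"
    by (rule nn_integral_cmult) (auto intro!: sigma_finite_measure.borel_measurable_nn_integral sigma_finite_lborel)
  also have "(\<integral>\<^sup>+s. (\<integral>\<^sup>+c. ?k c s \<partial>lborel) \<partial>unif (pi / 2)) = (\<integral>\<^sup>+c. (\<integral>\<^sup>+s. ?k c s \<partial>unif (pi / 2)) \<partial>lborel)"
    by (rule nn_integral_swap_borel) (auto intro!: sigma_finite_lborel sigma_finite_unif)
  also have "\<dots> = (\<integral>\<^sup>+c. ennreal (2 / pi) * (ennreal (ln (\<alpha> / c) * (legendre_chi 1 c / (2 * c))) * indicator {0..\<alpha>} c) \<partial>lborel)"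
    using AE_lborel_singleton[of 0] AE_lborel_singleton[of 1]
  proof (intro nn_integral_cong_AE, eventually_elim)
    fix c :: real assume c01: "c \<noteq> 0" "c \<noteq> 1"
    show "(\<integral>\<^sup>+s. ?k c s \<partial>unif (pi / 2)) =
      ennreal (2 / pi) * (ennreal (ln (\<alpha> / c) * (legendre_chi 1 c / (2 * c))) * indicator {0..\<alpha>} c)"
    proof (cases "c \<in> {0..\<alpha>}")
      case True
      then have c: "0 < c" "c < 1" "c \<le> \<alpha>" using c01 a by auto
      have l: "0 \<le> ln (\<alpha> / c)" using c a by (intro ln_ge_zero) auto
      have "(\<integral>\<^sup>+s. ?k c s \<partial>unif (pi / 2)) = (\<integral>\<^sup>+s. ennreal (ln (\<alpha> / c)) * ennreal (cos s / sqrt (1 - c\<^sup>2 * (cos s)\<^sup>2)) \<partial>unif (pi / 2))"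
        using True by simp
      also have "\<dots> = ennreal (ln (\<alpha> / c)) * (\<integral>\<^sup>+s. ennreal (cos s / sqrt (1 - c\<^sup>2 * (cos s)\<^sup>2)) \<partial>unif (pi / 2))"
        by (rule nn_integral_cmult) auto
      also have "\<dots> = ennreal (ln (\<alpha> / c)) * (ennreal (2 / pi) * ennreal (legendre_chi 1 c / (2 * c)))"
        by (simp only: nn_integral_cos_sqrt[OF c(1,2)])
      also have "\<dots> = ennreal (2 / pi) * (ennreal (ln (\<alpha> / c)) * ennreal (legendre_chi 1 c / (2 * c)))"
        by (simp only: mult_ac)
      also have "ennreal (ln (\<alpha> / c)) * ennreal (legendre_chi 1 c / (2 * c)) = ennreal (ln (\<alpha> / c) * (legendre_chi 1 c / (2 * c)))"
        using l by (rule ennreal_mult'[symmetric])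
      finally show ?thesis using True c by simp
    qed simp
  qed
  also have "\<dots> = ennreal (2 / pi) * (\<integral>\<^sup>+c\<in>{0..\<alpha>}. ennreal (ln (\<alpha> / c) * (legendre_chi 1 c / (2 * c))) \<partial>lborel)"
    by (rule nn_integral_cmult) auto
  also have "(\<integral>\<^sup>+c\<in>{0..\<alpha>}. ennreal (ln (\<alpha> / c) * (legendre_chi 1 c / (2 * c))) \<partial>lborel) = ennreal (legendre_chi 3 \<alpha> / 2)"
    by (rule nn_integral_has_integral_Icc[OF has_integral_ln_legendre_chi[OF a] ln_legendre_chi_nonneg])
       (use a in auto)
  also have "ennreal (2 / pi) * (ennreal (2 / pi) * ennreal (legendre_chi 3 \<alpha> / 2)) = ennreal (2 / pi * (2 / pi * (legendre_chi 3 \<alpha> / 2)))"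
    by (simp only: ennreal_mult'[symmetric] divide_nonneg_pos zero_le_numeral pi_gt_zero)
  also have "2 / pi * (2 / pi * (legendre_chi 3 \<alpha> / 2)) = 2 / pi\<^sup>2 * legendre_chi 3 \<alpha>"
    by (simp add: power2_eq_square)
  finally show ?thesis .
qed

lemma legendre_chi_3_nonneg:
  assumes "0 \<le> t" "t \<le> 1"
  shows "0 \<le> legendre_chi 3 t"
proof (cases "t = 0")
  case False
  then have t: "0 < t" "t \<le> 1" using assms by auto
  have "0 \<le> legendre_chi 3 t / 2"
    by (rule has_integral_nonneg[OF has_integral_ln_legendre_chi[OF t]])
       (rule ln_legendre_chi_nonneg, use t in auto)
  then show ?thesis by simp
qed simp

definition cos_ratio_mean :: "real \<Rightarrow> ennreal" where
  "cos_ratio_mean \<alpha> =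
     (\<integral>\<^sup>+s. \<integral>\<^sup>+t. ennreal (ln_plus (\<alpha> * cos s / cos t)) \<partial>unif (pi / 2) \<partial>unif (pi / 2))"

lemma borel_measurable_cos_ratio_mean [measurable]: "cos_ratio_mean \<in> borel_measurable borel"
proof -
  interpret sigma_finite_measure "unif (pi / 2)" by (rule sigma_finite_unif) simp
  show ?thesis unfolding cos_ratio_mean_def[abs_def] by measurable
qed

lemma cos_ratio_mean_le_1:
  assumes "0 \<le> \<alpha>" "\<alpha> \<le> 1"
  shows "cos_ratio_mean \<alpha> = ennreal (2 / pi\<^sup>2 * legendre_chi 3 \<alpha>)"
proof (cases "\<alpha> = 0")
  case True
  then show ?thesis by (simp add: cos_ratio_mean_def ln_plus_def)
next
  case False
  then show ?thesis unfolding cos_ratio_mean_def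
    using assms by (intro nn_integral_ln_plus_cos_ratio_le_1) auto
qed

lemma cos_ratio_mean_swap:
  "(\<integral>\<^sup>+s. \<integral>\<^sup>+t. ennreal (ln_plus (\<alpha> * cos t / cos s)) \<partial>unif (pi / 2) \<partial>unif (pi / 2)) = cos_ratio_mean \<alpha>"
  unfolding cos_ratio_mean_def by (rule nn_integral_swap_borel) (auto intro!: sigma_finite_unif)

lemma ln_plus_split:
  assumes "0 < r" "1 \<le> \<alpha>"
  shows "ln_plus (\<alpha> * r) + ln_plus (1 / r) = ln \<alpha> + ln_plus r + ln_plus (1 / (\<alpha> * r))"
  using assms by (auto simp: ln_plus_def ln_mult ln_div max_def)

text \<open>The quotient $R$ and its inverse have the same law, so $\ln R$ has mean 0 and the claim is
$\ln^+ y = \ln y + \ln^+ (1/y)$ at $y = \alpha R$. To stay within nonnegative functions, the finite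
mean of $\ln^+ R$ is added on both sides.\<close>

lemma cos_ratio_mean_ge_1:
  assumes a: "1 \<le> \<alpha>"
  shows "cos_ratio_mean \<alpha> = ennreal (ln \<alpha>) + cos_ratio_mean (1 / \<alpha>)"
proof -
  have fin: "cos_ratio_mean 1 < \<infinity>" by (simp add: cos_ratio_mean_le_1)
  have pos: "0 < cos t" if "0 \<le> t" "t \<le> pi / 2" "t \<notin> {pi / 2}" for t :: real
    using that by (intro cos_gt_zero_pi) auto
  note [measurable] = sigma_finite_measure.borel_measurable_nn_integral[OF sigma_finite_unif]
  have "cos_ratio_mean \<alpha> + cos_ratio_mean 1 =
     (\<integral>\<^sup>+s. \<integral>\<^sup>+t. ennreal (ln_plus (\<alpha> * cos s / cos t)) + ennreal (ln_plus (1 * cos t / cos s)) \<partial>unif (pi / 2) \<partial>unif (pi / 2))"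
    unfolding cos_ratio_mean_swap[of 1, symmetric] unfolding cos_ratio_mean_def
    by (simp add: nn_integral_add)
  also have "\<dots> = (\<integral>\<^sup>+s. \<integral>\<^sup>+t. ennreal (ln \<alpha>) + ennreal (ln_plus (1 * cos s / cos t)) + ennreal (ln_plus (1 / \<alpha> * cos t / cos s)) \<partial>unif (pi / 2) \<partial>unif (pi / 2))"
  proof (intro nn_integral_cong_AE AE_unifI[where S = "{pi / 2}"])
    fix s t :: real
    assume "0 \<le> s" "s \<le> pi / 2" "s \<notin> {pi / 2}" and "0 \<le> t" "t \<le> pi / 2" "t \<notin> {pi / 2}"
    then have "0 < cos s" "0 < cos t" using pos by auto
    then have "ln_plus (\<alpha> * cos s / cos t) + ln_plus (1 * cos t / cos s)
      = ln \<alpha> + ln_plus (1 * cos s / cos t) + ln_plus (1 / \<alpha> * cos t / cos s)"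
      using ln_plus_split[of "cos s / cos t" \<alpha>] a by simp
    moreover have "0 \<le> ln \<alpha>" using a by simp
    ultimately show "ennreal (ln_plus (\<alpha> * cos s / cos t)) + ennreal (ln_plus (1 * cos t / cos s))
      = ennreal (ln \<alpha>) + ennreal (ln_plus (1 * cos s / cos t)) + ennreal (ln_plus (1 / \<alpha> * cos t / cos s))"
      by (simp flip: ennreal_plus)
  qed auto
  also have "\<dots> = ennreal (ln \<alpha>) + cos_ratio_mean 1 + cos_ratio_mean (1 / \<alpha>)"
    unfolding cos_ratio_mean_swap[of "1 / \<alpha>", symmetric] unfolding cos_ratio_mean_def
    by (simp add: nn_integral_add)
  finally have "cos_ratio_mean 1 + cos_ratio_mean \<alpha> = cos_ratio_mean 1 + (ennreal (ln \<alpha>) + cos_ratio_mean (1 / \<alpha>))"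
    by (simp only: ac_simps)
  then show ?thesis using fin by (auto simp: ennreal_add_left_cancel)
qed

section \<open>Averaging over the tangents\<close>

lemma nn_integral_tan_tan_reflect:
  fixes f :: "real \<Rightarrow> ennreal"
  assumes [measurable]: "f \<in> borel_measurable borel"
  shows "(\<integral>\<^sup>+v. \<integral>\<^sup>+w. f (tan v * tan w) \<partial>unif (pi / 2) \<partial>unif (pi / 2)) =
         (\<integral>\<^sup>+v. \<integral>\<^sup>+w. f (1 / (tan v * tan w)) \<partial>unif (pi / 2) \<partial>unif (pi / 2))"
proof -
  have t: "tan (pi / 2 - x) = 1 / tan x" for x :: real by (simp add: tan_def sin_diff cos_diff)
  have i: "(\<integral>\<^sup>+w. f (c * tan w) \<partial>unif (pi / 2)) = (\<integral>\<^sup>+w. f (c / tan w) \<partial>unif (pi / 2))" for c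
    using nn_integral_unif_reflect[of "\<lambda>w. f (c * tan w)" "pi / 2"] by (simp add: t)
  have "(\<integral>\<^sup>+v. \<integral>\<^sup>+w. f (tan v * tan w) \<partial>unif (pi / 2) \<partial>unif (pi / 2)) =
     (\<integral>\<^sup>+v. (\<lambda>v. \<integral>\<^sup>+w. f (tan v * tan w) \<partial>unif (pi / 2)) (pi / 2 - v) \<partial>unif (pi / 2))"
    by (rule nn_integral_unif_reflect[symmetric])
       (auto intro!: sigma_finite_measure.borel_measurable_nn_integral sigma_finite_unif)
  also have "\<dots> = (\<integral>\<^sup>+v. \<integral>\<^sup>+w. f (1 / tan v * tan w) \<partial>unif (pi / 2) \<partial>unif (pi / 2))"
    by (simp only: t)
  also have "\<dots> = (\<integral>\<^sup>+v. \<integral>\<^sup>+w. f (1 / tan v / tan w) \<partial>unif (pi / 2) \<partial>unif (pi / 2))"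
    by (simp only: i)
  finally show ?thesis by simp
qed

text \<open>The substitution $x = L t$ takes the density of $T_1 T_2$ to the kernel of $I_b$ for $b = 1/L$.\<close>

lemma nn_integral_chi_tan_kernel:
  assumes L: "L > 0" and b: "b = 1 / L"
    and I: "((\<lambda>t. legendre_chi 3 t * (ln t - ln b) * (2 * b / (t ^ 2 - b ^ 2))) has_integral I) {0..1}"
  shows "(\<integral>\<^sup>+x\<in>{0..L}. ennreal (legendre_chi 3 (x / L)) * ennreal (tan_kernel x) \<partial>lborel) = ennreal (I / 2)"
    and "I \<ge> 0"
proof -
  have e: "legendre_chi 3 t * (L * tan_kernel (L * t)) =
      (1 / 2) * (legendre_chi 3 t * (ln t - ln b) * (2 * b / (t ^ 2 - b ^ 2)))" if "0 \<le> t" for t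
  proof (cases "t = 0")
    case False
    then have t: "t > 0" using that by auto
    have "t ^ 2 - b ^ 2 = ((L * t) ^ 2 - 1) / L ^ 2" using L by (simp add: b power_mult_distrib power_divide field_simps)
    then have "b / (t ^ 2 - b ^ 2) = L / ((L * t) ^ 2 - 1)" using L by (simp add: b power2_eq_square)
    moreover have "ln t - ln b = ln (L * t)" using L t by (simp add: b ln_mult ln_div)
    moreover have "L * tan_kernel (L * t) = ln (L * t) * (L / ((L * t) ^ 2 - 1))"
      by (simp add: tan_kernel_def)
    ultimately have "L * tan_kernel (L * t) = (ln t - ln b) * (b / (t ^ 2 - b ^ 2))" by (simp only:)
    then show ?thesis by simp
  qed simp
  have nn: "0 \<le> legendre_chi 3 t * (L * tan_kernel (L * t))" if "0 \<le> t" "t \<le> 1" for t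
    using that L by (intro mult_nonneg_nonneg legendre_chi_3_nonneg tan_kernel_nonneg) auto
  have hi: "((\<lambda>t. legendre_chi 3 t * (L * tan_kernel (L * t))) has_integral (1 / 2) * I) {0..1}"
    by (rule has_integral_eq[OF _ has_integral_mult_right[OF I, of "1 / 2"]]) (use e in auto)
  show "I \<ge> 0" using has_integral_nonneg[OF hi] nn by simp
  have "(\<integral>\<^sup>+x\<in>{0..L}. ennreal (legendre_chi 3 (x / L)) * ennreal (tan_kernel x) \<partial>lborel)
     = (\<integral>\<^sup>+t\<in>{0..1}. ennreal L * (ennreal (legendre_chi 3 (L * t / L)) * ennreal (tan_kernel (L * t))) \<partial>lborel)"
    by (rule nn_integral_Icc_scale) (use L in auto)
  also have "\<dots> = (\<integral>\<^sup>+t\<in>{0..1}. ennreal (legendre_chi 3 t * (L * tan_kernel (L * t))) \<partial>lborel)"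
  proof (rule nn_integral_cong)
    fix t :: real
    have eq: "ennreal L * (ennreal (legendre_chi 3 (L * t / L)) * ennreal (tan_kernel (L * t)))
        = ennreal (legendre_chi 3 t * (L * tan_kernel (L * t)))" if "t \<in> {0..1}"
      using that L tan_kernel_nonneg[of "L * t"] legendre_chi_3_nonneg[of t] by (simp add: ennreal_mult mult_ac)
    show "ennreal L * (ennreal (legendre_chi 3 (L * t / L)) * ennreal (tan_kernel (L * t))) * indicator {0..1} t =
       ennreal (legendre_chi 3 t * (L * tan_kernel (L * t))) * indicator {0..1} t"
    proof (cases "t \<in> {0..1}")
      case True show ?thesis unfolding eq[OF True] ..
    qed simp
  qed
  also have "\<dots> = ennreal ((1 / 2) * I)"
    by (rule nn_integral_has_integral_Icc[OF hi nn]) auto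
  finally show "(\<integral>\<^sup>+x\<in>{0..L}. ennreal (legendre_chi 3 (x / L)) * ennreal (tan_kernel x) \<partial>lborel) = ennreal (I / 2)"
    by simp
qed

lemma nn_integral_ln_tan_kernel:
  assumes a: "a > 0"
    and H: "((\<lambda>t. - ln t * (ln t + ln a) * (a / ((a * t) ^ 2 - 1))) has_integral H) {0..1}"
  shows "(\<integral>\<^sup>+x\<in>{0..a}. ennreal (ln (a / x)) * ennreal (tan_kernel x) \<partial>lborel) = ennreal H"
    and "H \<ge> 0"
proof -
  have e: "- ln t * (a * tan_kernel (a * t)) = - ln t * (ln t + ln a) * (a / ((a * t) ^ 2 - 1))" if "0 \<le> t" for t
    using that a by (cases "t = 0") (auto simp: tan_kernel_def ln_mult add.commute)
  have nn: "0 \<le> - ln t * (a * tan_kernel (a * t))" if "0 \<le> t" "t \<le> 1" for t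
  proof (cases "t = 0")
    case False
    then have "0 \<le> - ln t" using that by simp
    then show ?thesis using that a by (intro mult_nonneg_nonneg tan_kernel_nonneg) auto
  qed simp
  have hi: "((\<lambda>t. - ln t * (a * tan_kernel (a * t))) has_integral H) {0..1}"
    by (rule has_integral_eq[OF _ H]) (use e in auto)
  show "H \<ge> 0" using has_integral_nonneg[OF hi] nn by simp
  have "(\<integral>\<^sup>+x\<in>{0..a}. ennreal (ln (a / x)) * ennreal (tan_kernel x) \<partial>lborel)
     = (\<integral>\<^sup>+t\<in>{0..1}. ennreal a * (ennreal (ln (a / (a * t))) * ennreal (tan_kernel (a * t))) \<partial>lborel)"
    by (rule nn_integral_Icc_scale) (use a in auto)
  also have "\<dots> = (\<integral>\<^sup>+t\<in>{0..1}. ennreal (- ln t * (a * tan_kernel (a * t))) \<partial>lborel)"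
  proof (rule nn_integral_cong)
    fix t :: real
    have eq: "ennreal a * (ennreal (ln (a / (a * t))) * ennreal (tan_kernel (a * t)))
        = ennreal (- ln t * (a * tan_kernel (a * t)))" if t: "t \<in> {0..1}"
    proof -
      have l: "ln (a / (a * t)) = - ln t" using t a by (cases "t = 0") (auto simp: ln_div)
      have "0 \<le> - ln t" using t by (cases "t = 0") auto
      then have "ennreal (- ln t * (a * tan_kernel (a * t))) = ennreal (- ln t) * (ennreal a * ennreal (tan_kernel (a * t)))"
        using a by (simp only: ennreal_mult'[of "- ln t"] ennreal_mult'[of a] less_imp_le)
      then show ?thesis unfolding l by (simp add: mult_ac)
    qed
    show "ennreal a * (ennreal (ln (a / (a * t))) * ennreal (tan_kernel (a * t))) * indicator {0..1} t =
       ennreal (- ln t * (a * tan_kernel (a * t))) * indicator {0..1} t"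
    proof (cases "t \<in> {0..1}")
      case True show ?thesis unfolding eq[OF True] ..
    qed simp
  qed
  also have "\<dots> = ennreal H"
    by (rule nn_integral_has_integral_Icc[OF hi nn]) auto
  finally show "(\<integral>\<^sup>+x\<in>{0..a}. ennreal (ln (a / x)) * ennreal (tan_kernel x) \<partial>lborel) = ennreal H" .
qed

text \<open>Split at $a T_1 T_2 = 1$. Below, the mean over $R$ is a value of $\chi$. Above, replacing the
tangents by their inverses makes the argument of $\chi$ small again, and the additional summand
$\ln (a/x)$ contributes $H$.\<close>

lemma nn_integral_cos_ratio_mean_tan_tan:
  assumes a: "a > 0"
    and I: "((\<lambda>t. legendre_chi 3 t * (ln t - ln a) * (2 * a / (t ^ 2 - a ^ 2))) has_integral I) {0..1}"
    and I': "((\<lambda>t. legendre_chi 3 t * (ln t - ln (1 / a)) * (2 * (1 / a) / (t ^ 2 - (1 / a) ^ 2))) has_integral I') {0..1}"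
    and H: "((\<lambda>t. - ln t * (ln t + ln a) * (a / ((a * t) ^ 2 - 1))) has_integral H) {0..1}"
  shows "(\<integral>\<^sup>+v. \<integral>\<^sup>+w. cos_ratio_mean (a * (tan v * tan w)) \<partial>unif (pi / 2) \<partial>unif (pi / 2)) =
           ennreal (4 / pi ^ 4 * (I + I') + 4 / pi\<^sup>2 * H)"
    and "0 \<le> 4 / pi ^ 4 * (I + I') + 4 / pi\<^sup>2 * H"
proof -
  let ?U = "unif (pi / 2)"
  note [measurable] = sigma_finite_measure.borel_measurable_nn_integral[OF sigma_finite_unif]
  note A = nn_integral_chi_tan_kernel[of "1 / a" a I, simplified, OF a I[simplified]]
  note B = nn_integral_chi_tan_kernel[of a "1 / a" I', OF a refl I']
  note C = nn_integral_ln_tan_kernel[OF a H]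
  show "0 \<le> 4 / pi ^ 4 * (I + I') + 4 / pi\<^sup>2 * H" using A(2) B(2) C(2) by simp
  \<comment> \<open>The parts below and above the split.\<close>
  define f1 where "f1 = (\<lambda>x. cos_ratio_mean (a * x) * indicator {0..1 / a} x)"
  define f2 where "f2 = (\<lambda>x. cos_ratio_mean (a * x) * indicator {1 / a<..} x)"
  have [measurable]: "f1 \<in> borel_measurable borel" "f2 \<in> borel_measurable borel"
    unfolding f1_def f2_def by measurable
  have tpos: "0 \<le> tan v" if "0 \<le> v" "v \<le> pi / 2" for v :: real
    using that by (auto simp: tan_def intro!: divide_nonneg_nonneg sin_ge_zero cos_ge_zero)
  have "(\<integral>\<^sup>+v. \<integral>\<^sup>+w. cos_ratio_mean (a * (tan v * tan w)) \<partial>?U \<partial>?U) =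
     (\<integral>\<^sup>+v. \<integral>\<^sup>+w. f1 (tan v * tan w) + f2 (tan v * tan w) \<partial>?U \<partial>?U)"
  proof (intro nn_integral_cong_AE AE_unifI[where S = "{}"])
    fix v w :: real assume "0 \<le> v" "v \<le> pi / 2" "0 \<le> w" "w \<le> pi / 2"
    then have "0 \<le> tan v * tan w" using tpos by simp
    then show "cos_ratio_mean (a * (tan v * tan w)) = f1 (tan v * tan w) + f2 (tan v * tan w)"
      by (auto simp: f1_def f2_def indicator_def)
  qed auto
  also have "\<dots> = (\<integral>\<^sup>+v. \<integral>\<^sup>+w. f1 (tan v * tan w) \<partial>?U \<partial>?U) + (\<integral>\<^sup>+v. \<integral>\<^sup>+w. f2 (tan v * tan w) \<partial>?U \<partial>?U)"
    by (simp add: nn_integral_add)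
  also have "(\<integral>\<^sup>+v. \<integral>\<^sup>+w. f1 (tan v * tan w) \<partial>?U \<partial>?U) = ennreal (4 / pi\<^sup>2) * (ennreal (2 / pi\<^sup>2) * ennreal (I / 2))"
  proof -
    have "(\<integral>\<^sup>+x\<in>{0..}. f1 x * ennreal (tan_kernel x) \<partial>lborel) =
        (\<integral>\<^sup>+x. ennreal (2 / pi\<^sup>2) * (ennreal (legendre_chi 3 (x / (1 / a))) * ennreal (tan_kernel x) * indicator {0..1 / a} x) \<partial>lborel)"
    proof (rule nn_integral_cong)
      fix x :: real
      show "f1 x * ennreal (tan_kernel x) * indicator {0..} x =
        ennreal (2 / pi\<^sup>2) * (ennreal (legendre_chi 3 (x / (1 / a))) * ennreal (tan_kernel x) * indicator {0..1 / a} x)"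
      proof (cases "x \<in> {0..1 / a}")
        case True
        then have "0 \<le> a * x" "a * x \<le> 1" using a by (auto simp: field_simps)
        then have "cos_ratio_mean (a * x) = ennreal (2 / pi\<^sup>2) * ennreal (legendre_chi 3 (a * x))"
          using legendre_chi_3_nonneg[of "a * x"] by (simp only: cos_ratio_mean_le_1) (rule ennreal_mult, auto)
        then show ?thesis using True by (simp add: f1_def mult_ac)
      qed (auto simp: f1_def)
    qed
    also have "\<dots> = ennreal (2 / pi\<^sup>2) * (\<integral>\<^sup>+x\<in>{0..1 / a}. ennreal (legendre_chi 3 (x / (1 / a))) * ennreal (tan_kernel x) \<partial>lborel)"
      by (rule nn_integral_cmult) auto
    also have "\<dots> = ennreal (2 / pi\<^sup>2) * ennreal (I / 2)" using A(1) by simp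
    finally show ?thesis by (subst nn_integral_tan_tan) auto
  qed
  also have "(\<integral>\<^sup>+v. \<integral>\<^sup>+w. f2 (tan v * tan w) \<partial>?U \<partial>?U) = ennreal (4 / pi\<^sup>2) * (ennreal H + ennreal (2 / pi\<^sup>2) * ennreal (I' / 2))"
  proof -
    have "(\<integral>\<^sup>+x\<in>{0..}. f2 (1 / x) * ennreal (tan_kernel x) \<partial>lborel) =
        (\<integral>\<^sup>+x. ennreal (ln (a / x)) * ennreal (tan_kernel x) * indicator {0..a} x +
           ennreal (2 / pi\<^sup>2) * (ennreal (legendre_chi 3 (x / a)) * ennreal (tan_kernel x) * indicator {0..a} x) \<partial>lborel)"
      using AE_lborel_singleton[of 0] AE_lborel_singleton[of a]
    proof (intro nn_integral_cong_AE, eventually_elim)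
      fix x :: real assume ne: "x \<noteq> 0" "x \<noteq> a"
      show "f2 (1 / x) * ennreal (tan_kernel x) * indicator {0..} x =
        ennreal (ln (a / x)) * ennreal (tan_kernel x) * indicator {0..a} x +
           ennreal (2 / pi\<^sup>2) * (ennreal (legendre_chi 3 (x / a)) * ennreal (tan_kernel x) * indicator {0..a} x)"
      proof (cases "x \<in> {0..a}")
        case True
        then have x: "0 < x" "x < a" using ne by auto
        then have "1 / a < 1 / x" using a by (intro divide_strict_left_mono) auto
        then have "f2 (1 / x) = cos_ratio_mean (a / x)" by (simp add: f2_def)
        also have "\<dots> = ennreal (ln (a / x)) + cos_ratio_mean (1 / (a / x))"
          using x by (intro cos_ratio_mean_ge_1) auto
        also have "cos_ratio_mean (1 / (a / x)) = ennreal (2 / pi\<^sup>2) * ennreal (legendre_chi 3 (x / a))"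
        proof -
          have "0 \<le> x / a" "x / a \<le> 1" using x by auto
          then have "cos_ratio_mean (x / a) = ennreal (2 / pi\<^sup>2) * ennreal (legendre_chi 3 (x / a))"
            using legendre_chi_3_nonneg[of "x / a"] by (simp only: cos_ratio_mean_le_1) (rule ennreal_mult, auto)
          then show ?thesis by simp
        qed
        finally show ?thesis using True by (simp add: distrib_left distrib_right mult_ac)
      next
        case False
        show ?thesis
        proof (cases "x > a")
          case True
          then have "1 / x \<le> 1 / a" using a by (intro divide_left_mono) auto
          then show ?thesis using False by (simp add: f2_def)
        qed (use False in auto)
      qed
    qed
    also have "\<dots> = (\<integral>\<^sup>+x\<in>{0..a}. ennreal (ln (a / x)) * ennreal (tan_kernel x) \<partial>lborel) +
        ennreal (2 / pi\<^sup>2) * (\<integral>\<^sup>+x\<in>{0..a}. ennreal (legendre_chi 3 (x / a)) * ennreal (tan_kernel x) \<partial>lborel)"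
      by (simp add: nn_integral_add nn_integral_cmult)
    also have "\<dots> = ennreal H + ennreal (2 / pi\<^sup>2) * ennreal (I' / 2)" by (simp only: B(1) C(1))
    finally have "(\<integral>\<^sup>+x\<in>{0..}. f2 (1 / x) * ennreal (tan_kernel x) \<partial>lborel) = \<dots>" .
    then show ?thesis
      by (subst nn_integral_tan_tan_reflect) (auto simp: nn_integral_tan_tan[of "\<lambda>x. f2 (1 / x)"])
  qed
  also have "ennreal (4 / pi\<^sup>2) * (ennreal (2 / pi\<^sup>2) * ennreal (I / 2)) +
       ennreal (4 / pi\<^sup>2) * (ennreal H + ennreal (2 / pi\<^sup>2) * ennreal (I' / 2)) =
     ennreal (4 / pi\<^sup>2 * (2 / pi\<^sup>2 * (I / 2)) + 4 / pi\<^sup>2 * (H + 2 / pi\<^sup>2 * (I' / 2)))"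
    using A(2) B(2) C(2)
    by (simp only: ennreal_mult'[symmetric] ennreal_plus[symmetric] divide_nonneg_nonneg mult_nonneg_nonneg
          zero_le_numeral zero_le_power2 add_nonneg_nonneg)
  also have "4 / pi\<^sup>2 * (2 / pi\<^sup>2 * (I / 2)) + 4 / pi\<^sup>2 * (H + 2 / pi\<^sup>2 * (I' / 2)) = 4 / pi ^ 4 * (I + I') + 4 / pi\<^sup>2 * H"
    by (simp add: field_simps power2_eq_square power4_eq_xxxx)
  finally show "(\<integral>\<^sup>+v. \<integral>\<^sup>+w. cos_ratio_mean (a * (tan v * tan w)) \<partial>?U \<partial>?U) =
           ennreal (4 / pi ^ 4 * (I + I') + 4 / pi\<^sup>2 * H)" .
qed

section \<open>The Mahler measure as a mean\<close>

text \<open>Tonelli's theorem in the last coordinate; the factor $L$ passes from Lebesgue measure to the mean.\<close>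

lemma nn_integral_PiE_Suc:
  fixes F :: "(nat \<Rightarrow> real) \<Rightarrow> ennreal"
  assumes F: "F \<in> borel_measurable (\<Pi>\<^sub>M j\<in>{..<Suc n}. lborel)" and L: "L > 0"
  shows "(\<integral>\<^sup>+t\<in>(\<Pi>\<^sub>E j\<in>{..<Suc n}. {0..L}). F t \<partial>(\<Pi>\<^sub>M j\<in>{..<Suc n}. lborel)) =
     ennreal L * (\<integral>\<^sup>+t\<in>(\<Pi>\<^sub>E j\<in>{..<n}. {0..L}). (\<integral>\<^sup>+y. F (t(n := y)) \<partial>unif L) \<partial>(\<Pi>\<^sub>M j\<in>{..<n}. lborel))"
    and "(\<lambda>t. \<integral>\<^sup>+y. F (t(n := y)) \<partial>unif L) \<in> borel_measurable (\<Pi>\<^sub>M j\<in>{..<n}. lborel)"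
proof -
  interpret product_sigma_finite "\<lambda>_::nat. lborel :: real measure"
    by standard
  let ?M = "\<lambda>n. \<Pi>\<^sub>M j\<in>{..<n}. (lborel :: real measure)"
  have ins: "{..<Suc n} = insert n {..<n}" by auto
  have F': "F \<in> borel_measurable (Pi\<^sub>M (insert n {..<n}) (\<lambda>_. lborel))" using F unfolding ins .
  have up: "(\<lambda>(t, y). t(n := y)) \<in> measurable (?M n \<Otimes>\<^sub>M lborel) (Pi\<^sub>M (insert n {..<n}) (\<lambda>_. lborel))"
    by (rule measurable_add_dim)
  from measurable_compose[OF this F']
  have m: "(\<lambda>(t, y). F (t(n := y))) \<in> borel_measurable (?M n \<Otimes>\<^sub>M lborel)"
    by (simp add: case_prod_unfold)
  have mt: "(\<lambda>y. F (t(n := y))) \<in> borel_measurable borel" if "t \<in> space (?M n)" for t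
    using measurable_compose[OF measurable_Pair1'[OF that] m] by simp
  have "sets (?M n \<Otimes>\<^sub>M unif L) = sets (?M n \<Otimes>\<^sub>M lborel)" by (intro sets_pair_measure_cong) auto
  then have "(\<lambda>(t, y). F (t(n := y))) \<in> borel_measurable (?M n \<Otimes>\<^sub>M unif L)"
    using m measurable_cong_sets by blast
  then show mU: "(\<lambda>t. \<integral>\<^sup>+y. F (t(n := y)) \<partial>unif L) \<in> borel_measurable (?M n)"
    by (rule sigma_finite_measure.borel_measurable_nn_integral[OF sigma_finite_unif[OF L]])
  have PiE: "(\<Pi>\<^sub>E j\<in>{..<k}. {0..L}) \<in> sets (?M k)" for k :: nat by (intro sets_PiM_I_finite) auto
  have "(\<integral>\<^sup>+t\<in>(\<Pi>\<^sub>E j\<in>{..<Suc n}. {0..L}). F t \<partial>?M (Suc n)) =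
     (\<integral>\<^sup>+t. (\<integral>\<^sup>+y. F (t(n := y)) * indicator (\<Pi>\<^sub>E j\<in>{..<Suc n}. {0..L}) (t(n := y)) \<partial>lborel) \<partial>?M n)"
    unfolding ins
    by (rule product_nn_integral_insert) (use F' PiE[of "Suc n"] in \<open>auto simp: ins\<close>)
  also have "\<dots> = (\<integral>\<^sup>+t. ennreal L * ((\<integral>\<^sup>+y. F (t(n := y)) \<partial>unif L) * indicator (\<Pi>\<^sub>E j\<in>{..<n}. {0..L}) t) \<partial>?M n)"
  proof (rule nn_integral_cong)
    fix t assume t: "t \<in> space (?M n)"
    then have ext: "t \<in> extensional {..<n}" by (auto simp: space_PiM PiE_def)
    have ind: "indicator (\<Pi>\<^sub>E j\<in>{..<Suc n}. {0..L}) (t(n := y)) = (indicator (\<Pi>\<^sub>E j\<in>{..<n}. {0..L}) t * indicator {0..L} y :: ennreal)" for y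
    proof -
      have "t(n := y) \<in> (\<Pi>\<^sub>E j\<in>{..<Suc n}. {0..L}) \<longleftrightarrow> t \<in> (\<Pi>\<^sub>E j\<in>{..<n}. {0..L}) \<and> y \<in> {0..L}"
        using ext by (fastforce simp: PiE_def Pi_def extensional_def less_Suc_eq)
      then show ?thesis by (simp add: indicator_def)
    qed
    have "(\<integral>\<^sup>+y. F (t(n := y)) * indicator (\<Pi>\<^sub>E j\<in>{..<Suc n}. {0..L}) (t(n := y)) \<partial>lborel)
       = (\<integral>\<^sup>+y. indicator (\<Pi>\<^sub>E j\<in>{..<n}. {0..L}) t * (F (t(n := y)) * indicator {0..L} y) \<partial>lborel)"
      by (simp add: ind mult_ac)
    also have "\<dots> = indicator (\<Pi>\<^sub>E j\<in>{..<n}. {0..L}) t * (\<integral>\<^sup>+y\<in>{0..L}. F (t(n := y)) \<partial>lborel)"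
      using mt[OF t] by (intro nn_integral_cmult) auto
    also have "(\<integral>\<^sup>+y\<in>{0..L}. F (t(n := y)) \<partial>lborel) = ennreal L * (\<integral>\<^sup>+y. F (t(n := y)) \<partial>unif L)"
    proof -
      have "ennreal L * (\<integral>\<^sup>+y. F (t(n := y)) \<partial>unif L) = ennreal L * ennreal (1 / L) * (\<integral>\<^sup>+y\<in>{0..L}. F (t(n := y)) \<partial>lborel)"
        using mt[OF t] L by (simp add: nn_integral_unif mult.assoc)
      also have "ennreal L * ennreal (1 / L) = 1" using L by (simp flip: ennreal_mult)
      finally show ?thesis by (simp only: mult_1_left)
    qed
    finally show "(\<integral>\<^sup>+y. F (t(n := y)) * indicator (\<Pi>\<^sub>E j\<in>{..<Suc n}. {0..L}) (t(n := y)) \<partial>lborel) =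
       ennreal L * ((\<integral>\<^sup>+y. F (t(n := y)) \<partial>unif L) * indicator (\<Pi>\<^sub>E j\<in>{..<n}. {0..L}) t)"
      by (simp only: mult_ac)
  qed
  also have "\<dots> = ennreal L * (\<integral>\<^sup>+t\<in>(\<Pi>\<^sub>E j\<in>{..<n}. {0..L}). (\<integral>\<^sup>+y. F (t(n := y)) \<partial>unif L) \<partial>?M n)"
    using mU PiE by (intro nn_integral_cmult) auto
  finally show "(\<integral>\<^sup>+t\<in>(\<Pi>\<^sub>E j\<in>{..<Suc n}. {0..L}). F t \<partial>?M (Suc n)) = \<dots>" .
qed

lemma nn_integral_PiE_5:
  fixes F :: "(nat \<Rightarrow> real) \<Rightarrow> ennreal"
  assumes F: "F \<in> borel_measurable (\<Pi>\<^sub>M j\<in>{..<5}. lborel)" and L: "L > 0"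
  shows "(\<integral>\<^sup>+t\<in>(\<Pi>\<^sub>E j\<in>{..<5}. {0..L}). F t \<partial>(\<Pi>\<^sub>M j\<in>{..<5}. lborel)) =
     ennreal (L ^ 5) * (\<integral>\<^sup>+v. \<integral>\<^sup>+w. \<integral>\<^sup>+x. \<integral>\<^sup>+y. \<integral>\<^sup>+z.
       F ((\<lambda>_. undefined)(0 := v, 1 := w, 2 := x, 3 := y, 4 := z)) \<partial>unif L \<partial>unif L \<partial>unif L \<partial>unif L \<partial>unif L)"
proof -
  interpret product_sigma_finite "\<lambda>_::nat. lborel :: real measure"
    by standard
  have n: "5 = Suc 4" "4 = Suc 3" "3 = Suc 2" "2 = Suc 1" "1 = Suc 0" by simp_all
  note s5 = nn_integral_PiE_Suc[where n = 4, folded n, OF F L]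
  note s4 = nn_integral_PiE_Suc[where n = 3, folded n, OF s5(2) L]
  note s3 = nn_integral_PiE_Suc[where n = 2, folded n, OF s4(2) L]
  note s2 = nn_integral_PiE_Suc[where n = 1, folded n, OF s3(2) L]
  note s1 = nn_integral_PiE_Suc[where n = 0, folded n, OF s2(2) L]
  have z: "(\<integral>\<^sup>+t\<in>(\<Pi>\<^sub>E j\<in>{..<0}. {0..L}). G t \<partial>(\<Pi>\<^sub>M j\<in>{..<0}. (lborel :: real measure))) = G (\<lambda>_. undefined)"
    for G :: "(nat \<Rightarrow> real) \<Rightarrow> ennreal"
    by (simp add: PiM_empty nn_integral_count_space_finite)
  have "ennreal (L ^ 5) = ennreal L * (ennreal L * (ennreal L * (ennreal L * ennreal L)))"
    using L by (simp add: ennreal_mult'[symmetric] numeral_eq_Suc)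
  then show ?thesis unfolding s5(1) s4(1) s3(1) s2(1) s1(1) z by (simp add: mult.assoc)
qed

text \<open>By Euler's integral each $\ln |1 + v|$ has mean 0; the summand $3 \ln 2$ is there to keep all
three pieces $\ln 2 - \ln |1 + v|$ nonnegative.\<close>

lemma nn_integral_unif_neg_ln_norm:
  "(\<integral>\<^sup>+v. \<integral>\<^sup>+w. \<integral>\<^sup>+x. ennreal (K + 3 * ln 2 - ln (norm ((1 + cis v) * (1 + cis w) * (1 + cis x))))
     \<partial>unif (2 * pi) \<partial>unif (2 * pi) \<partial>unif (2 * pi)) = ennreal (K + 3 * ln 2)" if K: "K \<ge> 0"
proof -
  let ?U = "unif (2 * pi)"
  define l where "l = (\<lambda>v. ln 2 - ln (norm (1 + cis v)))"
  have [measurable]: "l \<in> borel_measurable borel" unfolding l_def by measurable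
  have l: "l v \<ge> 0" for v
  proof (cases "1 + cis v = 0")
    case False
    have "norm (1 + cis v) \<le> 2" using norm_triangle_ineq[of 1 "cis v"] by simp
    then show ?thesis using False by (simp add: l_def)
  qed (simp add: l_def)
  have il: "(\<integral>\<^sup>+v. ennreal (l v) \<partial>?U) = ennreal (ln 2)" unfolding l_def by (rule nn_integral_ln_one_plus_cis)
  have "(\<integral>\<^sup>+v. \<integral>\<^sup>+w. \<integral>\<^sup>+x. ennreal (K + 3 * ln 2 - ln (norm ((1 + cis v) * (1 + cis w) * (1 + cis x)))) \<partial>?U \<partial>?U \<partial>?U)
     = (\<integral>\<^sup>+v. \<integral>\<^sup>+w. \<integral>\<^sup>+x. (ennreal K + ennreal (l v) + ennreal (l w)) + ennreal (l x) \<partial>?U \<partial>?U \<partial>?U)"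
  proof (intro nn_integral_cong_AE AE_unifI[where S = "{pi}"])
    fix v w x :: real
    assume "0 \<le> v" "v \<le> 2 * pi" "v \<notin> {pi}" "0 \<le> w" "w \<le> 2 * pi" "w \<notin> {pi}" "0 \<le> x" "x \<le> 2 * pi" "x \<notin> {pi}"
    then have "1 + cis v \<noteq> 0" "1 + cis w \<noteq> 0" "1 + cis x \<noteq> 0" by (simp_all add: one_plus_cis_nonzero)
    then have eq: "K + 3 * ln 2 - ln (norm ((1 + cis v) * (1 + cis w) * (1 + cis x))) = K + l v + l w + l x"
      by (simp add: l_def norm_mult ln_mult)
    show "ennreal (K + 3 * ln 2 - ln (norm ((1 + cis v) * (1 + cis w) * (1 + cis x))))
       = ennreal K + ennreal (l v) + ennreal (l w) + ennreal (l x)"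
      unfolding eq using K l by (simp add: ennreal_plus[symmetric] del: ennreal_plus)
  qed auto
  also have "\<dots> = ennreal K + ennreal (ln 2) + ennreal (ln 2) + ennreal (ln 2)"
    by (simp add: nn_integral_add il)
  also have "\<dots> = ennreal (K + 3 * ln 2)"
    using K by (simp add: ennreal_plus[symmetric] del: ennreal_plus)
  finally show ?thesis .
qed

text \<open>Shifting $z$ by $y$ replaces $y + z$ by $y (1 + z)$ on the torus; then the polynomial is linear in $y$.\<close>

lemma nn_integral_Jensen_pair:
  assumes A: "A \<noteq> 0" and K: "K \<ge> 0" "ln (norm A + 2 * norm B) \<le> K"
  shows "(\<integral>\<^sup>+y. \<integral>\<^sup>+z. ennreal (K - ln (norm (A + B * (cis y + cis z)))) \<partial>unif (2 * pi) \<partial>unif (2 * pi)) =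
     (\<integral>\<^sup>+z. ennreal (K - ln (max (norm A) (norm (B * (1 + cis z))))) \<partial>unif (2 * pi))"
proof -
  let ?U = "unif (2 * pi)"
  have "(\<integral>\<^sup>+y. \<integral>\<^sup>+z. ennreal (K - ln (norm (A + B * (cis y + cis z)))) \<partial>?U \<partial>?U) =
     (\<integral>\<^sup>+y. \<integral>\<^sup>+z. ennreal (K - ln (norm (A + B * (1 + cis z) * cis y))) \<partial>?U \<partial>?U)"
  proof (rule nn_integral_cong_AE, rule AE_unifI[where S = "{}"])
    fix y :: real assume y: "0 \<le> y" "y \<le> 2 * pi"
    define h where "h = (\<lambda>z. ennreal (K - ln (norm (A + B * (cis y + cis z)))))"
    have [measurable]: "h \<in> borel_measurable borel" unfolding h_def by measurable
    have "(\<integral>\<^sup>+z. h z \<partial>?U) = (\<integral>\<^sup>+z. h (z + y) \<partial>?U)"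
      by (rule nn_integral_unif_shift[symmetric]) (use y in \<open>auto simp: h_def cis_periodic\<close>)
    also have "\<dots> = (\<integral>\<^sup>+z. ennreal (K - ln (norm (A + B * (1 + cis z) * cis y))) \<partial>?U)"
      by (simp add: h_def cis_mult[symmetric] algebra_simps)
    finally show "(\<integral>\<^sup>+z. ennreal (K - ln (norm (A + B * (cis y + cis z)))) \<partial>?U) = \<dots>"
      by (simp add: h_def)
  qed auto
  also have "\<dots> = (\<integral>\<^sup>+z. \<integral>\<^sup>+y. ennreal (K - ln (norm (A + B * (1 + cis z) * cis y))) \<partial>?U \<partial>?U)"
    by (rule nn_integral_swap_borel) (auto intro!: sigma_finite_unif)
  also have "\<dots> = (\<integral>\<^sup>+z. ennreal (K - ln (max (norm A) (norm (B * (1 + cis z))))) \<partial>?U)"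
  proof (intro nn_integral_cong Jensen_linear A K)
    fix z :: real
    have "norm (1 + cis z) \<le> 2" using norm_triangle_ineq[of 1 "cis z"] by simp
    then have "norm (B * (1 + cis z)) \<le> 2 * norm B"
      using mult_left_mono[of "norm (1 + cis z)" 2 "norm B"] by (simp add: norm_mult mult.commute)
    moreover have "0 < norm A + norm (B * (1 + cis z))" using A by (simp add: add_pos_nonneg)
    ultimately have "ln (norm A + norm (B * (1 + cis z))) \<le> ln (norm A + 2 * norm B)" by (intro ln_mono) auto
    then show "ln (norm A + norm (B * (1 + cis z))) \<le> K" using K by linarith
  qed
  finally show ?thesis .
qed

lemma ln_max_eq:
  assumes "0 < p" "0 \<le> q"
  shows "ln (max p q) = ln p + ln_plus (q / p)"
proof (cases "q \<le> p")
  case True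
  have "ln (q / p) \<le> 0"
  proof (cases "q = 0")
    case False
    then show ?thesis using assms True by (subst ln_le_zero_iff) auto
  qed simp
  then show ?thesis using True by (simp add: ln_plus_def max_def)
next
  case False
  then have "0 \<le> ln (q / p)" using assms by (intro ln_ge_zero) auto
  then show ?thesis using assms False by (simp add: ln_plus_def max_def ln_div)
qed

text \<open>On the circle $|1 - v| / |1 + v|$ is the tangent, and $|1 + z|$ twice the cosine, of the half angle.\<close>

lemma nn_integral_ln_plus_circle:
  assumes a: "a > 0"
  shows "(\<integral>\<^sup>+v. \<integral>\<^sup>+w. \<integral>\<^sup>+x. \<integral>\<^sup>+z.
            ennreal (ln_plus (norm (of_real a * (1 - cis v) * (1 - cis w) * (1 + cis z)) / norm ((1 + cis v) * (1 + cis w) * (1 + cis x))))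
            \<partial>unif (2 * pi) \<partial>unif (2 * pi) \<partial>unif (2 * pi) \<partial>unif (2 * pi)) =
         (\<integral>\<^sup>+v. \<integral>\<^sup>+w. cos_ratio_mean (a * (tan v * tan w)) \<partial>unif (pi / 2) \<partial>unif (pi / 2))"
proof -
  let ?U = "unif (2 * pi)" and ?V = "unif (pi / 2)"
  interpret U: sigma_finite_measure "unif (2 * pi)" by (rule sigma_finite_unif) simp
  interpret V: sigma_finite_measure "unif (pi / 2)" by (rule sigma_finite_unif) simp
  define T where "T = (\<lambda>\<theta>::real. \<bar>sin (\<theta> / 2)\<bar> / \<bar>cos (\<theta> / 2)\<bar>)"
  define C where "C = (\<lambda>\<theta>::real. \<bar>cos (\<theta> / 2)\<bar>)"
  define f where "f = (\<lambda>v w x z. ennreal (ln_plus (a * (T v * T w) * C z / C x)))"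
  have [measurable]: "T \<in> borel_measurable borel" "C \<in> borel_measurable borel"
    unfolding T_def C_def by measurable
  have sym: "T (2 * pi - \<theta>) = T \<theta>" "C (2 * pi - \<theta>) = C \<theta>" for \<theta>
    by (simp_all add: T_def C_def diff_divide_distrib)
  have "norm (of_real a * (1 - cis v) * (1 - cis w) * (1 + cis z)) / norm ((1 + cis v) * (1 + cis w) * (1 + cis x))
     = a * (T v * T w) * C z / C x" for v w x z
    using a by (simp add: norm_mult norm_one_plus_cis norm_one_minus_cis T_def C_def)
  then have "(\<integral>\<^sup>+v. \<integral>\<^sup>+w. \<integral>\<^sup>+x. \<integral>\<^sup>+z.
            ennreal (ln_plus (norm (of_real a * (1 - cis v) * (1 - cis w) * (1 + cis z)) / norm ((1 + cis v) * (1 + cis w) * (1 + cis x))))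
            \<partial>?U \<partial>?U \<partial>?U \<partial>?U) = (\<integral>\<^sup>+v. \<integral>\<^sup>+w. \<integral>\<^sup>+x. \<integral>\<^sup>+z. f v w x z \<partial>?U \<partial>?U \<partial>?U \<partial>?U)"
    by (simp add: f_def)
  also have "\<dots> = (\<integral>\<^sup>+v. \<integral>\<^sup>+w. \<integral>\<^sup>+x. \<integral>\<^sup>+z. f v w x (2 * z) \<partial>?V \<partial>?U \<partial>?U \<partial>?U)"
    unfolding f_def by (intro nn_integral_cong nn_integral_circle_fold) (simp_all add: sym)
  also have "\<dots> = (\<integral>\<^sup>+v. \<integral>\<^sup>+w. \<integral>\<^sup>+x. \<integral>\<^sup>+z. f v w (2 * x) (2 * z) \<partial>?V \<partial>?V \<partial>?U \<partial>?U)"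
    unfolding f_def by (intro nn_integral_cong nn_integral_circle_fold) (simp_all add: sym)
  also have "\<dots> = (\<integral>\<^sup>+v. \<integral>\<^sup>+w. \<integral>\<^sup>+x. \<integral>\<^sup>+z. f v (2 * w) (2 * x) (2 * z) \<partial>?V \<partial>?V \<partial>?V \<partial>?U)"
    unfolding f_def by (intro nn_integral_cong nn_integral_circle_fold) (simp_all add: sym)
  also have "\<dots> = (\<integral>\<^sup>+v. \<integral>\<^sup>+w. \<integral>\<^sup>+x. \<integral>\<^sup>+z. f (2 * v) (2 * w) (2 * x) (2 * z) \<partial>?V \<partial>?V \<partial>?V \<partial>?V)"
    unfolding f_def by (intro nn_integral_circle_fold) (simp_all add: sym)
  also have "\<dots> = (\<integral>\<^sup>+v. \<integral>\<^sup>+w. \<integral>\<^sup>+x. \<integral>\<^sup>+z. ennreal (ln_plus (a * (tan v * tan w) * cos z / cos x)) \<partial>?V \<partial>?V \<partial>?V \<partial>?V)"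
  proof (intro nn_integral_cong_AE AE_unifI[where S = "{}"])
    fix v w x z :: real
    assume b: "0 \<le> v" "v \<le> pi / 2" "0 \<le> w" "w \<le> pi / 2" "0 \<le> x" "x \<le> pi / 2" "0 \<le> z" "z \<le> pi / 2"
    have C: "C (2 * t) = cos t" if "0 \<le> t" "t \<le> pi / 2" for t
      using that cos_ge_zero[of t] by (simp add: C_def)
    have T: "T (2 * t) = tan t" if "0 \<le> t" "t \<le> pi / 2" for t
      using that cos_ge_zero[of t] sin_ge_zero[of t] by (simp add: T_def tan_def)
    show "f (2 * v) (2 * w) (2 * x) (2 * z) = ennreal (ln_plus (a * (tan v * tan w) * cos z / cos x))"
      using b by (simp add: f_def C T)
  qed auto
  also have "\<dots> = (\<integral>\<^sup>+v. \<integral>\<^sup>+w. cos_ratio_mean (a * (tan v * tan w)) \<partial>?V \<partial>?V)"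
    by (simp only: cos_ratio_mean_swap)
  finally show ?thesis .
qed

text \<open>The constant $K$ bounds $\ln |P|$ on the torus. With $p$ the modulus of the product
$(1+v)(1+w)(1+x)$ and $q$ that of $a(1-v)(1-w)(1+z)$,
$\ln \max (p, q) = \ln p + \ln^+ (q/p)$, and $\ln p$ has mean 0. Thus the mean of
$K - \ln \max (p, q)$ and the mean $e$ of $\ln^+ (q/p)$ add up to $K$.\<close>

lemma nn_integral_mahler_deficit:
  assumes a: "a > 0" and e: "e \<ge> 0"
    and E: "(\<integral>\<^sup>+v. \<integral>\<^sup>+w. cos_ratio_mean (a * (tan v * tan w)) \<partial>unif (pi / 2) \<partial>unif (pi / 2)) = ennreal e"
  defines "K \<equiv> ln (1 + a) + 3 * ln 2"
  shows "(\<integral>\<^sup>+v. \<integral>\<^sup>+w. \<integral>\<^sup>+x. \<integral>\<^sup>+y. \<integral>\<^sup>+z.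
            ennreal (K - ln (norm ((1 + cis v) * (1 + cis w) * (1 + cis x) + of_real a * (1 - cis v) * (1 - cis w) * (cis y + cis z))))
            \<partial>unif (2 * pi) \<partial>unif (2 * pi) \<partial>unif (2 * pi) \<partial>unif (2 * pi) \<partial>unif (2 * pi)) = ennreal (K - e)"
    and "e \<le> K"
proof -
  let ?U = "unif (2 * pi)"
  interpret U: sigma_finite_measure "unif (2 * pi)" by (rule sigma_finite_unif) simp
  define A where "A = (\<lambda>v w x. (1 + cis v) * (1 + cis w) * (1 + cis x))"
  define B where "B = (\<lambda>v w. of_real a * (1 - cis v) * (1 - cis w))"
  have [measurable]: "(\<lambda>p. A (f p) (g p) (h p)) \<in> borel_measurable M"
      if "f \<in> borel_measurable M" "g \<in> borel_measurable M" "h \<in> borel_measurable M" for f g h and M :: "'z measure"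
    using that unfolding A_def by measurable
  have [measurable]: "(\<lambda>p. B (f p) (g p)) \<in> borel_measurable M"
      if "f \<in> borel_measurable M" "g \<in> borel_measurable M" for f g and M :: "'z measure"
    using that unfolding B_def by measurable
  have K0: "K \<ge> 0" using a by (simp add: K_def)
  have le2: "norm (1 + cis v) \<le> 2" "norm (1 - cis v) \<le> 2" for v
    using norm_triangle_ineq[of 1 "cis v"] norm_triangle_ineq4[of 1 "cis v"] by auto
  have KA: "ln (norm (A v w x) + 2 * norm (B v w)) \<le> K" if "A v w x \<noteq> 0" for v w x
  proof -
    have "norm (A v w x) \<le> 2 * 2 * 2" unfolding A_def norm_mult by (intro mult_mono le2) auto
    moreover have "norm (B v w) \<le> a * 2 * 2" unfolding B_def norm_mult using a by (intro mult_mono le2) auto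
    ultimately have "norm (A v w x) + 2 * norm (B v w) \<le> (1 + a) * 2 ^ 3" by (simp add: algebra_simps)
    moreover have "0 < norm (A v w x) + 2 * norm (B v w)" using that by (simp add: add_pos_nonneg)
    ultimately have "ln (norm (A v w x) + 2 * norm (B v w)) \<le> ln ((1 + a) * 2 ^ 3)" by (intro ln_mono) auto
    also have "\<dots> = K" using a ln_mult[of "1 + a" "2 ^ 3"] ln_realpow[of 2 3] by (simp add: K_def)
    finally show ?thesis .
  qed
  define G where "G = (\<integral>\<^sup>+v. \<integral>\<^sup>+w. \<integral>\<^sup>+x. \<integral>\<^sup>+z. ennreal (K - ln (max (norm (A v w x)) (norm (B v w * (1 + cis z))))) \<partial>?U \<partial>?U \<partial>?U \<partial>?U)"
  have G: "(\<integral>\<^sup>+v. \<integral>\<^sup>+w. \<integral>\<^sup>+x. \<integral>\<^sup>+y. \<integral>\<^sup>+z.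
            ennreal (K - ln (norm (A v w x + B v w * (cis y + cis z)))) \<partial>?U \<partial>?U \<partial>?U \<partial>?U \<partial>?U) = G"
    unfolding G_def
    apply (rule nn_integral_cong_AE, rule AE_unifI[where S = "{pi}"])
     apply (rule nn_integral_cong_AE, rule AE_unifI[where S = "{pi}"])
      apply (rule nn_integral_cong_AE, rule AE_unifI[where S = "{pi}"])
       apply (rule nn_integral_Jensen_pair[OF _ K0 KA])
    by (simp_all add: A_def one_plus_cis_nonzero)
  have "G + ennreal e = G + (\<integral>\<^sup>+v. \<integral>\<^sup>+w. \<integral>\<^sup>+x. \<integral>\<^sup>+z. ennreal (ln_plus (norm (B v w * (1 + cis z)) / norm (A v w x))) \<partial>?U \<partial>?U \<partial>?U \<partial>?U)"
    unfolding E[symmetric] nn_integral_ln_plus_circle[OF a, symmetric] A_def B_def ..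
  also have "\<dots> = (\<integral>\<^sup>+v. \<integral>\<^sup>+w. \<integral>\<^sup>+x. \<integral>\<^sup>+z. ennreal (K - ln (max (norm (A v w x)) (norm (B v w * (1 + cis z)))))
        + ennreal (ln_plus (norm (B v w * (1 + cis z)) / norm (A v w x))) \<partial>?U \<partial>?U \<partial>?U \<partial>?U)"
    unfolding G_def by (simp add: nn_integral_add)
  also have "\<dots> = (\<integral>\<^sup>+v. \<integral>\<^sup>+w. \<integral>\<^sup>+x. \<integral>\<^sup>+z. ennreal (K - ln (norm (A v w x))) \<partial>?U \<partial>?U \<partial>?U \<partial>?U)"
  proof (intro nn_integral_cong_AE AE_unifI[where S = "{pi}"])
    fix v w x z :: real
    assume "0 \<le> v" "v \<le> 2 * pi" "v \<notin> {pi}" "0 \<le> w" "w \<le> 2 * pi" "w \<notin> {pi}" "0 \<le> x" "x \<le> 2 * pi" "x \<notin> {pi}"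
    then have nz: "A v w x \<noteq> 0" by (simp add: A_def one_plus_cis_nonzero)
    let ?p = "norm (A v w x)" and ?q = "norm (B v w * (1 + cis z))"
    have "?q \<le> 2 * norm (B v w)"
      using mult_left_mono[OF le2(1)[of z], of "norm (B v w)"] by (simp add: norm_mult mult.commute)
    then have "max ?p ?q \<le> ?p + 2 * norm (B v w)"
      using norm_ge_zero[of "A v w x"] norm_ge_zero[of "B v w"] by linarith
    moreover have "0 < max ?p ?q" using nz by (simp add: less_max_iff_disj)
    ultimately have "ln (max ?p ?q) \<le> ln (?p + 2 * norm (B v w))" by (intro ln_mono) auto
    also have "\<dots> \<le> K" by (rule KA[OF nz])
    finally have "0 \<le> K - ln (max ?p ?q)" by simp
    moreover have "ln (max ?p ?q) = ln ?p + ln_plus (?q / ?p)" using nz by (intro ln_max_eq) auto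
    ultimately show "ennreal (K - ln (max ?p ?q)) + ennreal (ln_plus (?q / ?p)) = ennreal (K - ln ?p)"
      by (simp add: ennreal_plus[symmetric] del: ennreal_plus)
  qed auto
  also have "\<dots> = ennreal K"
    using nn_integral_unif_neg_ln_norm[of "ln (1 + a)"] a by (simp add: A_def K_def)
  finally have GE: "G + ennreal e = ennreal K" .
  show "e \<le> K"
  proof -
    have "ennreal e \<le> ennreal K" unfolding GE[symmetric] by simp
    then show ?thesis using K0 by simp
  qed
  have "G = ennreal K - ennreal e" unfolding GE[symmetric] by (simp add: ennreal_add_diff_cancel_right)
  also have "\<dots> = ennreal (K - e)" using e by (simp add: ennreal_minus)
  finally show "(\<integral>\<^sup>+v. \<integral>\<^sup>+w. \<integral>\<^sup>+x. \<integral>\<^sup>+y. \<integral>\<^sup>+z.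
            ennreal (K - ln (norm ((1 + cis v) * (1 + cis w) * (1 + cis x) + of_real a * (1 - cis v) * (1 - cis w) * (cis y + cis z))))
            \<partial>?U \<partial>?U \<partial>?U \<partial>?U \<partial>?U) = ennreal (K - e)"
    unfolding G[symmetric] A_def B_def .
qed

lemma mahler_measure_eq:
  assumes a: "a > 0" and e: "e \<ge> 0"
    and E: "(\<integral>\<^sup>+v. \<integral>\<^sup>+w. cos_ratio_mean (a * (tan v * tan w)) \<partial>unif (pi / 2) \<partial>unif (pi / 2)) = ennreal e"
  shows "mahler_measure 5
              (\<lambda>t. let v = t 0; w = t 1; x = t 2; y = t 3; z = t 4
                   in (1 + v) * (1 + w) * (1 + x)
                      + complex_of_real a * (1 - v) * (1 - w) * (y + z)) = e"
proof -
  let ?M = "\<Pi>\<^sub>M j\<in>{..<5::nat}. (lborel :: real measure)" and ?S = "\<Pi>\<^sub>E j\<in>{..<5::nat}. {0..2 * pi}"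
  define f where "f = (\<lambda>t::nat \<Rightarrow> real. ln (cmod ((1 + cis (t 0)) * (1 + cis (t 1)) * (1 + cis (t 2))
                      + complex_of_real a * (1 - cis (t 0)) * (1 - cis (t 1)) * (cis (t 3) + cis (t 4)))))"
  define K where "K = ln (1 + a) + 3 * ln 2"
  note D = nn_integral_mahler_deficit[OF a e E, folded K_def]
  have K0: "K \<ge> 0" using a by (simp add: K_def)
  have [measurable]: "(\<lambda>t. t j) \<in> borel_measurable ?M" if "j < 5" for j
    using measurable_component_singleton[of j "{..<5}" "\<lambda>_. lborel"] that by simp
  have [measurable]: "f \<in> borel_measurable ?M" unfolding f_def by measurable
  have [measurable]: "?S \<in> sets ?M" by (intro sets_PiM_I_finite) auto
  have le: "f t \<le> K" for t
  proof (cases "(1 + cis (t 0)) * (1 + cis (t 1)) * (1 + cis (t 2))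
                      + complex_of_real a * (1 - cis (t 0)) * (1 - cis (t 1)) * (cis (t 3) + cis (t 4)) = 0")
    case False
    have le2: "norm (1 + cis v) \<le> 2" "norm (1 - cis v) \<le> 2" "norm (cis v + cis w) \<le> 2" for v w
      using norm_triangle_ineq[of 1 "cis v"] norm_triangle_ineq4[of 1 "cis v"] norm_triangle_ineq[of "cis v" "cis w"] by auto
    have "norm ((1 + cis (t 0)) * (1 + cis (t 1)) * (1 + cis (t 2))
                      + complex_of_real a * (1 - cis (t 0)) * (1 - cis (t 1)) * (cis (t 3) + cis (t 4)))
       \<le> norm ((1 + cis (t 0)) * (1 + cis (t 1)) * (1 + cis (t 2)))
         + norm (complex_of_real a * (1 - cis (t 0)) * (1 - cis (t 1)) * (cis (t 3) + cis (t 4)))"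
      by (rule norm_triangle_ineq)
    also have "\<dots> \<le> 2 * 2 * 2 + a * 2 * 2 * 2"
      unfolding norm_mult using a by (intro add_mono mult_mono le2) auto
    also have "\<dots> = (1 + a) * 2 ^ 3" by simp
    finally have "f t \<le> ln ((1 + a) * 2 ^ 3)" unfolding f_def using False by (intro ln_mono) auto
    also have "\<dots> = K" using a ln_mult[of "1 + a" "2 ^ 3"] ln_realpow[of 2 3] by (simp add: K_def)
    finally show ?thesis .
  qed (use K0 in \<open>simp add: f_def\<close>)
  have pos: "0 \<le> (2 * pi) ^ 5" by simp
  \<comment> \<open>Only the deficit $K - f$ is known to be integrable so far; subtracting it from $K$ recovers $f$.\<close>
  have i1: "has_bochner_integral ?M (\<lambda>t. indicator ?S t * (K - f t)) ((2 * pi) ^ 5 * (K - e))"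
  proof (rule has_bochner_integral_nn_integral)
    have "(\<integral>\<^sup>+t. ennreal (indicator ?S t * (K - f t)) \<partial>?M) = (\<integral>\<^sup>+t\<in>?S. ennreal (K - f t) \<partial>?M)"
      by (intro nn_integral_cong) (auto simp: indicator_def)
    also have "\<dots> = ennreal ((2 * pi) ^ 5) * ennreal (K - e)"
      by (subst nn_integral_PiE_5) (auto simp: f_def D(1))
    finally show "(\<integral>\<^sup>+t. ennreal (indicator ?S t * (K - f t)) \<partial>?M) = ennreal ((2 * pi) ^ 5 * (K - e))"
      by (simp only: ennreal_mult'[OF pos])
  qed (use le D(2) in \<open>auto simp: indicator_def\<close>)
  have i2: "has_bochner_integral ?M (\<lambda>t. indicator ?S t * K) ((2 * pi) ^ 5 * K)"
  proof (rule has_bochner_integral_nn_integral)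
    have "(\<integral>\<^sup>+t. ennreal (indicator ?S t * K) \<partial>?M) = (\<integral>\<^sup>+t\<in>?S. ennreal K \<partial>?M)"
      by (intro nn_integral_cong) (auto simp: indicator_def)
    also have "\<dots> = ennreal ((2 * pi) ^ 5) * ennreal K"
      by (subst nn_integral_PiE_5) auto
    finally show "(\<integral>\<^sup>+t. ennreal (indicator ?S t * K) \<partial>?M) = ennreal ((2 * pi) ^ 5 * K)"
      by (simp only: ennreal_mult'[OF pos])
  qed (use K0 in \<open>auto simp: indicator_def\<close>)
  from has_bochner_integral_diff[OF i2 i1]
  have "has_bochner_integral ?M (\<lambda>t. indicator ?S t *\<^sub>R f t) ((2 * pi) ^ 5 * e)"
    by (simp add: algebra_simps)
  then have "(LINT t:?S|?M. f t) = (2 * pi) ^ 5 * e"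
    unfolding set_lebesgue_integral_def by (rule has_bochner_integral_integral_eq)
  then show ?thesis by (simp add: mahler_measure_def Let_def f_def)
qed

theorem theorem19:
  fixes a :: real
  assumes "a > 0"
  shows "complex_of_real
           (pi ^ 4 *
            mahler_measure 5
              (\<lambda>t. let v = t 0; w = t 1; x = t 2; y = t 3; z = t 4
                   in (1 + v) * (1 + w) * (1 + x)
                      + complex_of_real a * (1 - v) * (1 - w) * (y + z)))
         = 4 * complex_of_real (pi ^ 2) * L1 a 3 1
           - 2 * complex_of_real (pi ^ 2) * L1_log a 2 1
           + 4 * (L2 a 3 2 1 1 + L2_log a 3 1 1 1)"
proof -
  obtain I where I: "((\<lambda>t. legendre_chi 3 t * (ln t - ln a) * (2 * a / (t ^ 2 - a ^ 2))) has_integral I) {0..1}"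
    "S2 3 2 a 1 1 + of_real (ln a) * S2 3 1 a 1 1 = of_real I"
    using S2_eq_integral[OF assms] .
  have "1 / a > 0" using assms by simp
  then obtain I' where I': "((\<lambda>t. legendre_chi 3 t * (ln t - ln (1 / a)) * (2 * (1 / a) / (t ^ 2 - (1 / a) ^ 2))) has_integral I') {0..1}"
    "S2 3 2 (1 / a) 1 1 + of_real (ln (1 / a)) * S2 3 1 (1 / a) 1 1 = of_real I'"
    using S2_eq_integral by blast
  obtain H where H: "((\<lambda>t. - ln t * (ln t + ln a) * (a / ((a * t) ^ 2 - 1))) has_integral H) {0..1}"
    "L1 a 3 1 - L1_log a 2 1 / 2 = of_real H"
    using L1_eq_integral[OF assms] .
  note E = nn_integral_cos_ratio_mean_tan_tan[OF assms I(1) I'(1) H(1)]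
  have "pi ^ 4 * (4 / pi ^ 4 * (I + I') + 4 / pi\<^sup>2 * H) = 4 * (I + I') + 4 * pi\<^sup>2 * H"
    by (simp add: field_simps power2_eq_square power4_eq_xxxx)
  then have "complex_of_real
           (pi ^ 4 *
            mahler_measure 5
              (\<lambda>t. let v = t 0; w = t 1; x = t 2; y = t 3; z = t 4
                   in (1 + v) * (1 + w) * (1 + x)
                      + complex_of_real a * (1 - v) * (1 - w) * (y + z)))
      = complex_of_real (4 * (I + I') + 4 * pi\<^sup>2 * H)"
    by (simp only: mahler_measure_eq[OF assms E(2,1)])
  also have "\<dots> = 4 * (of_real I + of_real I') + 4 * complex_of_real (pi\<^sup>2) * of_real H" by simp
  also have "\<dots> = 4 * complex_of_real (pi ^ 2) * L1 a 3 1
           - 2 * complex_of_real (pi ^ 2) * L1_log a 2 1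
           + 4 * (L2 a 3 2 1 1 + L2_log a 3 1 1 1)"
    unfolding I(2)[symmetric] I'(2)[symmetric] H(2)[symmetric] L2_def L2_log_def
    by (simp add: algebra_simps)
  finally show ?thesis .
qed

end
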